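(* Let $(G,\mu)$ be a weighted graph, let $\{Y_n\}_{n\ge0}$ be the switch-walk-switch lamplighter walk on $\mathbb{Z}_2\wr G$, and let $d_{\mathbb{Z}_2\wr G}$ be the graph distance on $\mathbb{Z}_2\wr G$. (I) Assume the $p_0$-condition, the $d_f$-set condition and the sub-Gaussian heat kernel estimates hold, and that $d_s/2<1$, where $d_s/2=d_f/d_w$. Then there exist (non-random) constants $c_1,c_2,c_3,c_4>0$ such that for all $\boldsymbol{x}\in V(\mathbb{Z}_2\wr G)$: $$c_1\le\limsup_{n\to\infty}\frac{d_{\mathbb{Z}_2\wr G}(Y_0,Y_n)}{n^{d_s/2}(\log\log n)^{1-d_s/2}}\le c_2,\qquad P_{\boldsymbol{x}}\text{-a.s.},$$ $$c_3\le\liminf_{n\to\infty}\frac{d_{\mathbb{Z}_2\wr G}(Y_0,Y_n)}{n^{d_s/2}(\log\log n)^{-d_s/2}}\le c_4,\qquad P_{\boldsymbol{x}}\text{-a.s.}$$ (II) Assume the $p_0$-condition, the $d_f$-set condition and the on-diagonal heat kernel upper bound with exponent $d_s$ hold, and that $d_s/2>1$. Then there exist (non-random) constants $c_1,c_2>0$ such that for all $\boldsymbol{x}\in V(\mathbb{Z}_2\wr G)$: $$c_1\le\liminf_{n\to\infty}\frac{d_{\mathbb{Z}_2\wr G}(Y_0,Y_n)}{n}\le\limsup_{n\to\infty}\frac{d_{\mathbb{Z}_2\wr G}(Y_0,Y_n)}{n}\le c_2,\qquad P_{\boldsymbol{x}}\text{-a.s.}$$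
   Context: Weighted graph: $G=(V(G),E(G))$ is an infinite, locally finite, connected graph with countable vertex set, with graph distance $d$. $\mu:V(G)\times V(G)\to[0,\infty)$ is symmetric, with $\mu_{xy}=\mu(x,y)>0$ if and only if $(x,y)\in E(G)$. Put $m(x)=\sum_{y}\mu_{xy}$, $m(A)=\sum_{x\in A}m(x)$, $B(x,r)=\{y:d(x,y)\le r\}$, $V(x,r)=m(B(x,r))$. $\{X_n\}_{n\ge0}$ is the Markov chain on $V(G)$ with transition probability $p(x,y)=\mu_{xy}/m(x)$, $P_x$ is its law when $X_0=x$, and $p_n(x,y)=P_x(X_n=y)$. $p_0$-condition: there is $p_0>0$ with $\mu_{xy}/m(x)\ge p_0$ whenever $\{x,y\}\in E(G)$. $d_f$-set condition: there are constants $d_f,c_1,c_2>0$ with $c_1r^{d_f}\le V(x,r)\le c_2r^{d_f}$ for all $x\in V(G)$ and $r\in\mathbb{N}\cup\{0\}$, where $0^{d_f}$ is regarded as $1$. On-diagonal heat kernel upper bound: there are $d_s>0$ and $c_1>0$ such that $p_n(x,y)/m(y)\le c_1n^{-d_s/2}$ for all $x,y\in V(G)$, $n\ge1$. Sub-Gaussian heat kernel estimates: there are $d_w>1$ and constants $c_1,c_2,c_3,c_4>0$ such that $$\frac{p_n(x,y)}{m(y)}\le\frac{c_1}{V(x,n^{1/d_w})}\exp\left(-c_2\left(\frac{d(x,y)^{d_w}}{n}\right)^{\frac1{d_w-1}}\right)$$ for all $x,y\in V(G)$, $n\ge1$, and $$\frac{p_n(x,y)}{m(y)}+\frac{p_{n+1}(x,y)}{m(y)}\ge\frac{c_3}{V(x,n^{1/d_w})}\exp\left(-c_4\left(\frac{d(x,y)^{d_w}}{n}\right)^{\frac1{d_w-1}}\right)$$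 for all $x,y\in V(G)$, $n\ge1$ with $d(x,y)\le n$. (The $d_f$-set condition and the first of these bounds imply the on-diagonal upper bound with $d_s/2=d_f/d_w$; this is the meaning of $d_s$ when the sub-Gaussian estimates are assumed.) Wreath product: $\mathbb{Z}_2=\{0,1\}$ is the graph with two vertices and one edge joining them. $V(\mathbb{Z}_2\wr G)$ is the set of pairs $(f,v)$ with $v\in V(G)$ and $f:V(G)\to\{0,1\}$ with $\{x:f(x)\ne0\}$ finite; $(f,u)$ and $(g,v)$ are adjacent iff either $f=g$ and $(u,v)\in E(G)$, or $u=v$, $f=g$ off $u$, and $f(u)\ne g(u)$. Lamplighter walk: $Y_n=(\eta_n,X_n)$ is the Markov chain on $V(\mathbb{Z}_2\wr G)$ with transition probability $\tilde p=Q*\tilde P*Q$ (composition of kernels), where $\tilde P((f,x),(g,y))=p(x,y)$ if $f=g$ and $0$ otherwise, and $Q((f,x),(g,y))=1/2$ if $x=y$ and $f(v)=g(v)$ for all $v\ne x$, and $0$ otherwise. $P_{\boldsymbol{x}}$ is its law when $Y_0=\boldsymbol{x}$. *)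

theory Defs
  imports "HOL-Probability.Probability" "HOL-Library.Poly_Mapping" "HOL-Library.Z2"
begin

section \<open>Graphs on a vertex type\<close>

text \<open>The vertex set is the whole type \<^typ>\<open>'v\<close> and \<open>E\<close> is the adjacency relation.
  The distance is the least length of a walk; it is meaningful only for connected vertices.\<close>

definition gdist :: "('v \<Rightarrow> 'v \<Rightarrow> bool) \<Rightarrow> 'v \<Rightarrow> 'v \<Rightarrow> nat" where
  "gdist E x y = (LEAST n. (E ^^ n) x y)"

definition gball :: "('v \<Rightarrow> 'v \<Rightarrow> bool) \<Rightarrow> 'v \<Rightarrow> real \<Rightarrow> 'v set" where
  "gball E x r = {y. real (gdist E x y) \<le> r}"

definition mass :: "('v \<Rightarrow> 'v \<Rightarrow> real) \<Rightarrow> 'v \<Rightarrow> real" where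
  "mass \<mu> x = (\<Sum>\<^sub>\<infinity>y. \<mu> x y)"

definition vol :: "('v \<Rightarrow> 'v \<Rightarrow> bool) \<Rightarrow> ('v \<Rightarrow> 'v \<Rightarrow> real) \<Rightarrow> 'v \<Rightarrow> real \<Rightarrow> real" where
  "vol E \<mu> x r = (\<Sum>y\<in>gball E x r. mass \<mu> y)"

locale weighted_graph =
  fixes E :: "'v \<Rightarrow> 'v \<Rightarrow> bool" and \<mu> :: "'v \<Rightarrow> 'v \<Rightarrow> real"
  assumes infinite_vertices: "infinite (UNIV :: 'v set)"
    and countable_vertices: "countable (UNIV :: 'v set)"
    and locally_finite: "finite {y. E x y}"
    and connected: "E\<^sup>*\<^sup>* x y"
    and weight_nonneg: "0 \<le> \<mu> x y"
    and weight_sym: "\<mu> x y = \<mu> y x"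
    and weight_pos_iff: "0 < \<mu> x y \<longleftrightarrow> E x y"
begin

lemma mass_eq_sum: "mass \<mu> x = (\<Sum>y | E x y. \<mu> x y)"
proof -
  have "\<mu> x y = 0" if "\<not> E x y" for y
    using weight_pos_iff[of x y] weight_nonneg[of x y] that by linarith
  then have "mass \<mu> x = infsum (\<mu> x) {y. E x y}"
    unfolding mass_def by (intro infsum_cong_neutral) auto
  then show ?thesis
    using locally_finite by simp
qed

lemma mass_pos: "0 < mass \<mu> x"
proof -
  have "UNIV \<noteq> {x}"
    using infinite_vertices by (metis finite.emptyI finite.insertI)
  then obtain y where "y \<noteq> x" by auto
  with connected[of x y] obtain z where "E x z"
    by (metis converse_rtranclpE)
  then show ?thesis
    unfolding mass_eq_sum using locally_finite weight_pos_iff weight_nonneg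
    by (intro sum_pos2[of _ z]) auto
qed

lemma relpowp_gdist: "(E ^^ gdist E x y) x y"
  unfolding gdist_def by (rule LeastI_ex) (metis connected rtranclp_power)

lemma finite_gball: "finite (gball E x r)"
proof -
  have *: "finite {y. (E ^^ n) x y}" for n
  proof (induction n)
    case (Suc n)
    have "{y. (E ^^ Suc n) x y} = (\<Union>z\<in>{z. (E ^^ n) x z}. {y. E z y})" by auto
    then show ?case using Suc locally_finite by simp
  qed simp
  have "gball E x r \<subseteq> (\<Union>n\<in>{..nat \<lfloor>r\<rfloor>}. {y. (E ^^ n) x y})"
  proof
    fix y assume "y \<in> gball E x r"
    then have "gdist E x y \<le> nat \<lfloor>r\<rfloor>" by (simp add: gball_def le_nat_floor)
    then show "y \<in> (\<Union>n\<in>{..nat \<lfloor>r\<rfloor>}. {y. (E ^^ n) x y})" using relpowp_gdist by blast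
  qed
  moreover have "finite (\<Union>n\<in>{..nat \<lfloor>r\<rfloor>}. {y. (E ^^ n) x y})" using * by blast
  ultimately show ?thesis by (rule finite_subset)
qed

end


section \<open>The law of a Markov chain\<close>

text \<open>The law on path space of the chain with transition kernel \<open>K\<close> started at \<open>x\<close>, by the
  Ionescu-Tulcea theorem. Lemma \<open>emeasure_chain_law\<close> below gives its finite-dimensional
  distributions.\<close>

definition chain_step :: "('s \<Rightarrow> 's pmf) \<Rightarrow> 's \<Rightarrow> nat \<Rightarrow> (nat \<Rightarrow> 's) \<Rightarrow> 's measure" where
  "chain_step K x n \<omega> = measure_pmf (case n of 0 \<Rightarrow> return_pmf x | Suc k \<Rightarrow> K (\<omega> k))"

interpretation chain: Ionescu_Tulcea "chain_step K x" "\<lambda>_. count_space UNIV" for K x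
proof (rule Ionescu_Tulcea.intro)
  fix n :: nat
  show "chain_step K x n \<in> PiM {0..<n} (\<lambda>_. count_space UNIV) \<rightarrow>\<^sub>M subprob_algebra (count_space UNIV)"
  proof (cases n)
    case 0
    then show ?thesis
      by (simp add: chain_step_def[abs_def] measure_pmf_in_subprob_algebra)
  next
    case (Suc k)
    have "(\<lambda>\<omega>. \<omega> k) \<in> PiM {0..<n} (\<lambda>_. count_space UNIV) \<rightarrow>\<^sub>M count_space UNIV"
      by (rule measurable_component_singleton) (simp add: Suc)
    moreover have "(\<lambda>y. measure_pmf (K y)) \<in> count_space UNIV \<rightarrow>\<^sub>M subprob_algebra (count_space UNIV)"
      by (simp add: measure_pmf_in_subprob_algebra)
    ultimately show ?thesis
      unfolding chain_step_def[abs_def] Suc by (simp add: measurable_compose)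
  qed
next
  show "prob_space (chain_step K x n \<omega>)" for n \<omega>
    unfolding chain_step_def by (rule measure_pmf.prob_space_axioms)
qed

definition chain_law :: "('s \<Rightarrow> 's pmf) \<Rightarrow> 's \<Rightarrow> (nat \<Rightarrow> 's) measure" where
  "chain_law K x = chain.PF.lim K x"

lemma sets_chain_law: "sets (chain_law K x) = sets (PiM UNIV (\<lambda>_. count_space UNIV))"
  unfolding chain_law_def by simp

lemma space_chain_law: "space (chain_law K x) = UNIV"
  using sets_eq_imp_space_eq[OF sets_chain_law, of K x] by (simp add: space_PiM)

lemma prob_space_chain_law: "prob_space (chain_law K x)"
proof
  have "emeasure (chain_law K x) (chain.PF.emb UNIV {} {\<lambda>_. undefined}) =
      emeasure (chain.CI K x {}) {\<lambda>_. undefined}"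
    unfolding chain_law_def by (rule chain.lim) (simp_all add: sets_PiM_empty)
  moreover interpret CI: prob_space "chain.CI K x {}"
    by (rule chain.PF.prob_space_P) simp_all
  have "space (chain.CI K x {}) = {\<lambda>_. undefined}"
    by (simp add: chain.CI_def space_PiM)
  ultimately show "emeasure (chain_law K x) (space (chain_law K x)) = 1"
    using CI.emeasure_space_1 by (simp add: space_chain_law prod_emb_def space_PiM restrict_def)
qed

lemma emeasure_chain_law:
  "emeasure (chain_law K x) {\<omega>. \<forall>i\<le>n. \<omega> i = s i} =
    ennreal (if s 0 = x then \<Prod>i<n. pmf (K (s i)) (s (Suc i)) else 0)"
proof -
  let ?M = "\<lambda>_::nat. count_space (UNIV :: 'a set)"
  let ?X = "\<lambda>m. PiE {0..<m} (\<lambda>i. {s i})"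
  have X[measurable]: "?X m \<in> sets (PiM {0..<m} ?M)" for m
    by (intro sets_PiM_I_finite) auto
  have C: "emeasure (chain.C K x 0 (Suc m) (\<lambda>_. undefined)) (?X (Suc m)) =
    ennreal (if s 0 = x then \<Prod>i<m. pmf (K (s i)) (s (Suc i)) else 0)" for m
  proof -
    have eP: "emeasure (chain.eP K x m \<omega>) (?X (Suc m)) =
        indicator (?X m) \<omega> * emeasure (chain_step K x m s) {s m}"
      if \<omega>: "\<omega> \<in> space (PiM {0..<m} ?M)" for \<omega> m
    proof -
      have "emeasure (chain.eP K x m \<omega>) (?X (Suc m)) =
          emeasure (chain_step K x m \<omega>) (fun_upd \<omega> m -` ?X (Suc m) \<inter> space (count_space UNIV))"
        by (rule chain.emeasure_eP[OF \<omega> X])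
      also have "fun_upd \<omega> m -` ?X (Suc m) \<inter> space (count_space UNIV) =
          (if \<omega> \<in> ?X m then {s m} else {})"
        using \<omega> by (auto simp: PiE_iff space_PiM extensional_def atLeastLessThanSuc split: if_splits)
      also have "emeasure (chain_step K x m \<omega>) \<dots> = indicator (?X m) \<omega> * emeasure (chain_step K x m s) {s m}"
        by (auto simp: chain_step_def PiE_iff split: nat.split)
      finally show ?thesis .
    qed
    have step: "emeasure (chain.C K x 0 (Suc m) (\<lambda>_. undefined)) (?X (Suc m)) =
        emeasure (chain.C K x 0 m (\<lambda>_. undefined)) (?X m) * emeasure (chain_step K x m s) {s m}" for m
    proof -
      let ?N = "chain.C K x 0 m (\<lambda>_. undefined)"
      have sp: "(\<lambda>_. undefined) \<in> space (PiM {0..<0} ?M)" by (simp add: space_PiM)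
      have spN: "space ?N = space (PiM {0..<m} ?M)"
        using chain.space_C[OF sp, of K x m] by simp
      have setsN: "sets ?N = sets (PiM {0..<m} ?M)"
        using chain.sets_C[OF sp, of K x m] by simp
      have XN: "?X m \<in> sets ?N" using X[of m] by (simp only: setsN)
      have eM: "chain.eP K x m \<in> ?N \<rightarrow>\<^sub>M subprob_algebra (PiM {0..<Suc m} ?M)"
        using chain.measurable_eP[of K x m] measurable_cong_sets[OF setsN refl] by blast
      have ne: "space ?N \<noteq> {}" unfolding spN by (simp add: space_PiM PiE_eq_empty_iff)
      have "emeasure (chain.C K x 0 (Suc m) (\<lambda>_. undefined)) (?X (Suc m)) =
          (\<integral>\<^sup>+\<omega>. emeasure (chain.eP K x m \<omega>) (?X (Suc m)) \<partial>?N)"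
        using emeasure_bind[OF ne eM X] by simp
      also have "\<dots> = (\<integral>\<^sup>+\<omega>. indicator (?X m) \<omega> * emeasure (chain_step K x m s) {s m} \<partial>?N)"
        by (intro nn_integral_cong eP) (simp add: spN)
      also have "\<dots> = emeasure ?N (?X m) * emeasure (chain_step K x m s) {s m}"
        using XN by (subst nn_integral_multc) (simp_all add: borel_measurable_indicator)
      finally show ?thesis .
    qed
    show ?thesis
    proof (induction m)
      case 0
      show ?case
        by (subst step) (simp add: chain_step_def emeasure_return[OF X[of 0, simplified]]
            sets_PiM_empty emeasure_pmf_single indicator_def)
    next
      case (Suc m)
      show ?case
        by (subst step, subst Suc)
          (auto simp: chain_step_def emeasure_pmf_single ennreal_mult prod_nonneg)
    qed
  qed
  have "{\<omega>. \<forall>i\<le>n. \<omega> i = s i} = chain.PF.emb UNIV {0..<Suc n} (?X (Suc n))"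
    by (auto simp: prod_emb_def space_PiM PiE_iff restrict_def less_Suc_eq_le)
  then have "emeasure (chain_law K x) {\<omega>. \<forall>i\<le>n. \<omega> i = s i} = emeasure (chain.CI K x {0..<Suc n}) (?X (Suc n))"
    unfolding chain_law_def using chain.lim[OF _ X, of "Suc n"] by simp
  also have "\<dots> = emeasure (chain.C K x 0 (Suc n) (\<lambda>_. undefined))
      (chain.PF.emb {0..<Suc n} {0..<Suc n} (?X (Suc n)))"
    by (rule chain.emeasure_CI[OF subset_refl X])
  also have "chain.PF.emb {0..<Suc n} {0..<Suc n} (?X (Suc n)) = ?X (Suc n)"
    using sets.sets_into_space[OF X] by (intro prod_emb_id) (simp add: space_PiM)
  finally show ?thesis by (simp only: C)
qed


section \<open>The walk on the base graph and its heat kernel conditions\<close>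

definition walk :: "('v \<Rightarrow> 'v \<Rightarrow> real) \<Rightarrow> 'v \<Rightarrow> 'v pmf" where
  "walk \<mu> x = embed_pmf (\<lambda>y. \<mu> x y / mass \<mu> x)"

lemma (in weighted_graph) pmf_walk: "pmf (walk \<mu> x) y = \<mu> x y / mass \<mu> x"
  unfolding walk_def
proof (rule pmf_embed_pmf)
  have zero: "\<mu> x y = 0" if "\<not> E x y" for y
    using weight_pos_iff[of x y] weight_nonneg[of x y] that by linarith
  have "(\<integral>\<^sup>+y. ennreal (\<mu> x y / mass \<mu> x) \<partial>count_space UNIV) =
      (\<Sum>y | E x y. ennreal (\<mu> x y / mass \<mu> x))"
    by (rule nn_integral_count_space'[OF locally_finite]) (auto simp: zero)
  also have "\<dots> = ennreal (\<Sum>y | E x y. \<mu> x y / mass \<mu> x)"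
    using weight_nonneg mass_pos[of x] by (intro sum_ennreal) (simp add: less_imp_le)
  also have "(\<Sum>y | E x y. \<mu> x y / mass \<mu> x) = 1"
    using mass_pos[of x] mass_eq_sum[of x] by (simp flip: sum_divide_distrib)
  finally show "(\<integral>\<^sup>+y. ennreal (\<mu> x y / mass \<mu> x) \<partial>count_space UNIV) = 1" by simp
qed (simp add: weight_nonneg mass_pos less_imp_le)

definition step_prob :: "('v \<Rightarrow> 'v \<Rightarrow> real) \<Rightarrow> nat \<Rightarrow> 'v \<Rightarrow> 'v \<Rightarrow> real" where
  "step_prob \<mu> n x y = measure (chain_law (walk \<mu>) x) {\<omega>. \<omega> n = y}"

definition p0_condition :: "('v \<Rightarrow> 'v \<Rightarrow> bool) \<Rightarrow> ('v \<Rightarrow> 'v \<Rightarrow> real) \<Rightarrow> bool" where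
  "p0_condition E \<mu> \<longleftrightarrow> (\<exists>p0>0. \<forall>x y. E x y \<longrightarrow> p0 \<le> \<mu> x y / mass \<mu> x)"

text \<open>The case distinction encodes the convention that \<open>0\<close> to the power \<open>df\<close> is \<open>1\<close> here
  (whereas \<^term>\<open>0 powr df = (0::real)\<close>).\<close>

definition df_set_condition :: "('v \<Rightarrow> 'v \<Rightarrow> bool) \<Rightarrow> ('v \<Rightarrow> 'v \<Rightarrow> real) \<Rightarrow> real \<Rightarrow> bool" where
  "df_set_condition E \<mu> df \<longleftrightarrow> df > 0 \<and>
    (\<exists>c1>0. \<exists>c2>0. \<forall>x. \<forall>r::nat.
      c1 * (if r = 0 then 1 else real r powr df) \<le> vol E \<mu> x (real r) \<and>
      vol E \<mu> x (real r) \<le> c2 * (if r = 0 then 1 else real r powr df))"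

definition on_diagonal_upper_bound :: "('v \<Rightarrow> 'v \<Rightarrow> real) \<Rightarrow> real \<Rightarrow> bool" where
  "on_diagonal_upper_bound \<mu> ds \<longleftrightarrow> ds > 0 \<and>
    (\<exists>c1>0. \<forall>x y. \<forall>n\<ge>1. step_prob \<mu> n x y / mass \<mu> y \<le> c1 * real n powr (- ds / 2))"

definition sub_gaussian_estimates ::
    "('v \<Rightarrow> 'v \<Rightarrow> bool) \<Rightarrow> ('v \<Rightarrow> 'v \<Rightarrow> real) \<Rightarrow> real \<Rightarrow> bool" where
  "sub_gaussian_estimates E \<mu> dw \<longleftrightarrow> dw > 1 \<and>
    (\<exists>c1>0. \<exists>c2>0. \<exists>c3>0. \<exists>c4>0.
      (\<forall>x y. \<forall>n\<ge>1.
        step_prob \<mu> n x y / mass \<mu> y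
          \<le> c1 / vol E \<mu> x (real n powr (1 / dw)) *
             exp (- c2 * (real (gdist E x y) powr dw / real n) powr (1 / (dw - 1)))) \<and>
      (\<forall>x y. \<forall>n\<ge>1. gdist E x y \<le> n \<longrightarrow>
        step_prob \<mu> n x y / mass \<mu> y + step_prob \<mu> (n + 1) x y / mass \<mu> y
          \<ge> c3 / vol E \<mu> x (real n powr (1 / dw)) *
             exp (- c4 * (real (gdist E x y) powr dw / real n) powr (1 / (dw - 1)))))"


section \<open>The wreath product and the lamplighter walk\<close>

text \<open>A vertex is a pair of a finitely supported lamp configuration \<open>'v \<Rightarrow>\<^sub>0 bit\<close> and a position.\<close>

type_synonym 'v lamp_state = "('v \<Rightarrow>\<^sub>0 bit) \<times> 'v"

definition wreath_adj :: "('v \<Rightarrow> 'v \<Rightarrow> bool) \<Rightarrow> 'v lamp_state \<Rightarrow> 'v lamp_state \<Rightarrow> bool" where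
  "wreath_adj E = (\<lambda>(f, u) (g, v).
    (f = g \<and> E u v) \<or>
    (u = v \<and> (\<forall>w. w \<noteq> u \<longrightarrow> poly_mapping.lookup f w = poly_mapping.lookup g w) \<and> poly_mapping.lookup f u \<noteq> poly_mapping.lookup g u))"

definition switch_kernel :: "'v lamp_state \<Rightarrow> 'v lamp_state pmf" where
  "switch_kernel = (\<lambda>(f, x). map_pmf (\<lambda>b. (Poly_Mapping.update x b f, x)) (pmf_of_set {0, 1}))"

definition move_kernel :: "('v \<Rightarrow> 'v \<Rightarrow> real) \<Rightarrow> 'v lamp_state \<Rightarrow> 'v lamp_state pmf" where
  "move_kernel \<mu> = (\<lambda>(f, x). map_pmf (Pair f) (walk \<mu> x))"

definition lamplighter_kernel :: "('v \<Rightarrow> 'v \<Rightarrow> real) \<Rightarrow> 'v lamp_state \<Rightarrow> 'v lamp_state pmf" where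
  "lamplighter_kernel \<mu> s =
    bind_pmf (switch_kernel s) (\<lambda>t. bind_pmf (move_kernel \<mu> t) switch_kernel)"

lemma pmf_switch_kernel:
  "pmf (switch_kernel (f, x)) (g, y) =
    (if x = y \<and> (\<forall>v. v \<noteq> x \<longrightarrow> poly_mapping.lookup f v = poly_mapping.lookup g v) then 1 / 2 else 0)"
proof -
  let ?h = "\<lambda>b. (Poly_Mapping.update x b f, x)"
  have inj: "inj ?h"
    by (rule injI) (metis Poly_Mapping.lookup_update prod.inject)
  have eq: "x = y \<and> (\<forall>v. v \<noteq> x \<longrightarrow> poly_mapping.lookup f v = poly_mapping.lookup g v) \<longleftrightarrow> (g, y) \<in> range ?h"
  proof
    assume "x = y \<and> (\<forall>v. v \<noteq> x \<longrightarrow> poly_mapping.lookup f v = poly_mapping.lookup g v)"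
    then have "(g, y) = ?h (poly_mapping.lookup g x)"
      by (auto intro!: poly_mapping_eqI simp: Poly_Mapping.lookup_update)
    then show "(g, y) \<in> range ?h" by blast
  qed (auto simp: Poly_Mapping.lookup_update)
  show ?thesis
  proof (cases "(g, y) \<in> range ?h")
    case True
    then obtain b where b: "(g, y) = ?h b" by blast
    have "b \<in> {0, 1}" by (cases b) auto
    then have "pmf (switch_kernel (f, x)) (?h b) = 1 / 2"
      unfolding switch_kernel_def prod.case pmf_map_inj'[OF inj] by auto
    then show ?thesis using True eq b by metis
  next
    case False
    then have "(g, y) \<notin> set_pmf (switch_kernel (f, x))"
      unfolding switch_kernel_def by auto
    then show ?thesis using False eq by (auto simp: set_pmf_iff)
  qed
qed

lemma (in weighted_graph) pmf_move_kernel: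
  "pmf (move_kernel \<mu> (f, x)) (g, y) = (if f = g then \<mu> x y / mass \<mu> x else 0)"
proof (cases "f = g")
  case True
  have "pmf (map_pmf (Pair f) (walk \<mu> x)) (f, y) = pmf (walk \<mu> x) y"
    by (rule pmf_map_inj') (simp add: inj_def)
  then show ?thesis using True by (simp add: move_kernel_def pmf_walk)
next
  case False
  then have "(g, y) \<notin> set_pmf (move_kernel \<mu> (f, x))"
    by (auto simp: move_kernel_def)
  then show ?thesis using False by (simp add: set_pmf_iff)
qed

end

theory Submission
  imports Defs "HOL-Real_Asymp.Real_Asymp"
begin

text \<open>Let \<open>R\<^sub>n\<close> be the number of sites that the base walk visits up to time \<open>n\<close>. The distance of
  \<open>Y\<^sub>0\<close> and \<open>Y\<^sub>n\<close> is at most \<open>8 R\<^sub>n\<close>, because the range is connected and a tour around a spanning tree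
  of it can repair all lamps; it is at least the number of changed lamps, which given the base walk is
  binomial with parameters \<open>R\<^sub>n\<close> and \<open>1/2\<close>. So everything reduces to the range.

  Let \<open>\<alpha> = d\<^sub>s/2 < 1\<close>, cut \<open>n\<close> into \<open>b\<close> blocks of length \<open>t = n/b\<close> and write \<open>r\<close> for the
  range of one block. The number of self-intersections has mean of order \<open>t\<^sup>2\<^sup>-\<^sup>\<alpha>\<close>, whence
  \<open>r\<close> is rarely much smaller than \<open>t\<^sup>\<alpha>\<close>; the Green function bounds its mean by a multiple of \<open>t\<^sup>\<alpha>\<close>,
  and by the strong Markov property its tail is then geometric on that scale. Hence
  \<open>R\<^sub>n < c t\<^sup>\<alpha>\<close> and \<open>R\<^sub>n > C b t\<^sup>\<alpha>\<close> have probability at most \<open>e\<^sup>-\<^sup>2\<^sup>b\<close>. Conversely, staying in a ball of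
  radius of order \<open>t\<^sup>1\<^sup>/\<^sup>\<beta>\<close>, or moving to a new such ball in every block, has probability at least
  \<open>\<delta>\<^sup>b\<close>, and then \<open>R\<^sub>n \<le> C t\<^sup>\<alpha>\<close> or \<open>R\<^sub>n \<ge> c b t\<^sup>\<alpha>\<close>. With \<open>b\<close> of order \<open>log log n\<close> the
  Borel-Cantelli lemmas give the four bounds.

  For \<open>d\<^sub>s/2 > 1\<close>, a block of length \<open>t\<close> spends little time in the part of the range that was visited
  before, and its self-intersections have mean of order \<open>t\<close>; so it finds order \<open>t\<close> new sites with
  probability bounded below, whatever the past, and \<open>R\<^sub>n < c n\<close> is exponentially unlikely in the number of
  blocks.\<close>

text \<open>All estimates concern \<open>mpath\<close>, the law of the first \<open>n\<close> steps
  as a finitely supported distribution on lists: expectations are finite sums, and stopping times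
  become inductions on the first step. The infinite path space appears only where almost sure
  statements are drawn. Disjoint pieces of the walk are not independent. Every estimate for a block
  is therefore uniform in its starting point (and, for new sites, in the set of old ones); this lets
  blocks be multiplied and replaces independence in the second Borel-Cantelli lemma. The lower heat
  kernel bound controls only \<open>p n x y + p (n + 1) x y\<close>, since the graph may be
  bipartite; its uses cost a factor 2 or one extra step. The binomial lower bound for the lamps
  fails with a probability exponentially small in R_n, not in n, so R_n must be known to outgrow a
  multiple of log n before the distance is compared with it. The small values of R_n come from a
  late segment of the walk alone; the sites seen before it are counted by the limsup bound at a much
  earlier time.\<close>

abbreviation pr :: "'a pmf \<Rightarrow> ('a \<Rightarrow> bool) \<Rightarrow> real" where
  "pr p Q \<equiv> measure_pmf.prob p {x. Q x}"

abbreviation EV :: "'a pmf \<Rightarrow> ('a \<Rightarrow> real) \<Rightarrow> real" where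
  "EV p f \<equiv> measure_pmf.expectation p f"

section \<open>Expectations and probabilities under finitely supported laws\<close>

lemma EV_sum: "finite (set_pmf p) \<Longrightarrow> EV p f = (\<Sum>a\<in>set_pmf p. pmf p a * f a)"
  by (simp add: integral_measure_pmf[of "set_pmf p"])

lemma EV_mono:
  assumes "finite (set_pmf p)" "\<And>a. a \<in> set_pmf p \<Longrightarrow> f a \<le> g a"
  shows "EV p f \<le> EV p g"
  using assms by (auto simp: EV_sum intro!: sum_mono mult_left_mono)

lemma EV_cong: "(\<And>a. a \<in> set_pmf p \<Longrightarrow> f a = g a) \<Longrightarrow> EV p f = EV p g"
  by (intro integral_cong_AE) (auto simp: AE_measure_pmf_iff)

lemma EV_le_const:
  assumes "finite (set_pmf p)" "\<And>a. a \<in> set_pmf p \<Longrightarrow> f a \<le> c"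
  shows "EV p f \<le> c"
  using EV_mono[OF assms] by simp

lemma EV_ge_const:
  assumes "finite (set_pmf p)" "\<And>a. a \<in> set_pmf p \<Longrightarrow> c \<le> f a"
  shows "c \<le> EV p f"
  using EV_mono[of p "\<lambda>_. c" f, OF assms] by simp

lemma EV_add: "finite (set_pmf p) \<Longrightarrow> EV p (\<lambda>x. f x + g x) = EV p f + EV p g"
  by (intro Bochner_Integration.integral_add integrable_measure_pmf_finite)

lemma EV_sum_fun: "finite (set_pmf p) \<Longrightarrow> EV p (\<lambda>x. \<Sum>i\<in>I. f i x) = (\<Sum>i\<in>I. EV p (f i))"
  by (intro Bochner_Integration.integral_sum integrable_measure_pmf_finite)

lemma EV_bind:
  assumes "finite (set_pmf p)" "\<And>x. x \<in> set_pmf p \<Longrightarrow> finite (set_pmf (f x))"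
  shows "EV (bind_pmf p f) h = EV p (\<lambda>x. EV (f x) h)"
proof -
  define f' where "f' = (\<lambda>x. if x \<in> set_pmf p then f x else return_pmf undefined)"
  have "bind_pmf p f = bind_pmf p f'" by (intro bind_pmf_cong) (auto simp: f'_def)
  moreover have "EV (bind_pmf p f') h = (\<Sum>a\<in>set_pmf p. pmf p a *\<^sub>R EV (f' a) h)"
    by (rule pmf_expectation_bind) (use assms in \<open>auto simp: f'_def\<close>)
  ultimately show ?thesis using assms(1) by (simp add: EV_sum[of p] f'_def)
qed

lemma pr_EV: "pr p Q = EV p (\<lambda>x. of_bool (Q x))"
proof -
  have "(\<lambda>x. of_bool (Q x) :: real) = indicator {x. Q x}" by (auto simp: indicator_def)
  then show ?thesis by simp
qed

lemma pr_bind: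
  assumes "finite (set_pmf p)" "\<And>x. x \<in> set_pmf p \<Longrightarrow> finite (set_pmf (f x))"
  shows "pr (bind_pmf p f) Q = EV p (\<lambda>x. pr (f x) Q)"
  unfolding pr_EV by (rule EV_bind) (use assms in auto)

lemma pr_map: "pr (map_pmf f p) Q = pr p (\<lambda>x. Q (f x))"
  by (simp add: vimage_def)

lemma pr_mono:
  assumes "\<And>x. x \<in> set_pmf p \<Longrightarrow> P x \<Longrightarrow> Q x"
  shows "pr p P \<le> pr p Q"
  by (intro measure_pmf.finite_measure_mono_AE) (auto simp: AE_measure_pmf_iff assms)

lemma pr_cong:
  assumes "\<And>x. x \<in> set_pmf p \<Longrightarrow> P x = Q x"
  shows "pr p P = pr p Q"
  by (intro antisym pr_mono) (use assms in auto)

lemma pr_eq_1: "(\<And>x. x \<in> set_pmf p \<Longrightarrow> Q x) \<Longrightarrow> pr p Q = 1"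
  by (subst pr_cong[of p Q "\<lambda>_. True"]) auto

lemma pr_eq_0: "(\<And>x. x \<in> set_pmf p \<Longrightarrow> \<not> Q x) \<Longrightarrow> pr p Q = 0"
  by (subst pr_cong[of p Q "\<lambda>_. False"]) auto

lemma pr_neg: "pr p (\<lambda>x. \<not> Q x) = 1 - pr p Q"
  using measure_pmf.prob_compl[of "{x. Q x}" p] by (simp add: Collect_neg_eq Compl_eq_Diff_UNIV)

lemma pr_disj: "pr p (\<lambda>x. P x \<or> Q x) \<le> pr p P + pr p Q"
  using measure_Un_le[of "{x. P x}" "measure_pmf p" "{x. Q x}"] by (simp add: Collect_disj_eq)

lemma pr_conj_ge: "pr p P - pr p (\<lambda>x. \<not> Q x) \<le> pr p (\<lambda>x. P x \<and> Q x)"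
proof -
  have "pr p P \<le> pr p (\<lambda>x. (P x \<and> Q x) \<or> \<not> Q x)" by (rule pr_mono) auto
  also have "\<dots> \<le> pr p (\<lambda>x. P x \<and> Q x) + pr p (\<lambda>x. \<not> Q x)" by (rule pr_disj)
  finally show ?thesis by simp
qed

lemma markov_ineq:
  assumes "finite (set_pmf p)" "\<And>x. x \<in> set_pmf p \<Longrightarrow> 0 \<le> f x" "0 < c"
    "\<And>x. x \<in> set_pmf p \<Longrightarrow> Q x \<Longrightarrow> c \<le> f x"
  shows "pr p Q \<le> EV p f / c"
proof -
  have "pr p Q \<le> EV p (\<lambda>x. f x / c)"
    unfolding pr_EV by (intro EV_mono) (use assms in \<open>auto simp: of_bool_def\<close>)
  then show ?thesis by simp
qed

section \<open>Paths of a Markov chain\<close>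

text \<open>A path of \<open>n\<close> steps is a list of \<open>n + 1\<close> states. The recursion
  peels off the first state, so that the Markov property at time 1 is definitional and inductions
  can generalise over the starting point.\<close>

primrec mpath :: "('s \<Rightarrow> 's pmf) \<Rightarrow> nat \<Rightarrow> 's \<Rightarrow> 's list pmf" where
  "mpath K 0 x = return_pmf [x]"
| "mpath K (Suc n) x = bind_pmf (K x) (\<lambda>y. map_pmf ((#) x) (mpath K n y))"

lemma path_support:
  "l \<in> set_pmf (mpath K n x) \<Longrightarrow> length l = Suc n \<and> hd l = x \<and> l \<noteq> [] \<and> x \<in> set l \<and> last l \<in> set l"
  by (induction n arbitrary: x l) fastforce+

text \<open>The two parts of a path of length \<open>m + n\<close> share its entry number \<open>m\<close>.\<close>

lemma path_split:
  "mpath K (m + n) x = bind_pmf (mpath K m x) (\<lambda>l. map_pmf (\<lambda>l'. l @ tl l') (mpath K n (last l)))"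
proof (induction m arbitrary: x)
  case 0
  have "map_pmf (\<lambda>l'. x # tl l') (mpath K n x) = map_pmf (\<lambda>l'. l') (mpath K n x)"
    by (intro map_pmf_cong) (auto dest!: path_support simp: neq_Nil_conv)
  then show ?case by (simp add: bind_return_pmf)
next
  case (Suc m)
  have "map_pmf ((#) x) (mpath K (m + n) y) = bind_pmf (mpath K m y)
     (\<lambda>xa. map_pmf (\<lambda>l'. (x # xa) @ tl l') (mpath K n (last (x # xa))))" for y
    unfolding Suc.IH map_bind_pmf pmf.map_comp o_def
    by (intro bind_pmf_cong) (auto dest: path_support)
  then show ?case
    by (simp add: bind_assoc_pmf bind_map_pmf)
qed

lemma pmf_path:
  "length s = Suc n \<Longrightarrow> pmf (mpath K n x) s = (if s ! 0 = x then \<Prod>i<n. pmf (K (s ! i)) (s ! Suc i) else 0)"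
proof (induction n arbitrary: x s)
  case 0
  then obtain a where "s = [a]" by (metis length_0_conv length_Suc_conv)
  then show ?case by (auto simp: indicator_def)
next
  case (Suc n)
  then obtain a l where s: "s = a # l" "length l = Suc n" by (metis length_Suc_conv)
  have z: "pmf (map_pmf ((#) x) (mpath K n y)) s = (if a = x then pmf (mpath K n y) l else 0)" for y
  proof (cases "a = x")
    case True
    then show ?thesis using s pmf_map_inj'[of "(#) x" "mpath K n y" l] by simp
  next
    case False
    then have "s \<notin> set_pmf (map_pmf ((#) x) (mpath K n y))" using s by auto
    then show ?thesis using False by (metis set_pmf_iff)
  qed
  have "pmf (mpath K (Suc n) x) s = EV (K x) (\<lambda>y. if a = x then pmf (mpath K n y) l else 0)"
    by (simp add: pmf_bind z)
  also have "\<dots> = (if a = x then EV (K x) (\<lambda>y. if y = l ! 0 then \<Prod>i<n. pmf (K (l ! i)) (l ! Suc i) else 0) else 0)"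
    by (simp add: Suc.IH[OF s(2)] eq_commute[of "l ! 0"])
  also have "EV (K x) (\<lambda>y. if y = l ! 0 then \<Prod>i<n. pmf (K (l ! i)) (l ! Suc i) else 0) =
      pmf (K x) (l ! 0) * (\<Prod>i<n. pmf (K (l ! i)) (l ! Suc i))"
    by (subst integral_measure_pmf[of "{l ! 0}"], simp, metis singletonI, simp)
  finally show ?case using s by (simp del: prod.lessThan_Suc add: prod.lessThan_Suc_shift)
qed

section \<open>Transfer between path space and finite paths\<close>

lemma coordinates_eq_iff:
  assumes "length s = Suc n"
  shows "map \<omega> [0..<Suc n] = s \<longleftrightarrow> (\<forall>i\<le>n. \<omega> i = s ! i)"
proof -
  have "map \<omega> [0..<Suc n] = s \<longleftrightarrow> (\<forall>i<Suc n. map \<omega> [0..<Suc n] ! i = s ! i)"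
    using assms by (subst list_eq_iff_nth_eq) (simp del: upt_Suc)
  then show ?thesis by (simp del: upt_Suc add: less_Suc_eq_le)
qed

text \<open>Lists over a countable type are countable, so only preimages of single lists matter;
  these are cylinders or empty.\<close>

lemma measurable_coordinates:
  assumes "countable (UNIV :: 's set)"
  shows "(\<lambda>\<omega>. map \<omega> [0..<Suc n]) \<in> measurable (chain_law K (x :: 's)) (count_space UNIV)"
proof -
  have c: "countable (UNIV :: 's list set)"
    using countable_lists[OF assms] by simp
  have "(\<lambda>\<omega>. map \<omega> [0..<Suc n]) -` {s} \<inter> space (chain_law K x) \<in> sets (chain_law K x)" for s
  proof (cases "length s = Suc n")
    case True
    have "(\<lambda>\<omega>. map \<omega> [0..<Suc n]) -` {s} \<inter> space (chain_law K x) = {\<omega>. \<forall>i\<le>n. \<omega> i = s ! i}"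
      using coordinates_eq_iff[OF True] by (auto simp: space_chain_law vimage_def simp del: upt_Suc)
    also have "\<dots> = (\<Inter>i\<in>{..n}. (\<lambda>\<omega>. \<omega> i) -` {s ! i} \<inter> space (PiM UNIV (\<lambda>_. count_space UNIV)))"
      by (auto simp: space_PiM)
    also have "\<dots> \<in> sets (PiM UNIV (\<lambda>_. count_space UNIV))"
      by (intro sets.finite_INT measurable_sets[OF measurable_component_singleton]) auto
    finally show ?thesis by (simp add: sets_chain_law)
  next
    case False
    then have "(\<lambda>\<omega>. map \<omega> [0..<Suc n]) -` {s} \<inter> space (chain_law K x) = {}" by auto
    then show ?thesis by simp
  qed
  then show ?thesis
    by (subst measurable_count_space_eq_countable[OF c]) auto
qed

text \<open>Measures on a countable set agree if they agree on singletons. There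
  \<open>emeasure_chain_law\<close> and \<open>pmf_path\<close> give the same product of transition
  probabilities, and lists of the wrong length are null on both sides.\<close>

lemma distr_chain_law:
  assumes "countable (UNIV :: 's set)"
  shows "distr (chain_law K (x :: 's)) (count_space UNIV) (\<lambda>\<omega>. map \<omega> [0..<Suc n]) = measure_pmf (mpath K n x)"
    (is "?D = _")
proof (rule measure_eqI_countable[of _ UNIV])
  show "countable (UNIV :: 's list set)" using countable_lists[OF assms] by simp
  fix s :: "'s list"
  have "(\<lambda>\<omega>. map \<omega> [0..<Suc n]) -` {s} \<inter> space (chain_law K x) = {\<omega>. map \<omega> [0..<Suc n] = s}"
    unfolding space_chain_law by (simp only: vimage_def Int_UNIV_right singleton_iff)
  then have 1: "emeasure ?D {s} = emeasure (chain_law K x) {\<omega>. map \<omega> [0..<Suc n] = s}"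
    using emeasure_distr[OF measurable_coordinates[OF assms], of "{s}"] by simp
  show "emeasure ?D {s} = emeasure (mpath K n x) {s}"
  proof (cases "length s = Suc n")
    case True
    show ?thesis unfolding 1 coordinates_eq_iff[OF True] emeasure_chain_law emeasure_pmf_single
        pmf_path[OF True] by (rule refl)
  next
    case False
    then have "{\<omega>. map \<omega> [0..<Suc n] = s} = {}" by (auto simp del: upt_Suc)
    moreover have "s \<notin> set_pmf (mpath K n x)" using False path_support[of s K n x] by auto
    ultimately show ?thesis unfolding 1 by (simp add: emeasure_pmf_single set_pmf_iff)
  qed
qed auto

lemma measure_chain_law_path:
  assumes "countable (UNIV :: 's set)"
  shows "{\<omega>. Q (map \<omega> [0..<Suc n])} \<in> sets (chain_law K (x :: 's))"
    "measure (chain_law K x) {\<omega>. Q (map \<omega> [0..<Suc n])} = pr (mpath K n x) Q"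
proof -
  note m = measurable_coordinates[OF assms, of n K x]
  have *: "(\<lambda>\<omega>. map \<omega> [0..<Suc n]) -` {l. Q l} \<inter> space (chain_law K x) = {\<omega>. Q (map \<omega> [0..<Suc n])}"
    unfolding space_chain_law by (simp only: vimage_def Int_UNIV_right mem_Collect_eq)
  show "{\<omega>. Q (map \<omega> [0..<Suc n])} \<in> sets (chain_law K x)"
    unfolding *[symmetric] by (rule measurable_sets[OF m]) simp
  have "pr (mpath K n x) Q = measure (distr (chain_law K x) (count_space UNIV) (\<lambda>\<omega>. map \<omega> [0..<Suc n])) {l. Q l}"
    by (simp only: distr_chain_law[OF assms])
  also have "\<dots> = measure (chain_law K x) {\<omega>. Q (map \<omega> [0..<Suc n])}"
    unfolding *[symmetric] by (rule measure_distr[OF m]) simp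
  finally show "measure (chain_law K x) {\<omega>. Q (map \<omega> [0..<Suc n])} = pr (mpath K n x) Q" by (rule sym)
qed

lemma AE_path:
  assumes "countable (UNIV :: 's set)" "\<And>l. l \<in> set_pmf (mpath K n (x :: 's)) \<Longrightarrow> Q l"
  shows "AE \<omega> in chain_law K x. Q (map \<omega> [0..<Suc n])"
proof -
  interpret prob_space "chain_law K x" by (rule prob_space_chain_law)
  have "prob {\<omega>. Q (map \<omega> [0..<Suc n])} = pr (mpath K n x) Q"
    by (rule measure_chain_law_path(2)[OF assms(1)])
  also have "\<dots> = 1" using assms(2) by (rule pr_eq_1)
  finally have "AE \<omega> in chain_law K x. \<omega> \<in> {\<omega>. Q (map \<omega> [0..<Suc n])}"
    using prob_eq_1[OF measure_chain_law_path(1)[OF assms(1)]] by blast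
  then show ?thesis by (simp only: mem_Collect_eq)
qed

lemma AE_borel_cantelli:
  assumes "countable (UNIV :: 's set)" "summable (\<lambda>k. pr (mpath K (N k) (x :: 's)) (Q k))"
  shows "AE \<omega> in chain_law K x. eventually (\<lambda>k. \<not> Q k (map \<omega> [0..<Suc (N k)])) sequentially"
proof -
  interpret prob_space "chain_law K x" by (rule prob_space_chain_law)
  have "AE \<omega> in chain_law K x. eventually (\<lambda>k. \<omega> \<in> space (chain_law K x) - {\<omega>. Q k (map \<omega> [0..<Suc (N k)])}) sequentially"
  proof (rule borel_cantelli_AE1)
    show "summable (\<lambda>k. prob {\<omega>. Q k (map \<omega> [0..<Suc (N k)])})"
      using assms(2) by (simp only: measure_chain_law_path(2)[OF assms(1)])
  qed (use measure_chain_law_path(1)[OF assms(1)] in \<open>simp_all add: emeasure_eq_measure del: upt_Suc\<close>)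
  then show ?thesis by (simp only: space_chain_law Diff_iff UNIV_I simp_thms mem_Collect_eq)
qed

section \<open>The Markov property at a fixed time\<close>

locale finite_kernel =
  fixes K :: "'s \<Rightarrow> 's pmf"
  assumes finite_kernel: "finite (set_pmf (K x))"
begin

lemma finite_path [simp]: "finite (set_pmf (mpath K n x))"
  by (induction n arbitrary: x) (auto simp: finite_kernel)

lemma EV_path_Suc: "EV (mpath K (Suc n) x) f = EV (K x) (\<lambda>y. EV (mpath K n y) (\<lambda>l. f (x # l)))"
  by (simp add: EV_bind finite_kernel)

lemma pr_path_Suc: "pr (mpath K (Suc n) x) Q = EV (K x) (\<lambda>y. pr (mpath K n y) (\<lambda>l. Q (x # l)))"
  unfolding mpath.simps by (simp only: pr_bind pr_map finite_kernel finite_path finite_imageI set_map_pmf)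

lemma EV_path_split:
  "EV (mpath K (m + n) x) f = EV (mpath K m x) (\<lambda>l. EV (mpath K n (last l)) (\<lambda>l'. f (l @ tl l')))"
  unfolding path_split by (simp add: EV_bind)

lemma pr_path_split:
  "pr (mpath K (m + n) x) Q = EV (mpath K m x) (\<lambda>l. pr (mpath K n (last l)) (\<lambda>l'. Q (l @ tl l')))"
  unfolding path_split by (simp only: pr_bind pr_map finite_path finite_imageI set_map_pmf)

lemma set_append_path:
  assumes "l \<in> set_pmf (mpath K m x)" "l' \<in> set_pmf (mpath K n (last l))"
  shows "set (l @ tl l') = set l \<union> set l'" "last (l @ tl l') = last l'"
proof -
  have "l' = last l # tl l'" "l \<noteq> []" "last l \<in> set l"
    using path_support[OF assms(1)] path_support[OF assms(2)] by (cases l'; auto)+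
  then show "set (l @ tl l') = set l \<union> set l'" "last (l @ tl l') = last l'"
    by (metis Un_insert_right insert_absorb list.simps(15) set_append Un_iff, metis last_ConsL last_ConsR last_append)
qed

text \<open>The form of the Markov property that multiplies lower bounds over consecutive pieces:
  \<open>q\<close> is required only after a good first piece, and \<open>P'\<close> may refer to
  that piece.\<close>

lemma pr_path_split_ge:
  assumes "pr (mpath K m x) P \<ge> p" "\<And>l. l \<in> set_pmf (mpath K m x) \<Longrightarrow> P l \<Longrightarrow> pr (mpath K n (last l)) (P' l) \<ge> q"
    "q \<ge> 0"
    "\<And>l l'. l \<in> set_pmf (mpath K m x) \<Longrightarrow> l' \<in> set_pmf (mpath K n (last l)) \<Longrightarrow> P l \<Longrightarrow> P' l l' \<Longrightarrow> Q (l @ tl l')"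
  shows "pr (mpath K (m + n) x) Q \<ge> p * q"
proof -
  have "p * q \<le> pr (mpath K m x) P * q" using assms by (intro mult_right_mono) auto
  also have "\<dots> = EV (mpath K m x) (\<lambda>l. of_bool (P l) * q)" unfolding pr_EV by simp
  also have "\<dots> \<le> pr (mpath K (m + n) x) Q"
    unfolding pr_path_split
  proof (intro EV_mono finite_path)
    fix l assume l: "l \<in> set_pmf (mpath K m x)"
    show "of_bool (P l) * q \<le> pr (mpath K n (last l)) (\<lambda>l'. Q (l @ tl l'))"
    proof (cases "P l")
      case True
      have "q \<le> pr (mpath K n (last l)) (P' l)" using assms(2) l True by blast
      also have "\<dots> \<le> pr (mpath K n (last l)) (\<lambda>l'. Q (l @ tl l'))"
        by (rule pr_mono) (use assms(4) l True in blast)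
      finally show ?thesis using True by simp
    qed simp
  qed
  finally show ?thesis .
qed

lemma pr_path_split_le:
  assumes "pr (mpath K m x) P \<le> p" "\<And>l. l \<in> set_pmf (mpath K m x) \<Longrightarrow> P l \<Longrightarrow> pr (mpath K n (last l)) (P' l) \<le> q"
    "q \<ge> 0"
    "\<And>l l'. l \<in> set_pmf (mpath K m x) \<Longrightarrow> l' \<in> set_pmf (mpath K n (last l)) \<Longrightarrow> Q (l @ tl l') \<Longrightarrow> P l \<and> P' l l'"
  shows "pr (mpath K (m + n) x) Q \<le> p * q"
proof -
  have "pr (mpath K (m + n) x) Q \<le> EV (mpath K m x) (\<lambda>l. of_bool (P l) * q)"
    unfolding pr_path_split
  proof (intro EV_mono finite_path)
    fix l assume l: "l \<in> set_pmf (mpath K m x)"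
    show "pr (mpath K n (last l)) (\<lambda>l'. Q (l @ tl l')) \<le> of_bool (P l) * q"
    proof (cases "P l")
      case True
      have "pr (mpath K n (last l)) (\<lambda>l'. Q (l @ tl l')) \<le> pr (mpath K n (last l)) (P' l)"
        by (rule pr_mono) (use assms(4) l True in blast)
      also have "\<dots> \<le> q" using assms(2) l True by blast
      finally show ?thesis using True by simp
    next
      case False
      then have "pr (mpath K n (last l)) (\<lambda>l'. Q (l @ tl l')) = 0"
        by (intro pr_eq_0) (use assms(4) l in blast)
      then show ?thesis using False by simp
    qed
  qed
  also have "\<dots> = pr (mpath K m x) P * q" unfolding pr_EV by simp
  also have "\<dots> \<le> p * q" using assms by (intro mult_right_mono) auto
  finally show ?thesis .
qed

lemma pr_path_take: "pr (mpath K (m + n) x) (\<lambda>l. Q (take (Suc m) l)) = pr (mpath K m x) Q"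
proof -
  have "pr (mpath K (m + n) x) (\<lambda>l. Q (take (Suc m) l)) = EV (mpath K m x) (\<lambda>l. of_bool (Q l))"
    unfolding pr_path_split
  proof (intro EV_cong)
    fix l assume l: "l \<in> set_pmf (mpath K m x)"
    then show "pr (mpath K n (last l)) (\<lambda>l'. Q (take (Suc m) (l @ tl l'))) = of_bool (Q l)"
      using path_support[OF l] by auto
  qed
  then show ?thesis unfolding pr_EV .
qed

text \<open>An event that survives every extension of the path may be moved to a later time. Ranges
  only grow, so this absorbs the rounding when \<open>n\<close> is not a multiple of the block
  length.\<close>

lemma pr_path_mono:
  assumes "m \<le> n" "\<And>l l'. P l \<Longrightarrow> P (l @ l')"
  shows "pr (mpath K m x) P \<le> pr (mpath K n x) P"
proof -
  have "pr (mpath K m x) P = pr (mpath K (m + (n - m)) x) (\<lambda>l. P (take (Suc m) l))"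
    by (rule pr_path_take[symmetric])
  also have "\<dots> \<le> pr (mpath K (m + (n - m)) x) P"
  proof (rule pr_mono)
    fix l assume "P (take (Suc m) l)"
    then have "P (take (Suc m) l @ drop (Suc m) l)" by (rule assms(2))
    then show "P l" by simp
  qed
  finally show ?thesis using assms(1) by simp
qed

end

section \<open>Occupation times, self-intersections and hitting probabilities\<close>

context finite_kernel
begin

lemma pr_last_Suc:
  "pr (mpath K (Suc k) x) (\<lambda>l. Q (last l)) = EV (K x) (\<lambda>y. pr (mpath K k y) (\<lambda>l. Q (last l)))"
  unfolding pr_path_Suc by (intro EV_cong pr_cong) (auto dest: path_support)

lemma EV_length_filter:
  "EV (mpath K n x) (\<lambda>l. real (length (filter Q l))) = (\<Sum>k\<le>n. pr (mpath K k x) (\<lambda>l. Q (last l)))"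
proof (induction n arbitrary: x)
  case (Suc n)
  have "EV (mpath K (Suc n) x) (\<lambda>l. real (length (filter Q l))) =
      EV (K x) (\<lambda>y. EV (mpath K n y) (\<lambda>l. of_bool (Q x) + real (length (filter Q l))))"
    unfolding EV_path_Suc by (intro EV_cong) auto
  also have "\<dots> = EV (K x) (\<lambda>y. of_bool (Q x) + (\<Sum>k\<le>n. pr (mpath K k y) (\<lambda>l. Q (last l))))"
    by (simp add: EV_add Suc.IH)
  also have "\<dots> = of_bool (Q x) + (\<Sum>k\<le>n. pr (mpath K (Suc k) x) (\<lambda>l. Q (last l)))"
    unfolding pr_last_Suc by (simp add: EV_add EV_sum_fun finite_kernel)
  also have "\<dots> = (\<Sum>k\<le>Suc n. pr (mpath K k x) (\<lambda>l. Q (last l)))"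
    unfolding sum.atMost_Suc_shift by (simp add: measure_return_pmf indicator_def)
  finally show ?case .
qed (simp add: measure_return_pmf indicator_def)

end

text \<open>The sum of the squared local times, that is, the number of ordered pairs of times (equal
  times included) at which the path is at the same site.\<close>

definition self_intersections :: "'s list \<Rightarrow> nat" where
  "self_intersections l = (\<Sum>v\<in>set l. (count_list l v)\<^sup>2)"

lemma self_intersections_Cons:
  "self_intersections (x # l) = self_intersections l + 2 * count_list l x + 1"
proof -
  have "self_intersections (x # l) = (count_list l x + 1)\<^sup>2 + (\<Sum>v\<in>set l - {x}. (count_list l v)\<^sup>2)"
    unfolding self_intersections_def by (simp add: sum.insert_remove) (intro sum.cong, auto)
  moreover have "self_intersections l = (count_list l x)\<^sup>2 + (\<Sum>v\<in>set l - {x}. (count_list l v)\<^sup>2)"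
  proof (cases "x \<in> set l")
    case True
    then show ?thesis unfolding self_intersections_def by (simp add: sum.remove)
  next
    case False
    then show ?thesis unfolding self_intersections_def by (simp add: count_notin)
  qed
  ultimately show ?thesis by (simp add: power2_eq_square)
qed

text \<open>Cauchy-Schwarz for the local times against the constant 1. With \<open>Q\<close> true
  everywhere it bounds the range from below by the squared number of entries over the
  self-intersections; with \<open>Q\<close> the complement of a set of old sites it bounds the
  number of new sites.\<close>

lemma length_filter_squared_le:
  "(real (length (filter Q l)))\<^sup>2 \<le> real (card {v\<in>set l. Q v}) * real (self_intersections l)"
proof -
  have "length (filter Q l) = (\<Sum>v\<in>{v\<in>set l. Q v}. count_list l v)"
  proof (induction l)
    case (Cons a l)
    have "(\<Sum>v\<in>{v\<in>set (a # l). Q v}. count_list (a # l) v) =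
        (\<Sum>v\<in>{v\<in>set (a # l). Q v}. of_bool (a = v)) + (\<Sum>v\<in>{v\<in>set (a # l). Q v}. count_list l v)"
      unfolding sum.distrib[symmetric] by (intro sum.cong) auto
    also have "(\<Sum>v\<in>{v\<in>set (a # l). Q v}. of_bool (a = v)) = (of_bool (Q a) :: nat)"
      by (subst sum.mono_neutral_cong_right[of _ "if Q a then {a} else {}" _ "\<lambda>_. 1"]) (auto split: if_splits)
    also have "(\<Sum>v\<in>{v\<in>set (a # l). Q v}. count_list l v) = (\<Sum>v\<in>{v\<in>set l. Q v}. count_list l v)"
      by (rule sum.mono_neutral_right) (auto intro: ccontr simp: count_notin)
    finally show ?case using Cons.IH by simp
  qed simp
  then have "real (length (filter Q l)) = (\<Sum>v\<in>{v\<in>set l. Q v}. 1 * real (count_list l v))" by simp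
  also have "\<dots>\<^sup>2 \<le> (\<Sum>v\<in>{v\<in>set l. Q v}. 1\<^sup>2) * (\<Sum>v\<in>{v\<in>set l. Q v}. (real (count_list l v))\<^sup>2)"
    by (rule Cauchy_Schwarz_ineq_sum)
  also have "\<dots> \<le> real (card {v\<in>set l. Q v}) * real (self_intersections l)"
    unfolding self_intersections_def of_nat_sum by (auto intro!: mult_left_mono sum_mono2)
  finally show ?thesis .
qed

context finite_kernel
begin

text \<open>Peeling off the first state adds 1 plus twice the number of its later occurrences, whose
  mean is a sum of return probabilities. The horizon \<open>N\<close> stays fixed, so that one bound
  for that sum serves the whole induction.\<close>

lemma EV_self_intersections:
  assumes g: "\<And>x k. k \<ge> 1 \<Longrightarrow> pr (mpath K k x) (\<lambda>l. last l = x) \<le> g k" and "n \<le> N"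
  shows "EV (mpath K n x) (\<lambda>l. real (self_intersections l)) \<le> (real n + 1) * (1 + 2 * (\<Sum>k=1..N. g k))"
  using \<open>n \<le> N\<close>
proof (induction n arbitrary: x)
  case 0
  have "0 \<le> g k" if "k \<ge> 1" for k using g[OF that, of x] by (meson measure_nonneg order_trans)
  then have "0 \<le> (\<Sum>k=1..N. g k)" by (intro sum_nonneg) auto
  then show ?case by (simp add: self_intersections_def)
next
  case (Suc n)
  have nn: "0 \<le> g k" if "k \<ge> 1" for k using g[OF that, of x] by (meson measure_nonneg order_trans)
  let ?G = "\<Sum>k=1..N. g k"
  have "EV (mpath K (Suc n) x) (\<lambda>l. real (self_intersections l)) =
      EV (K x) (\<lambda>y. EV (mpath K n y) (\<lambda>l. real (self_intersections l) + (2 * real (length (filter ((=) x) l)) + 1)))"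
    unfolding EV_path_Suc self_intersections_Cons
    by (simp add: count_list_eq_length_filter algebra_simps)
  also have "\<dots> = EV (K x) (\<lambda>y. EV (mpath K n y) (\<lambda>l. real (self_intersections l)) +
      (2 * (\<Sum>k\<le>n. pr (mpath K k y) (\<lambda>l. x = last l)) + 1))"
    by (simp add: EV_add EV_length_filter)
  also have "\<dots> = EV (K x) (\<lambda>y. EV (mpath K n y) (\<lambda>l. real (self_intersections l))) +
      (2 * (\<Sum>k\<le>n. pr (mpath K (Suc k) x) (\<lambda>l. x = last l)) + 1)"
    unfolding pr_last_Suc by (simp add: EV_add EV_sum_fun finite_kernel)
  also have "\<dots> \<le> (real n + 1) * (1 + 2 * ?G) + (2 * ?G + 1)"
  proof (intro add_mono mult_left_mono)
    show "EV (K x) (\<lambda>y. EV (mpath K n y) (\<lambda>l. real (self_intersections l))) \<le> (real n + 1) * (1 + 2 * ?G)"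
      by (intro EV_le_const finite_kernel Suc.IH) (use Suc.prems in auto)
    have "(\<Sum>k\<le>n. pr (mpath K (Suc k) x) (\<lambda>l. x = last l)) \<le> (\<Sum>k\<le>n. g (Suc k))"
      by (intro sum_mono) (use g[of "Suc _" x] in \<open>simp add: eq_commute\<close>)
    also have "\<dots> = (\<Sum>k=1..Suc n. g k)"
      unfolding sum.atMost_shift[symmetric] by (simp add: sum.shift_bounds_cl_Suc_ivl atMost_atLeast0 del: sum.cl_ivl_Suc)
    also have "\<dots> \<le> ?G" by (rule sum_mono2) (use Suc.prems nn in auto)
    finally show "(\<Sum>k\<le>n. pr (mpath K (Suc k) x) (\<lambda>l. x = last l)) \<le> ?G" .
  qed auto
  finally show ?case by (simp add: algebra_simps)
qed

text \<open>Once \<open>y\<close> is hit within \<open>s\<close> steps, the mean time spent there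
  during the next \<open>t\<close> steps is at least \<open>g\<close>, and all of it falls before
  \<open>s + t\<close>. Induction on the first step takes the place of the hitting time.\<close>

lemma hitting_green:
  assumes "g \<le> (\<Sum>k\<le>t. pr (mpath K k y) (\<lambda>l. last l = y))" "0 \<le> g"
  shows "pr (mpath K s x) (\<lambda>l. y \<in> set l) * g \<le> (\<Sum>k\<le>s+t. pr (mpath K k x) (\<lambda>l. last l = y))"
proof (induction s arbitrary: x)
  case 0
  show ?case
  proof (cases "x = y")
    case False
    then have "pr (mpath K 0 x) (\<lambda>l. y \<in> set l) = 0" by (simp add: measure_return_pmf)
    then show ?thesis by (simp only: mult_zero_left) (intro sum_nonneg measure_nonneg)
  qed (use assms in \<open>simp add: measure_return_pmf\<close>)
next
  case (Suc s)
  show ?case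
  proof (cases "x = y")
    case True
    have "pr (mpath K (Suc s) x) (\<lambda>l. y \<in> set l) * g \<le> 1 * g" by (intro mult_right_mono assms) auto
    also have "\<dots> \<le> (\<Sum>k\<le>t. pr (mpath K k y) (\<lambda>l. last l = y))" using assms by simp
    also have "\<dots> \<le> (\<Sum>k\<le>Suc s+t. pr (mpath K k y) (\<lambda>l. last l = y))"
      by (intro sum_mono2) auto
    finally show ?thesis using True by simp
  next
    case False
    have "pr (mpath K (Suc s) x) (\<lambda>l. y \<in> set l) * g = EV (K x) (\<lambda>z. pr (mpath K s z) (\<lambda>l. y \<in> set l) * g)"
      unfolding pr_path_Suc using False by simp
    also have "\<dots> \<le> EV (K x) (\<lambda>z. \<Sum>k\<le>s+t. pr (mpath K k z) (\<lambda>l. last l = y))"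
      by (intro EV_mono finite_kernel Suc.IH)
    also have "\<dots> = (\<Sum>k\<le>s+t. pr (mpath K (Suc k) x) (\<lambda>l. last l = y))"
      unfolding pr_last_Suc[where Q = "\<lambda>z. z = y"] by (simp add: EV_sum_fun finite_kernel)
    also have "\<dots> \<le> (\<Sum>k\<le>Suc (s+t). pr (mpath K k x) (\<lambda>l. last l = y))"
      unfolding sum.atMost_Suc_shift by simp
    finally show ?thesis by simp
  qed
qed

text \<open>Sum \<open>hitting_green\<close> over \<open>y\<close>: on the right each of the
  \<open>s + t + 1\<close> times contributes at most 1, because the endpoint is at only one
  site.\<close>

lemma EV_card_range_green:
  assumes "\<And>y. g \<le> (\<Sum>k\<le>t. pr (mpath K k y) (\<lambda>l. last l = y))" "0 < g"
  shows "EV (mpath K s x) (\<lambda>l. real (card (set l))) \<le> (real (s + t) + 1) / g"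
proof -
  \<comment> \<open>Every site that the path can reach: a finite set, over which the range becomes a
    sum of indicators.\<close>
  define F where "F = (\<Union>l\<in>set_pmf (mpath K s x). set l)"
  have F: "finite F" by (simp add: F_def)
  have "EV (mpath K s x) (\<lambda>l. real (card (set l))) = EV (mpath K s x) (\<lambda>l. \<Sum>y\<in>F. of_bool (y \<in> set l))"
  proof (intro EV_cong)
    fix l assume "l \<in> set_pmf (mpath K s x)"
    then have "set l = F \<inter> {y. y \<in> set l}" by (auto simp: F_def)
    then show "real (card (set l)) = (\<Sum>y\<in>F. of_bool (y \<in> set l))"
      using F by (simp add: sum_of_bool_eq)
  qed
  also have "\<dots> = (\<Sum>y\<in>F. pr (mpath K s x) (\<lambda>l. y \<in> set l))"
    unfolding pr_EV by (simp only: EV_sum_fun finite_path)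
  finally have "EV (mpath K s x) (\<lambda>l. real (card (set l))) * g = (\<Sum>y\<in>F. pr (mpath K s x) (\<lambda>l. y \<in> set l) * g)"
    by (simp add: sum_distrib_right)
  also have "\<dots> \<le> (\<Sum>y\<in>F. \<Sum>k\<le>s+t. pr (mpath K k x) (\<lambda>l. last l = y))"
    by (intro sum_mono hitting_green) (use assms in \<open>auto simp: less_imp_le\<close>)
  also have "\<dots> = (\<Sum>k\<le>s+t. \<Sum>y\<in>F. pr (mpath K k x) (\<lambda>l. last l = y))"
    by (rule sum.swap)
  also have "\<dots> \<le> (\<Sum>k\<le>s+t. 1)"
  proof (rule sum_mono)
    fix k
    have "(\<Sum>y\<in>F. pr (mpath K k x) (\<lambda>l. last l = y)) = EV (mpath K k x) (\<lambda>l. \<Sum>y\<in>F. of_bool (last l = y))"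
      unfolding pr_EV by (simp only: EV_sum_fun finite_path)
    also have "\<dots> \<le> 1"
    proof (intro EV_le_const finite_path)
      fix l :: "'s list"
      have "(\<Sum>y\<in>F. of_bool (last l = y)) = (of_bool (last l \<in> F) :: real)"
        using F by (simp add: of_bool_def)
      then show "(\<Sum>y\<in>F. of_bool (last l = y)) \<le> (1 :: real)" by simp
    qed
    finally show "(\<Sum>y\<in>F. pr (mpath K k x) (\<lambda>l. last l = y)) \<le> 1" .
  qed
  finally show ?thesis using assms(2) by (simp add: field_simps)
qed

text \<open>Strong Markov property at the first time when the range, together with the set \<open>A\<close>,
  has \<open>a\<close> elements.\<close>

lemma range_submultiplicative_aux:
  assumes "\<And>s y. s \<le> t \<Longrightarrow> pr (mpath K s y) (\<lambda>l. b \<le> card (set l)) \<le> q"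
    "finite A" "card A < a"
  shows "pr (mpath K t x) (\<lambda>l. a + b \<le> card (A \<union> set l)) \<le> pr (mpath K t x) (\<lambda>l. a \<le> card (A \<union> set l)) * q"
  using assms
proof (induction t arbitrary: x A)
  case 0
  have q0: "0 \<le> q" using 0(1)[of 0 x] by (meson measure_nonneg order_trans le0)
  have c: "card (A \<union> {x}) \<le> Suc (card A)" using card_insert_le_m1[of "Suc (card A)" A x] by simp
  show ?case
  proof (cases "b = 0")
    case True
    have "1 \<le> q" using 0(1)[of 0 x] True by simp
    then show ?thesis using True mult_left_mono[of 1 q "pr (mpath K 0 x) (\<lambda>l. a \<le> card (A \<union> set l))"] by simp
  next
    case False
    then have "\<not> a + b \<le> card (A \<union> {x})" using c 0(3) by linarith
    then have "pr (mpath K 0 x) (\<lambda>l. a + b \<le> card (A \<union> set l)) = 0" by (simp add: measure_return_pmf)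
    then show ?thesis using q0 by simp
  qed
next
  case (Suc t)
  have c: "card (insert x A) \<le> Suc (card A)" using card_insert_le_m1[of "Suc (card A)" A x] by simp
  show ?case
  proof (cases "card (insert x A) < a")
    case True
    have "pr (mpath K (Suc t) x) (\<lambda>l. a + b \<le> card (A \<union> set l)) =
        EV (K x) (\<lambda>y. pr (mpath K t y) (\<lambda>l. a + b \<le> card (insert x A \<union> set l)))"
      unfolding pr_path_Suc by simp
    also have "\<dots> \<le> EV (K x) (\<lambda>y. pr (mpath K t y) (\<lambda>l. a \<le> card (insert x A \<union> set l)) * q)"
      by (intro EV_mono finite_kernel Suc.IH) (use Suc.prems True in auto)
    also have "\<dots> = pr (mpath K (Suc t) x) (\<lambda>l. a \<le> card (A \<union> set l)) * q"
      unfolding pr_path_Suc by simp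
    finally show ?thesis .
  next
    case False
    \<comment> \<open>This is the stopping time: the threshold \<open>a\<close> is reached at
      \<open>x\<close>, and the path from \<open>x\<close> on must itself have range at least
      \<open>b\<close>.\<close>
    then have e: "card (insert x A) = a" using c Suc.prems(3) by linarith
    have "pr (mpath K (Suc t) x) (\<lambda>l. a \<le> card (A \<union> set l)) = 1"
    proof (rule pr_eq_1)
      fix l assume "l \<in> set_pmf (mpath K (Suc t) x)"
      then have "insert x A \<subseteq> A \<union> set l" using path_support by fast
      then show "a \<le> card (A \<union> set l)"
        using card_mono[of "A \<union> set l" "insert x A"] Suc.prems(2) e by simp
    qed
    moreover have "pr (mpath K (Suc t) x) (\<lambda>l. a + b \<le> card (A \<union> set l)) \<le> pr (mpath K (Suc t) x) (\<lambda>l. b \<le> card (set l))"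
    proof (rule pr_mono)
      fix l assume "l \<in> set_pmf (mpath K (Suc t) x)" "a + b \<le> card (A \<union> set l)"
      moreover from this have "x \<in> set l" by (auto dest: path_support)
      moreover have "card (A \<union> set l) \<le> card A + card (set l)" by (rule card_Un_le)
      ultimately show "b \<le> card (set l)" using Suc.prems(3) by linarith
    qed
    ultimately show ?thesis using Suc.prems(1)[of "Suc t" x] by simp
  qed
qed

text \<open>Each further \<open>a\<close> new sites cost another factor \<open>q\<close>, by the
  strong Markov step with empty initial set. That step wants the threshold \<open>k * a\<close> to
  be positive, whence the separate case \<open>k = 0\<close>.\<close>

lemma range_geometric_tail:
  assumes "\<And>y. pr (mpath K t y) (\<lambda>l. a \<le> card (set l)) \<le> q" "a > 0"
  shows "pr (mpath K t x) (\<lambda>l. k * a \<le> card (set l)) \<le> q ^ k"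
proof (induction k)
  case (Suc k)
  have q0: "0 \<le> q" using assms(1)[of x] by (meson measure_nonneg order_trans)
  show ?case
  proof (cases "k = 0")
    case False
    have "pr (mpath K s y) (\<lambda>l. a \<le> card (set l)) \<le> q" if "s \<le> t" for s y
    proof -
      have "pr (mpath K s y) (\<lambda>l. a \<le> card (set l)) \<le> pr (mpath K t y) (\<lambda>l. a \<le> card (set l))"
        by (rule pr_path_mono[OF that]) (auto intro: order_trans card_mono)
      with assms(1)[of y] show ?thesis by linarith
    qed
    from range_submultiplicative_aux[OF this, where A = "{}" and a = "k * a"] False assms(2)
    have "pr (mpath K t x) (\<lambda>l. k * a + a \<le> card (set l)) \<le> pr (mpath K t x) (\<lambda>l. k * a \<le> card (set l)) * q" by simp
    also have "\<dots> \<le> q ^ k * q" by (intro mult_right_mono Suc.IH q0)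
    finally show ?thesis by (simp add: add.commute mult.commute)
  qed (use assms(1) in simp)
qed simp

text \<open>The tail \<open>(1/2) ^ k\<close> integrates every base below 2. For 4/3 the ratio is
  2/3, and the geometric series gives (4/3) / (1 - 2/3) = 4.\<close>

lemma range_exp_moment:
  assumes "\<And>y. pr (mpath K t y) (\<lambda>l. a \<le> card (set l)) \<le> 1 / 2" "a > 0"
  shows "EV (mpath K t x) (\<lambda>l. (4/3) powr (real (card (set l)) / real a)) \<le> 4"
proof -
  have "EV (mpath K t x) (\<lambda>l. (4/3) powr (real (card (set l)) / real a)) \<le>
      EV (mpath K t x) (\<lambda>l. \<Sum>k\<le>Suc t. (4/3) * (4/3) ^ k * of_bool (k * a \<le> card (set l)))"
  proof (intro EV_mono finite_path)
    fix l assume "l \<in> set_pmf (mpath K t x)"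
    then have "card (set l) \<le> Suc t" using card_length[of l] by (auto dest: path_support)
    moreover define k where "k = card (set l) div a"
    ultimately have k: "k \<le> Suc t" "k * a \<le> card (set l)" "card (set l) < Suc k * a"
      using assms(2) by (auto intro: order_trans div_le_dividend simp: k_def dividend_less_div_times)
    have "real (card (set l)) \<le> real (Suc k) * real a" using k(3) by (metis less_imp_le of_nat_le_iff of_nat_mult)
    then have "real (card (set l)) / real a \<le> real (Suc k)" using assms(2) by (simp add: field_simps)
    then have "(4/3) powr (real (card (set l)) / real a) \<le> (4/3::real) powr real (Suc k)"
      by (intro powr_mono) auto
    also have "\<dots> = (4/3) * (4/3) ^ k * of_bool (k * a \<le> card (set l))"
      using k(2) by (subst powr_realpow) auto
    also have "\<dots> \<le> (\<Sum>k\<le>Suc t. (4/3) * (4/3) ^ k * of_bool (k * a \<le> card (set l)))"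
      by (rule member_le_sum) (use k in auto)
    finally show "(4/3) powr (real (card (set l)) / real a) \<le> (\<Sum>k\<le>Suc t. (4/3) * (4/3) ^ k * of_bool (k * a \<le> card (set l)))" .
  qed
  also have "\<dots> = (\<Sum>k\<le>Suc t. (4/3) * (4/3) ^ k * pr (mpath K t x) (\<lambda>l. k * a \<le> card (set l)))"
    unfolding pr_EV by (simp only: EV_sum_fun finite_path integral_mult_right_zero)
  also have "\<dots> \<le> (\<Sum>k\<le>Suc t. (4/3) * (4/3) ^ k * (1/2) ^ k)"
    by (intro sum_mono mult_left_mono range_geometric_tail assms) auto
  also have "\<dots> = (4/3) * (\<Sum>k<Suc (Suc t). (2/3) ^ k)"
    unfolding sum_distrib_left lessThan_Suc_atMost[symmetric] by (intro sum.cong) (auto simp flip: power_mult_distrib)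
  also have "\<dots> \<le> 4"
    by (subst sum_gp_strict) (auto simp: field_simps)
  finally show ?thesis .
qed

section \<open>Chains of blocks of equal length\<close>

text \<open>The range is subadditive over blocks, so its exponential moments are submultiplicative.
  The prefactor \<open>z\<close> pays for the starting site, which is the whole range when
  \<open>b = 0\<close>.\<close>

lemma EV_range_blocks:
  assumes "\<And>x. EV (mpath K t x) (\<lambda>l. z powr (real (card (set l)) / a)) \<le> C" "z \<ge> 1" "a \<ge> 1"
  shows "EV (mpath K (b * t) x) (\<lambda>l. z powr (real (card (set l)) / a)) \<le> z * C ^ b"
proof (induction b)
  case 0
  have "z powr (1 / a) \<le> z powr 1" using assms by (intro powr_mono) auto
  then show ?case using assms by simp
next
  case (Suc b)
  have "0 \<le> EV (mpath K t x) (\<lambda>l. z powr (real (card (set l)) / a))" by (rule EV_ge_const) auto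
  with assms(1)[of x] have "0 \<le> C" by linarith
  have "EV (mpath K (Suc b * t) x) (\<lambda>l. z powr (real (card (set l)) / a)) =
     EV (mpath K (b * t) x) (\<lambda>l. EV (mpath K t (last l)) (\<lambda>l'. z powr (real (card (set (l @ tl l'))) / a)))"
    using EV_path_split[of "b * t" t x] by (simp add: add.commute)
  also have "\<dots> \<le> EV (mpath K (b * t) x) (\<lambda>l. z powr (real (card (set l)) / a) * C)"
  proof (intro EV_mono finite_path)
    fix l assume l: "l \<in> set_pmf (mpath K (b * t) x)"
    have "EV (mpath K t (last l)) (\<lambda>l'. z powr (real (card (set (l @ tl l'))) / a)) \<le>
        EV (mpath K t (last l)) (\<lambda>l'. z powr (real (card (set l)) / a) * z powr (real (card (set l')) / a))"
    proof (intro EV_mono finite_path)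
      fix l' assume "l' \<in> set_pmf (mpath K t (last l))"
      from set_append_path(1)[OF l this] have "real (card (set (l @ tl l'))) \<le> real (card (set l)) + real (card (set l'))"
        using card_Un_le[of "set l" "set l'"] by simp
      then have "real (card (set (l @ tl l'))) / a \<le> real (card (set l)) / a + real (card (set l')) / a"
        using assms(3) by (simp add: field_simps)
      then show "z powr (real (card (set (l @ tl l'))) / a) \<le> z powr (real (card (set l)) / a) * z powr (real (card (set l')) / a)"
        unfolding powr_add[symmetric] using assms by (intro powr_mono) auto
    qed
    also have "\<dots> = z powr (real (card (set l)) / a) * EV (mpath K t (last l)) (\<lambda>l'. z powr (real (card (set l')) / a))" by simp
    also have "\<dots> \<le> z powr (real (card (set l)) / a) * C" by (intro mult_left_mono assms) auto
    finally show "EV (mpath K t (last l)) (\<lambda>l'. z powr (real (card (set (l @ tl l'))) / a)) \<le> z powr (real (card (set l)) / a) * C" .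
  qed
  also have "\<dots> = EV (mpath K (b * t) x) (\<lambda>l. z powr (real (card (set l)) / a)) * C" by simp
  also have "\<dots> \<le> z * C ^ b * C" by (intro mult_right_mono Suc.IH) fact
  finally show ?case by (simp add: ac_simps)
qed

text \<open>Exponential Chebyshev inequality. The prefactor 4/3 is absorbed into
  \<open>(4/3) ^ b\<close>, and 14 makes (4/3) * 4 / (4/3)^14 at most 1/9, hence at most exp
  (-2).\<close>

lemma range_upper_blocks:
  assumes "\<And>y. pr (mpath K t y) (\<lambda>l. a \<le> card (set l)) \<le> 1 / 2" "a > 0" "b > 0"
  shows "pr (mpath K (b * t) x) (\<lambda>l. 14 * a * b \<le> card (set l)) \<le> exp (- 2 * real b)"
proof -
  have "EV (mpath K (b * t) x) (\<lambda>l. (4/3) powr (real (card (set l)) / real a)) \<le> 4/3 * 4 ^ b"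
    by (rule EV_range_blocks) (use range_exp_moment[OF assms(1,2)] assms(2) in auto)
  moreover have "pr (mpath K (b * t) x) (\<lambda>l. 14 * a * b \<le> card (set l)) \<le>
      EV (mpath K (b * t) x) (\<lambda>l. (4/3) powr (real (card (set l)) / real a)) / (4/3) ^ (14 * b)"
  proof (rule markov_ineq)
    fix l :: "'s list" assume "14 * a * b \<le> card (set l)"
    then have "real (14 * b) * real a \<le> real (card (set l))" by (metis mult.assoc mult.commute of_nat_le_iff of_nat_mult)
    then have "real (14 * b) \<le> real (card (set l)) / real a" using assms(2) by (simp add: field_simps)
    then have "(4/3) powr real (14 * b) \<le> (4/3::real) powr (real (card (set l)) / real a)" by (intro powr_mono) auto
    then show "(4/3) ^ (14 * b) \<le> (4/3::real) powr (real (card (set l)) / real a)" by (subst (asm) powr_realpow) auto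
  qed auto
  moreover have "4/3 * 4 ^ b / (4/3) ^ (14 * b) \<le> exp (- 2 * real b)"
  proof -
    have e: "exp (- 2::real) \<ge> 1/9"
    proof -
      have "exp (2::real) = exp 1 * exp 1" by (simp flip: exp_add)
      also have "\<dots> \<le> 3 * 3" by (intro mult_mono) (use exp_le in auto)
      finally show ?thesis by (simp add: exp_minus field_simps)
    qed
    have "(4/3 * 4 ^ b / (4/3) ^ (14 * b) :: real) \<le> (4/3) ^ b * 4 ^ b / ((4/3) ^ 14) ^ b"
      unfolding power_mult using assms(3) self_le_power[of "4/3::real" b]
      by (intro divide_right_mono mult_right_mono) auto
    also have "\<dots> = ((4/3) * 4 / (4/3) ^ 14) ^ b" by (simp only: power_mult_distrib[symmetric] power_divide[symmetric])
    also have "\<dots> \<le> exp (- 2) ^ b" by (intro power_mono order_trans[OF _ e]) (auto simp: power_numeral_reduce)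
    also have "\<dots> = exp (- 2 * real b)" by (simp flip: exp_of_nat_mult add: mult.commute)
    finally show ?thesis .
  qed
  moreover have "EV (mpath K (b * t) x) (\<lambda>l. (4/3) powr (real (card (set l)) / real a)) / (4/3) ^ (14 * b) \<le> 4/3 * 4 ^ b / (4/3) ^ (14 * b)"
    by (intro divide_right_mono calculation(1)) auto
  ultimately show ?thesis by linarith
qed

text \<open>A path of small range has small range in every one of its blocks.\<close>

lemma range_lower_blocks:
  assumes "\<And>y. pr (mpath K t y) (\<lambda>l. real (card (set l)) < m) \<le> q"
  shows "pr (mpath K (b * t) x) (\<lambda>l. real (card (set l)) < m) \<le> q ^ b"
proof (induction b)
  case (Suc b)
  have "pr (mpath K (b * t + t) x) (\<lambda>l. real (card (set l)) < m) \<le> q ^ b * q"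
  proof (rule pr_path_split_le[OF Suc.IH, where P' = "\<lambda>_ l. real (card (set l)) < m"])
    show "0 \<le> q" using assms[of x] by (meson measure_nonneg order_trans)
    fix l l' assume l: "l \<in> set_pmf (mpath K (b * t) x)" "l' \<in> set_pmf (mpath K t (last l))"
      and c: "real (card (set (l @ tl l'))) < m"
    have "card (set l) \<le> card (set (l @ tl l'))" "card (set l') \<le> card (set (l @ tl l'))"
      unfolding set_append_path(1)[OF l] by (auto intro!: card_mono)
    with c show "real (card (set l)) < m \<and> real (card (set l')) < m" by linarith
  qed (use assms in auto)
  then show ?case by (simp add: ac_simps)
qed simp

text \<open>An inequality of Ottaviani type. From the first state \<open>z\<close> with
  \<open>F z\<close>, the walk ends outside the neighbourhood \<open>N z\<close> with probability at
  most \<open>q\<close>, whatever time is left; otherwise its endpoint satisfies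
  \<open>G\<close>.\<close>

lemma exit_bound:
  assumes "\<And>s z. s \<le> t \<Longrightarrow> pr (mpath K s z) (\<lambda>l. \<not> N z (last l)) \<le> q"
    "\<And>z w. F z \<Longrightarrow> N z w \<Longrightarrow> G w"
  shows "pr (mpath K t x) (\<lambda>l. \<exists>z\<in>set l. F z) \<le> pr (mpath K t x) (\<lambda>l. G (last l)) + q"
  using assms(1)
proof (induction t arbitrary: x)
  case (Suc t)
  have q0: "0 \<le> q" using Suc.prems[of 0 x] by (meson measure_nonneg order_trans le0)
  show ?case
  proof (cases "F x")
    case True
    have "1 = pr (mpath K (Suc t) x) (\<lambda>l. G (last l) \<or> \<not> N x (last l))"
      by (rule pr_eq_1[symmetric]) (use True assms(2) in auto)
    also have "\<dots> \<le> pr (mpath K (Suc t) x) (\<lambda>l. G (last l)) + pr (mpath K (Suc t) x) (\<lambda>l. \<not> N x (last l))"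
      by (rule pr_disj)
    also have "\<dots> \<le> pr (mpath K (Suc t) x) (\<lambda>l. G (last l)) + q" using Suc.prems[of "Suc t" x] by simp
    finally show ?thesis by (meson measure_pmf.prob_le_1 order_trans)
  next
    case False
    then have "pr (mpath K (Suc t) x) (\<lambda>l. \<exists>z\<in>set l. F z) = EV (K x) (\<lambda>y. pr (mpath K t y) (\<lambda>l. \<exists>z\<in>set l. F z))"
      unfolding pr_path_Suc by simp
    also have "\<dots> \<le> EV (K x) (\<lambda>y. pr (mpath K t y) (\<lambda>l. G (last l)) + q)"
      by (intro EV_mono finite_kernel Suc.IH) (use Suc.prems in auto)
    also have "\<dots> = pr (mpath K (Suc t) x) (\<lambda>l. G (last l)) + q"
      unfolding pr_last_Suc by (simp add: EV_add finite_kernel)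
    finally show ?thesis .
  qed
next
  case 0
  have q0: "0 \<le> q" using 0[of 0 x] by (meson measure_nonneg order_trans le0)
  show ?case
  proof (cases "F x \<and> \<not> G x")
    case True
    then have "\<not> N x x" using assms(2) by blast
    then have "1 \<le> q" using 0[of 0 x] by (simp add: measure_return_pmf)
    then show ?thesis using measure_pmf.prob_le_1 by (simp add: measure_return_pmf indicator_def)
  qed (use q0 in \<open>auto simp: measure_return_pmf indicator_def\<close>)
qed

lemma confinement_blocks:
  assumes "\<And>y. y \<in> S \<Longrightarrow> \<delta> \<le> pr (mpath K t y) (\<lambda>l. set l \<subseteq> B \<and> last l \<in> S)" "0 \<le> \<delta>" "S \<subseteq> B" "y \<in> S"
  shows "\<delta> ^ b \<le> pr (mpath K (b * t) y) (\<lambda>l. set l \<subseteq> B \<and> last l \<in> S)"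
proof (induction b)
  case 0
  show ?case using assms(3,4) by (auto simp: measure_return_pmf)
next
  case (Suc b)
  have "\<delta> ^ b * \<delta> \<le> pr (mpath K (b * t + t) y) (\<lambda>l. set l \<subseteq> B \<and> last l \<in> S)"
    by (rule pr_path_split_ge[OF Suc.IH, where P' = "\<lambda>_ l. set l \<subseteq> B \<and> last l \<in> S"])
      (use assms in \<open>auto simp: set_append_path simp del: set_append last_append\<close>)
  then show ?case by (simp add: ac_simps)
qed

text \<open>The regions \<open>S i\<close> and \<open>B i\<close> change from block to block, so the
  index \<open>j\<close> of the first block must be free for the induction to drop that
  block.\<close>

lemma excursion_blocks:
  assumes "\<And>i y. i < n \<Longrightarrow> y \<in> S i \<Longrightarrow> \<delta> \<le> pr (mpath K t y) (\<lambda>l. m \<le> real (card (set l \<inter> B i)) \<and> last l \<in> S (Suc i))"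
    "0 \<le> \<delta>" "y \<in> S j" "j + b \<le> n"
  shows "\<delta> ^ b \<le> pr (mpath K (b * t) y) (\<lambda>l. \<forall>i\<in>{j..<j+b}. m \<le> real (card (set l \<inter> B i)))"
  using assms(3,4)
proof (induction b arbitrary: j y)
  case (Suc b)
  have "\<delta> * \<delta> ^ b \<le> pr (mpath K (t + b * t) y) (\<lambda>l. \<forall>i\<in>{j..<j+Suc b}. m \<le> real (card (set l \<inter> B i)))"
  proof (rule pr_path_split_ge[where P' = "\<lambda>_ l. \<forall>i\<in>{Suc j..<Suc j+b}. m \<le> real (card (set l \<inter> B i))"])
    show "\<delta> \<le> pr (mpath K t y) (\<lambda>l. m \<le> real (card (set l \<inter> B j)) \<and> last l \<in> S (Suc j))"
      by (rule assms(1)) (use Suc.prems in auto)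
    fix l assume l: "l \<in> set_pmf (mpath K t y)" "m \<le> real (card (set l \<inter> B j)) \<and> last l \<in> S (Suc j)"
    show "\<delta> ^ b \<le> pr (mpath K (b * t) (last l)) (\<lambda>l. \<forall>i\<in>{Suc j..<Suc j + b}. m \<le> real (card (set l \<inter> B i)))"
      by (rule Suc.IH) (use l Suc.prems in auto)
    fix l' assume l': "l' \<in> set_pmf (mpath K (b * t) (last l))" "\<forall>i\<in>{Suc j..<Suc j+b}. m \<le> real (card (set l' \<inter> B i))"
    show "\<forall>i\<in>{j..<j + Suc b}. m \<le> real (card (set (l @ tl l') \<inter> B i))"
    proof
      fix i assume i: "i \<in> {j..<j + Suc b}"
      have "card (set l \<inter> B i) \<le> card (set (l @ tl l') \<inter> B i)" "card (set l' \<inter> B i) \<le> card (set (l @ tl l') \<inter> B i)"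
        unfolding set_append_path(1)[OF l(1) l'(1)] by (auto intro!: card_mono)
      moreover have "i = j \<or> i \<in> {Suc j..<Suc j+b}" using i by auto
      ultimately show "m \<le> real (card (set (l @ tl l') \<inter> B i))" using l(2) l'(2) by fastforce
    qed
  qed (use assms(2) in auto)
  then show ?case by simp
qed simp

text \<open>The range is the sum over the blocks of the sites that are new to the path so far.
  \<open>N\<close> bounds the number of entries of the whole path, and so every set of old sites
  that a block can meet.\<close>

lemma new_sites_blocks:
  assumes "\<And>x A. finite A \<Longrightarrow> card A \<le> N \<Longrightarrow> EV (mpath K t x) (\<lambda>l. exp (- \<theta> * real (card (set l - A)))) \<le> \<rho>"
    "b * t + 1 \<le> N" "0 \<le> \<theta>"
  shows "EV (mpath K (b * t) x) (\<lambda>l. exp (- \<theta> * real (card (set l)))) \<le> \<rho> ^ b"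
  using assms(2)
proof (induction b)
  case 0
  then show ?case using assms(3) by simp
next
  case (Suc b)
  have "EV (mpath K t x) (\<lambda>l. exp (- \<theta> * real (card (set l - {})))) \<le> \<rho>" by (rule assms(1)) simp_all
  moreover have "0 \<le> EV (mpath K t x) (\<lambda>l. exp (- \<theta> * real (card (set l - {}))))" by (intro EV_ge_const finite_path) simp
  ultimately have \<rho>: "0 \<le> \<rho>" by (rule order_trans[rotated])
  have "EV (mpath K (Suc b * t) x) (\<lambda>l. exp (- \<theta> * real (card (set l)))) =
     EV (mpath K (b * t) x) (\<lambda>l. EV (mpath K t (last l)) (\<lambda>l'. exp (- \<theta> * real (card (set (l @ tl l'))))))"
    using EV_path_split[of "b * t" t x] by (simp add: add.commute)
  also have "\<dots> \<le> EV (mpath K (b * t) x) (\<lambda>l. exp (- \<theta> * real (card (set l))) * \<rho>)"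
  proof (intro EV_mono finite_path)
    fix l assume l: "l \<in> set_pmf (mpath K (b * t) x)"
    have "EV (mpath K t (last l)) (\<lambda>l'. exp (- \<theta> * real (card (set (l @ tl l'))))) =
        EV (mpath K t (last l)) (\<lambda>l'. exp (- \<theta> * real (card (set l))) * exp (- \<theta> * real (card (set l' - set l))))"
    proof (intro EV_cong)
      fix l' assume "l' \<in> set_pmf (mpath K t (last l))"
      from set_append_path(1)[OF l this] have "card (set (l @ tl l')) = card (set l) + card (set l' - set l)"
        using card_Un_disjoint[of "set l" "set l' - set l"] by simp
      then show "exp (- \<theta> * real (card (set (l @ tl l')))) = exp (- \<theta> * real (card (set l))) * exp (- \<theta> * real (card (set l' - set l)))"
        by (simp add: distrib_left exp_diff exp_minus field_simps exp_add)
    qed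
    also have "\<dots> = exp (- \<theta> * real (card (set l))) * EV (mpath K t (last l)) (\<lambda>l'. exp (- \<theta> * real (card (set l' - set l))))" by simp
    also have "\<dots> \<le> exp (- \<theta> * real (card (set l))) * \<rho>"
    proof (intro mult_left_mono assms(1))
      show "card (set l) \<le> N" using card_length[of l] path_support[OF l] Suc.prems by simp
    qed auto
    finally show "EV (mpath K t (last l)) (\<lambda>l'. exp (- \<theta> * real (card (set (l @ tl l'))))) \<le> exp (- \<theta> * real (card (set l))) * \<rho>" .
  qed
  also have "\<dots> = EV (mpath K (b * t) x) (\<lambda>l. exp (- \<theta> * real (card (set l)))) * \<rho>" by simp
  also have "\<dots> \<le> \<rho> ^ b * \<rho>" by (intro mult_right_mono Suc.IH \<rho>) (use Suc.prems in auto)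
  finally show ?case by (simp add: ac_simps)
qed

end

section \<open>The lamplighter walk and the range of the base walk\<close>

definition lamp_diff :: "('v \<Rightarrow>\<^sub>0 bit) \<Rightarrow> ('v \<Rightarrow>\<^sub>0 bit) \<Rightarrow> 'v set" where
  "lamp_diff f g = {v. poly_mapping.lookup f v \<noteq> poly_mapping.lookup g v}"

lemma finite_lamp_diff: "finite (lamp_diff f g)"
proof (rule finite_subset)
  show "lamp_diff f g \<subseteq> Poly_Mapping.keys f \<union> Poly_Mapping.keys g"
    by (auto simp: lamp_diff_def in_keys_iff)
qed simp

lemma card_lamp_diff_le: "(wreath_adj E ^^ n) s t \<Longrightarrow> card (lamp_diff (fst s) (fst t)) \<le> n"
proof (induction n arbitrary: t)
  case (Suc n)
  then obtain r where r: "(wreath_adj E ^^ n) s r" "wreath_adj E r t" by auto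
  obtain w where "lamp_diff (fst s) (fst t) \<subseteq> insert w (lamp_diff (fst s) (fst r))"
    using r(2) by (force simp: wreath_adj_def lamp_diff_def split: prod.splits)
  then have "card (lamp_diff (fst s) (fst t)) \<le> card (insert w (lamp_diff (fst s) (fst r)))"
    by (intro card_mono) (simp_all add: finite_lamp_diff)
  also have "\<dots> \<le> Suc (card (lamp_diff (fst s) (fst r)))"
    by (simp add: card_insert_if finite_lamp_diff)
  finally show ?case using Suc.IH[OF r(1)] by simp
qed (simp add: lamp_diff_def)

lemma gdist_le: "(E ^^ n) x y \<Longrightarrow> gdist E x y \<le> n"
  unfolding gdist_def by (rule Least_le)

lemma relpowp_gdistI: "(E ^^ n) x y \<Longrightarrow> (E ^^ gdist E x y) x y"
  unfolding gdist_def by (rule LeastI)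

text \<open>Follow \<open>W\<close> and give every lamp on the way its value in \<open>g\<close>: at
  most one switch and one move per entry of \<open>W\<close>.\<close>

lemma wreath_walk:
  "W \<noteq> [] \<Longrightarrow> successively E W \<Longrightarrow> lamp_diff f g \<subseteq> set W \<Longrightarrow>
    \<exists>n\<le>2 * length W. (wreath_adj E ^^ n) (f, hd W) (g, last W)"
proof (induction W arbitrary: f)
  case (Cons x W)
  define f' where "f' = Poly_Mapping.update x (poly_mapping.lookup g x) f"
  obtain m where m: "m \<le> 1" "(wreath_adj E ^^ m) (f, x) (f', x)"
  proof (cases "poly_mapping.lookup f x = poly_mapping.lookup g x")
    case True
    then have "f' = f" by (intro poly_mapping_eqI) (auto simp: f'_def Poly_Mapping.lookup_update)
    then show ?thesis using that[of 0] by simp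
  next
    case False
    then have "wreath_adj E (f, x) (f', x)"
      by (auto simp: f'_def wreath_adj_def Poly_Mapping.lookup_update)
    then show ?thesis by (intro that[of 1]) (simp_all only: relpowp_1 order_refl)
  qed
  have d: "lamp_diff f' g \<subseteq> set W" if "W \<noteq> []"
    using Cons.prems(3) by (auto simp: lamp_diff_def f'_def Poly_Mapping.lookup_update)
  show ?case
  proof (cases "W = []")
    case True
    then have "f' = g"
      using Cons.prems(3) by (intro poly_mapping_eqI) (auto simp: lamp_diff_def f'_def Poly_Mapping.lookup_update)
    then show ?thesis using True m by (auto intro!: exI[of _ m])
  next
    case False
    then have "E x (hd W)" "successively E W" using Cons.prems(2) by (auto simp: successively_Cons)
    then have "wreath_adj E (f', x) (f', hd W)" by (simp add: wreath_adj_def)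
    moreover obtain n where n: "n \<le> 2 * length W" "(wreath_adj E ^^ n) (f', hd W) (g, last W)"
      using Cons.IH[OF False \<open>successively E W\<close> d[OF False]] by auto
    ultimately have "(wreath_adj E ^^ Suc n) (f', x) (g, last W)"
      by (intro relpowp_Suc_I2)
    with m(2) have "(wreath_adj E ^^ (m + Suc n)) (f, x) (g, last W)"
      unfolding relpowp_add by blast
    then show ?thesis using m(1) n(1) False by (intro exI[of _ "m + Suc n"]) auto
  qed
qed simp

text \<open>The tour goes around a spanning tree: a new last vertex of \<open>l\<close> is inserted as a detour of
  two steps behind an occurrence of its predecessor.\<close>

lemma closed_tour:
  assumes sym: "\<And>x y. E x y \<Longrightarrow> E y x" and "l \<noteq> []" "successively E l"
  shows "\<exists>W. W \<noteq> [] \<and> hd W = hd l \<and> last W = hd l \<and> successively E W \<and> set W = set l \<and>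
    length W < 2 * card (set l)"
  using assms(2,3)
proof (induction l rule: rev_induct)
  case (snoc y l)
  show ?case
  proof (cases "l = []")
    case True
    then show ?thesis by (intro exI[of _ "[y]"]) simp
  next
    case False
    then have E: "E (last l) y" and l: "successively E l"
      using snoc.prems(2) by (auto simp: successively_append_iff)
    obtain W where W: "W \<noteq> []" "hd W = hd l" "last W = hd l" "successively E W" "set W = set l"
      "length W < 2 * card (set l)" using snoc.IH[OF False l] by auto
    show ?thesis
    proof (cases "y \<in> set l")
      case True
      then show ?thesis using W False by (intro exI[of _ W]) (auto simp: insert_absorb)
    next
      case new: False
      have "last l \<in> set W" using W(5) False by simp
      then obtain A B where AB: "W = A @ last l # B" by (meson split_list)
      let ?W = "A @ [last l, y, last l] @ B"
      have "successively E ?W"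
        using W(4) E sym[OF E] unfolding AB by (auto simp: successively_append_iff successively_Cons)
      moreover have "hd ?W = hd l" "last ?W = hd l" using W(2,3) unfolding AB by (auto simp: hd_append split: if_splits)
      moreover have "set ?W = insert y (set l)" using W(5) unfolding AB by auto
      moreover have "length ?W < 2 * card (insert y (set l))" using W(6) new unfolding AB by simp
      ultimately show ?thesis using False by (intro exI[of _ ?W]) auto
    qed
  qed
qed simp

text \<open>The closed tour ends where it began. Running along it once more up to an occurrence of
  \<open>last l\<close> corrects the endpoint and at most doubles the length.\<close>

lemma covering_walk:
  assumes sym: "\<And>x y. E x y \<Longrightarrow> E y x" and "l \<noteq> []" "successively E l"
  shows "\<exists>W. W \<noteq> [] \<and> hd W = hd l \<and> last W = last l \<and> successively E W \<and> set l \<subseteq> set W \<and>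
    length W \<le> 4 * card (set l)"
proof -
  obtain W where W: "W \<noteq> []" "hd W = hd l" "last W = hd l" "successively E W" "set W = set l"
      "length W < 2 * card (set l)" using closed_tour[of E, OF sym assms(2,3)] by blast
  have "last l \<in> set W" using W(5) assms(2) by simp
  then obtain A B where AB: "W = A @ last l # B" by (meson split_list)
  \<comment> \<open>The second run drops its first entry, since the tour \<open>W\<close> already
    ends in \<open>hd l\<close>.\<close>
  define W' where "W' = tl (A @ [last l])"
  have l: "A @ [last l] = hd l # W'"
    using W(2) unfolding AB W'_def by (cases A) auto
  have sA: "successively E (A @ [last l])"
    using W(4) unfolding AB by (auto simp: successively_append_iff successively_Cons)
  have "successively E (W @ W')"
    using W sA unfolding l by (auto simp: successively_append_iff successively_Cons)
  moreover have "last (W @ W') = last l"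
  proof (cases "W' = []")
    case True
    then show ?thesis using l W(3) by (cases A) auto
  next
    case False
    then have "last W' = last (hd l # W')" by simp
    then show ?thesis using False unfolding l[symmetric] by simp
  qed
  moreover have "length (W @ W') \<le> 4 * card (set l)" using W(6) unfolding W'_def AB by simp
  moreover have "hd (W @ W') = hd l" "W @ W' \<noteq> []" "set l \<subseteq> set (W @ W')" using W(1,2,5) by simp_all
  ultimately show ?thesis by blast
qed

text \<open>The 8 is 2 steps per entry of a covering walk with at most
  \<open>4 * card (set l)\<close> entries. That walk also serves the lower bound:
  \<open>gdist\<close> is a \<open>LEAST\<close>, and only the existence of some walk makes it the
  length of one. Along that one, each step changes at most one lamp.\<close>

lemma wreath_path_range:
  assumes "\<And>x y. E x y \<Longrightarrow> E y x" "l \<noteq> []" "successively E l" "lamp_diff f g \<subseteq> set l"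
  shows "gdist (wreath_adj E) (f, hd l) (g, last l) \<le> 8 * card (set l)"
    "card (lamp_diff f g) \<le> gdist (wreath_adj E) (f, hd l) (g, last l)"
proof -
  obtain W where W: "W \<noteq> []" "hd W = hd l" "last W = last l" "successively E W" "set l \<subseteq> set W"
    "length W \<le> 4 * card (set l)" using covering_walk[of E, OF assms(1-3)] by blast
  obtain n where n: "n \<le> 2 * length W" "(wreath_adj E ^^ n) (f, hd l) (g, last l)"
    using wreath_walk[OF W(1,4), of f g] W assms(4) by auto
  show "gdist (wreath_adj E) (f, hd l) (g, last l) \<le> 8 * card (set l)"
    using gdist_le[OF n(2)] n(1) W(6) by linarith
  show "card (lamp_diff f g) \<le> gdist (wreath_adj E) (f, hd l) (g, last l)"
    using card_lamp_diff_le[OF relpowp_gdistI[OF n(2)]] unfolding fst_conv .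
qed

lemma lamp_diff_triangle: "lamp_diff f h \<subseteq> lamp_diff f g \<union> lamp_diff g h"
  by (auto simp: lamp_diff_def)

section \<open>The lamps given the base walk\<close>

context weighted_graph
begin

abbreviation "wpath \<equiv> mpath (walk \<mu>)"

abbreviation "lpath \<equiv> mpath (lamplighter_kernel \<mu>)"

lemma E_sym: "E x y \<Longrightarrow> E y x"
  unfolding weight_pos_iff[symmetric] by (subst weight_sym)

lemma set_pmf_walk: "set_pmf (walk \<mu> x) = {y. E x y}"
proof -
  have "pmf (walk \<mu> x) y \<noteq> 0 \<longleftrightarrow> E x y" for y
    unfolding pmf_walk weight_pos_iff[symmetric] using weight_nonneg[of x y] mass_pos[of x] by auto
  then show ?thesis by (simp add: set_eq_iff set_pmf_iff)
qed

sublocale W: finite_kernel "walk \<mu>"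
  by unfold_locales (simp add: set_pmf_walk locally_finite)

lemma finite_switch: "finite (set_pmf (switch_kernel s))"
  by (cases s) (simp add: switch_kernel_def)

lemma finite_move: "finite (set_pmf (move_kernel \<mu> s))"
  by (cases s) (simp add: move_kernel_def W.finite_kernel)

sublocale L: finite_kernel "lamplighter_kernel \<mu>"
  by unfold_locales (auto simp: lamplighter_kernel_def finite_switch finite_move)

lemma map_snd_switch: "map_pmf snd (switch_kernel s) = return_pmf (snd s)"
  by (cases s) (simp add: switch_kernel_def pmf.map_comp o_def map_pmf_const)

lemma map_snd_lamplighter: "map_pmf snd (lamplighter_kernel \<mu> s) = walk \<mu> (snd s)"
proof -
  have "map_pmf snd (move_kernel \<mu> t) = walk \<mu> (snd t)" for t :: "'v lamp_state"
    by (cases t) (simp add: move_kernel_def pmf.map_comp o_def)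
  then have "map_pmf snd (bind_pmf (move_kernel \<mu> t) switch_kernel) = walk \<mu> (snd t)" for t :: "'v lamp_state"
    unfolding map_bind_pmf map_snd_switch by (metis map_pmf_def)
  then have "map_pmf snd (lamplighter_kernel \<mu> s) = bind_pmf (map_pmf snd (switch_kernel s)) (walk \<mu>)"
    unfolding lamplighter_kernel_def map_bind_pmf bind_map_pmf by simp
  then show ?thesis unfolding map_snd_switch by (simp add: bind_return_pmf)
qed

lemma map_snd_path: "map_pmf (map snd) (lpath n s) = wpath n (snd s)"
proof (induction n arbitrary: s)
  case (Suc n)
  have "map_pmf (map snd) (lpath (Suc n) s) =
      bind_pmf (lamplighter_kernel \<mu> s) (\<lambda>t. map_pmf ((#) (snd s)) (map_pmf (map snd) (lpath n t)))"
    by (simp add: map_bind_pmf pmf.map_comp o_def)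
  also have "\<dots> = bind_pmf (map_pmf snd (lamplighter_kernel \<mu> s)) (\<lambda>y. map_pmf ((#) (snd s)) (wpath n y))"
    unfolding Suc.IH bind_map_pmf ..
  finally show ?case by (simp add: map_snd_lamplighter)
qed simp

lemma pr_lamplighter_walk:
  "pr (lpath n s) (\<lambda>l. Q (map snd l)) = pr (wpath n (snd s)) Q"
  unfolding map_snd_path[symmetric] pr_map ..

lemma lamplighter_support:
  assumes "t \<in> set_pmf (lamplighter_kernel \<mu> s)"
  shows "E (snd s) (snd t)" "lamp_diff (fst s) (fst t) \<subseteq> {snd s, snd t}"
proof -
  have "snd t \<in> set_pmf (map_pmf snd (lamplighter_kernel \<mu> s))" using assms by auto
  then show "E (snd s) (snd t)" by (simp add: map_snd_lamplighter set_pmf_walk)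
  obtain r r' where r: "r \<in> set_pmf (switch_kernel s)" "r' \<in> set_pmf (move_kernel \<mu> r)" "t \<in> set_pmf (switch_kernel r')"
    using assms by (auto simp: lamplighter_kernel_def)
  have sw: "lamp_diff (fst a) (fst b) \<subseteq> {snd a} \<and> snd b = snd a" if "b \<in> set_pmf (switch_kernel a)" for a b :: "'v lamp_state"
    using that by (cases a) (auto simp: switch_kernel_def lamp_diff_def Poly_Mapping.lookup_update split: if_splits)
  have "fst r' = fst r" using r(2) by (cases r) (auto simp: move_kernel_def)
  then show "lamp_diff (fst s) (fst t) \<subseteq> {snd s, snd t}"
    using sw[OF r(1)] sw[OF r(3)] lamp_diff_triangle[of "fst s" "fst t" "fst r"] by auto
qed

lemma lamplighter_path_support:
  assumes "l \<in> set_pmf (lpath n s)"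
  shows "successively E (map snd l)" "lamp_diff (fst (hd l)) (fst (last l)) \<subseteq> set (map snd l)"
  using assms
proof (induction n arbitrary: s l)
  case 0
  case 1 then show ?case by simp
  case 2 then show ?case by (simp add: lamp_diff_def)
next
  case (Suc n)
  have *: "successively E (map snd l) \<and> lamp_diff (fst (hd l)) (fst (last l)) \<subseteq> set (map snd l)"
    if "l \<in> set_pmf (lpath (Suc n) s)" for l s
  proof -
    obtain t l' where l': "t \<in> set_pmf (lamplighter_kernel \<mu> s)" "l' \<in> set_pmf (lpath n t)" "l = s # l'"
      using \<open>l \<in> set_pmf (lpath (Suc n) s)\<close>
      unfolding mpath.simps set_bind_pmf set_map_pmf by blast
    note sup = path_support[OF l'(2)]
    have "lamp_diff (fst s) (fst (last l')) \<subseteq> lamp_diff (fst s) (fst t) \<union> lamp_diff (fst t) (fst (last l'))"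
      by (rule lamp_diff_triangle)
    moreover have "snd t \<in> snd ` set l'" using sup by auto
    ultimately show ?thesis
      using lamplighter_support[OF l'(1)] Suc.IH[OF l'(2)] sup unfolding l'(3)
      by (auto simp: successively_Cons hd_map)
  qed
  case 1 show ?case by (rule *[OF 1, THEN conjunct1])
  case 2 show ?case by (rule *[OF 2, THEN conjunct2])
qed

lemma lamplighter_gdist:
  assumes "l \<in> set_pmf (lpath n s)"
  shows "gdist (wreath_adj E) (hd l) (last l) \<le> 8 * card (set (map snd l))"
    "card (lamp_diff (fst (hd l)) (fst (last l))) \<le> gdist (wreath_adj E) (hd l) (last l)"
proof -
  have ne: "l \<noteq> []" using path_support[OF assms] by simp
  note * = wreath_path_range[of E "map snd l" "fst (hd l)" "fst (last l)", OF E_sym _ lamplighter_path_support[OF assms]]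
  show "gdist (wreath_adj E) (hd l) (last l) \<le> 8 * card (set (map snd l))"
    "card (lamp_diff (fst (hd l)) (fst (last l))) \<le> gdist (wreath_adj E) (hd l) (last l)"
    using * ne by (simp_all add: hd_map last_map)
qed

lemma EV_switch:
  "EV (switch_kernel (f, x)) F = (F (Poly_Mapping.update x 0 f, x) + F (Poly_Mapping.update x 1 f, x)) / 2"
  unfolding switch_kernel_def by (simp add: integral_pmf_of_set)

lemma EV_move: "EV (move_kernel \<mu> (f, x)) F = EV (walk \<mu> x) (\<lambda>y. F (f, y))"
  by (simp add: move_kernel_def)

lemma EV_lamplighter:
  "EV (lamplighter_kernel \<mu> (f, x)) F =
    EV (switch_kernel (f, x)) (\<lambda>t. EV (walk \<mu> x) (\<lambda>y. EV (switch_kernel (fst t, y)) F))"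
  unfolding lamplighter_kernel_def
  by (simp add: EV_bind finite_switch finite_move EV_switch EV_move)

lemma switch_twice: "EV (switch_kernel s) (\<lambda>t. EV (switch_kernel t) F) = EV (switch_kernel s) F"
proof (cases s)
  case (Pair f x)
  have "Poly_Mapping.update x b (Poly_Mapping.update x c f) = Poly_Mapping.update x b f" for b c
    by (intro poly_mapping_eqI) (simp add: Poly_Mapping.lookup_update)
  then show ?thesis unfolding Pair by (simp add: EV_switch)
qed

text \<open>Given the path of the base walk, the lamps on its range are independent and uniform; the
  generating function of their number of disagreements with \<open>f0\<close> therefore factorises. The
  induction is on walks that start with a switch, since two consecutive switches amount to one.\<close>

lemma EV_switched_lamps:
  assumes "finite A"
  shows "EV (switch_kernel (f, x)) (\<lambda>s. EV (lpath n s)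
      (\<lambda>l. h (map snd l) * z ^ card (lamp_diff (fst (last l)) f0 \<inter> (A \<union> set (map snd l))))) =
    EV (wpath n x) (\<lambda>p. h p * ((1 + z) / 2) ^ card (set p) * z ^ card (lamp_diff f f0 \<inter> (A - set p)))"
  using assms
proof (induction n arbitrary: f x A h)
  case 0
  let ?D = "lamp_diff f f0 \<inter> (A - {x})"
  have 1: "lamp_diff (Poly_Mapping.update x b f) f0 \<inter> (insert x A) =
      (if b = poly_mapping.lookup f0 x then ?D else insert x ?D)" for b
    by (auto simp: lamp_diff_def Poly_Mapping.lookup_update)
  have "card (insert x ?D) = Suc (card ?D)" using 0 by simp
  moreover have "poly_mapping.lookup f0 x = 0 \<or> poly_mapping.lookup f0 x = 1" by (cases "poly_mapping.lookup f0 x") auto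
  ultimately show ?case by (auto simp: EV_switch 1 field_simps)
next
  case (Suc n)
  let ?K = "lamplighter_kernel \<mu>"
  define G where "G = (\<lambda>t. EV (mpath ?K n t) (\<lambda>l. h (x # map snd l) * z ^ card (lamp_diff (fst (last l)) f0 \<inter> (A \<union> set (x # map snd l)))))"
  have 1: "EV (mpath ?K (Suc n) s) (\<lambda>l. h (map snd l) * z ^ card (lamp_diff (fst (last l)) f0 \<inter> (A \<union> set (map snd l)))) =
      EV (?K s) G" if "snd s = x" for s
    unfolding L.EV_path_Suc G_def
    by (intro EV_cong) (auto dest: path_support simp: that)
  have "EV (switch_kernel (f, x)) (\<lambda>s. EV (mpath ?K (Suc n) s)
      (\<lambda>l. h (map snd l) * z ^ card (lamp_diff (fst (last l)) f0 \<inter> (A \<union> set (map snd l))))) =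
      EV (switch_kernel (f, x)) (\<lambda>s. EV (?K s) G)"
    by (simp only: EV_switch 1 snd_conv)
  also have "\<dots> = EV (switch_kernel (f, x)) (\<lambda>s. EV (switch_kernel s) (\<lambda>t. EV (walk \<mu> x) (\<lambda>y. EV (switch_kernel (fst t, y)) G)))"
    by (simp only: EV_switch[of f x] EV_lamplighter)
  also have "\<dots> = EV (switch_kernel (f, x)) (\<lambda>t. EV (walk \<mu> x) (\<lambda>y. EV (switch_kernel (fst t, y)) G))"
    by (rule switch_twice)
  \<comment> \<open>The site \<open>x\<close> joins the set \<open>A\<close> of lamps that are
    counted even if the remaining path does not return to them.\<close>
  also have "\<dots> = EV (switch_kernel (f, x)) (\<lambda>t. EV (walk \<mu> x) (\<lambda>y. EV (wpath n y)
      (\<lambda>p. h (x # p) * ((1 + z) / 2) ^ card (set p) * z ^ card (lamp_diff (fst t) f0 \<inter> (insert x A - set p)))))"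
    using Suc.IH[of "insert x A" _ _ "\<lambda>p. h (x # p)"] Suc.prems by (simp add: G_def)
  also have "\<dots> = EV (walk \<mu> x) (\<lambda>y. EV (wpath n y) (\<lambda>p. EV (switch_kernel (f, x))
      (\<lambda>t. h (x # p) * ((1 + z) / 2) ^ card (set p) * z ^ card (lamp_diff (fst t) f0 \<inter> (insert x A - set p)))))"
    by (simp only: EV_switch fst_conv add_divide_distrib EV_add[OF W.finite_kernel] EV_add[OF W.finite_path] integral_divide_zero)
  also have "\<dots> = EV (walk \<mu> x) (\<lambda>y. EV (wpath n y) (\<lambda>p.
      h (x # p) * ((1 + z) / 2) ^ card (set (x # p)) * z ^ card (lamp_diff f f0 \<inter> (A - set (x # p)))))"
  proof (intro EV_cong)
    fix p :: "'v list"
    let ?D = "lamp_diff f f0 \<inter> (A - set (x # p))"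
    have 1: "lamp_diff (Poly_Mapping.update x b f) f0 \<inter> (insert x A - set p) =
      (if b = poly_mapping.lookup f0 x \<or> x \<in> set p then ?D else insert x ?D)" for b
      by (auto simp: lamp_diff_def Poly_Mapping.lookup_update)
    have "card (insert x ?D) = Suc (card ?D)" using Suc.prems by simp
    moreover have "poly_mapping.lookup f0 x = 0 \<or> poly_mapping.lookup f0 x = 1" by (cases "poly_mapping.lookup f0 x") auto
    ultimately show "EV (switch_kernel (f, x))
      (\<lambda>t. h (x # p) * ((1 + z) / 2) ^ card (set p) * z ^ card (lamp_diff (fst t) f0 \<inter> (insert x A - set p))) =
      h (x # p) * ((1 + z) / 2) ^ card (set (x # p)) * z ^ card ?D"
      unfolding EV_switch fst_conv 1 by (auto simp: insert_absorb field_simps)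
  qed
  also have "\<dots> = EV (wpath (Suc n) x) (\<lambda>p. h p * ((1 + z) / 2) ^ card (set p) * z ^ card (lamp_diff f f0 \<inter> (A - set p)))"
    unfolding W.EV_path_Suc ..
  finally show ?case .
qed

text \<open>The first step of the walk begins with a switch at \<open>x\<close>, so a preliminary
  switch there leaves the law after that step unchanged and \<open>EV_switched_lamps\<close>
  applies. At time 0 no lamp has been resampled, hence \<open>n \<ge> 1\<close>. \<open>A\<close> is
  empty because only lamps in the range can differ from \<open>f\<close>.\<close>

lemma EV_lamps:
  assumes "n \<ge> 1"
  shows "EV (lpath n (f, x))
      (\<lambda>l. h (map snd l) * z ^ card (lamp_diff f (fst (last l)))) =
    EV (wpath n x) (\<lambda>p. h p * ((1 + z) / 2) ^ card (set p))"
proof -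
  let ?K = "lamplighter_kernel \<mu>"
  obtain m where n: "n = Suc m" using assms by (cases n) auto
  have 0: "lamp_diff f (fst (last l)) = lamp_diff (fst (last l)) f \<inter> ({} \<union> set (map snd l))"
    if "l \<in> set_pmf (mpath ?K n (f, x))" for l
  proof -
    have "lamp_diff f (fst (last l)) = lamp_diff (fst (last l)) f" by (auto simp: lamp_diff_def)
    then show ?thesis
      using lamplighter_path_support(2)[OF that] path_support[OF that] by auto
  qed
  define F where "F = (\<lambda>l :: 'v lamp_state list. h (map snd l) * z ^ card (lamp_diff (fst (last l)) f \<inter> ({} \<union> set (map snd l))))"
  have F: "EV (mpath ?K n s) F = EV (?K s) (\<lambda>t. EV (mpath ?K m t) (\<lambda>l. F ((f, x) # l)))" if "snd s = x" for s
    unfolding n L.EV_path_Suc by (intro EV_cong) (auto simp: F_def that dest: path_support)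
  have "EV (mpath ?K n (f, x)) (\<lambda>l. h (map snd l) * z ^ card (lamp_diff f (fst (last l)))) = EV (mpath ?K n (f, x)) F"
    unfolding F_def by (intro EV_cong) (simp only: 0[symmetric])
  also have "\<dots> = EV (?K (f, x)) (\<lambda>t. EV (mpath ?K m t) (\<lambda>l. F ((f, x) # l)))"
    by (simp add: F)
  \<comment> \<open>\<open>switch_twice\<close> read from right to left: the extra switch is
    inserted before the one inside the kernel.\<close>
  also have "\<dots> = EV (switch_kernel (f, x)) (\<lambda>s. EV (?K s) (\<lambda>t. EV (mpath ?K m t) (\<lambda>l. F ((f, x) # l))))"
    unfolding EV_lamplighter EV_switch[of f x "\<lambda>s. EV (?K s) _"] unfolding EV_lamplighter
    by (subst switch_twice[symmetric]) (simp only: EV_switch[of f x])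
  also have "\<dots> = EV (switch_kernel (f, x)) (\<lambda>s. EV (mpath ?K n s) F)"
    by (simp only: EV_switch F snd_conv)
  also have "\<dots> = EV (wpath n x) (\<lambda>p. h p * ((1 + z) / 2) ^ card (set p))"
    unfolding F_def EV_switched_lamps[OF finite.emptyI] by simp
  finally show ?thesis .
qed

text \<open>A Chernoff bound with \<open>z = (7/10)^4\<close>. If at most a quarter of the lamps in
  a range of size R disagree, then \<open>(10/7) ^ R\<close> times \<open>z\<close> to their number
  is at least 1, while its mean given the base path is ((10/7) * (1 + z) / 2)^R, and this base is
  below 9/10.\<close>

lemma few_lamps_on:
  assumes "n \<ge> 1"
  shows "pr (lpath n (f, x)) (\<lambda>l. 4 * card (lamp_diff f (fst (last l))) \<le> card (set (map snd l)) \<and>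
      m \<le> card (set (map snd l))) \<le> (9/10) ^ m"
proof -
  let ?K = "lamplighter_kernel \<mu>"
  define h :: "'v list \<Rightarrow> real" where "h = (\<lambda>p. of_bool (m \<le> card (set p)) * (10/7) ^ card (set p))"
  let ?z = "(7/10)^4 :: real"
  have "pr (mpath ?K n (f, x)) (\<lambda>l. 4 * card (lamp_diff f (fst (last l))) \<le> card (set (map snd l)) \<and>
      m \<le> card (set (map snd l))) \<le> EV (mpath ?K n (f, x)) (\<lambda>l. h (map snd l) * ?z ^ card (lamp_diff f (fst (last l)))) / 1"
  proof (rule markov_ineq)
    fix l :: "'v lamp_state list" assume *: "4 * card (lamp_diff f (fst (last l))) \<le> card (set (map snd l)) \<and> m \<le> card (set (map snd l))"
    have "(7/10::real) ^ card (set (map snd l)) \<le> (7/10) ^ (4 * card (lamp_diff f (fst (last l))))"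
      by (rule power_decreasing) (use * in auto)
    then have "(10/7::real) ^ card (set (map snd l)) * (7/10) ^ card (set (map snd l)) \<le>
        (10/7) ^ card (set (map snd l)) * (7/10) ^ (4 * card (lamp_diff f (fst (last l))))"
      by (rule mult_left_mono) simp
    moreover have "(10/7::real) ^ card (set (map snd l)) * (7/10) ^ card (set (map snd l)) = 1"
      by (simp flip: power_mult_distrib)
    ultimately have "1 \<le> (10/7) ^ card (set (map snd l)) * ?z ^ card (lamp_diff f (fst (last l)))"
      unfolding power_mult by linarith
    then show "1 \<le> h (map snd l) * ?z ^ card (lamp_diff f (fst (last l)))"
      using * unfolding h_def by (simp only: of_bool_eq mult_1)
  qed (auto simp: h_def)
  also have "\<dots> = EV (wpath n x) (\<lambda>p. h p * ((1 + ?z) / 2) ^ card (set p))"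
    by (subst EV_lamps[OF assms]) simp
  also have "\<dots> \<le> (9/10) ^ m"
  proof (rule EV_le_const)
    fix p :: "'v list"
    have "h p * ((1 + ?z) / 2) ^ card (set p) = of_bool (m \<le> card (set p)) * ((10/7) * ((1 + ?z) / 2)) ^ card (set p)"
      unfolding h_def power_mult_distrib[symmetric] mult.assoc by (simp only: power_mult_distrib)
    also have "\<dots> \<le> of_bool (m \<le> card (set p)) * (9/10) ^ card (set p)"
      by (intro mult_left_mono power_mono) (auto simp: power_numeral_reduce)
    also have "\<dots> \<le> (9/10) ^ m" by (auto intro: power_decreasing)
    finally show "h p * ((1 + ?z) / 2) ^ card (set p) \<le> (9/10) ^ m" .
  qed simp
  finally show ?thesis .
qed

end

section \<open>Estimates for the range of the base walk\<close>

text \<open>Comparison with the integral: by the mean value theorem each summand is at most an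
  increment of \<open>z powr (1 - \<alpha>) / (1 - \<alpha>)\<close>, and the increments
  telescope.\<close>

lemma sum_powr_neg_le:
  assumes "0 < \<alpha>" "\<alpha> < 1"
  shows "(\<Sum>k=1..n. real k powr (-\<alpha>)) \<le> real n powr (1 - \<alpha>) / (1 - \<alpha>)"
proof (induction n)
  case (Suc n)
  have "(1 - \<alpha>) * real (Suc n) powr (-\<alpha>) \<le> real (Suc n) powr (1 - \<alpha>) - real n powr (1 - \<alpha>)"
  proof (cases "n = 0")
    case False
    have "\<exists>z. real n < z \<and> z < real (Suc n) \<and> real (Suc n) powr (1 - \<alpha>) - real n powr (1 - \<alpha>) =
        (real (Suc n) - real n) * ((1 - \<alpha>) * z powr (1 - \<alpha> - 1))"
    proof (rule MVT2)
      fix z assume "real n \<le> z"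
      then show "((\<lambda>z. z powr (1 - \<alpha>)) has_real_derivative (1 - \<alpha>) * z powr (1 - \<alpha> - 1)) (at z)"
        using False by (intro has_real_derivative_powr) simp
    qed simp
    then obtain z where z: "real n < z" "z < real (Suc n)"
      "real (Suc n) powr (1 - \<alpha>) - real n powr (1 - \<alpha>) = (1 - \<alpha>) * z powr (- \<alpha>)" by auto
    have "real (Suc n) powr (-\<alpha>) \<le> z powr (-\<alpha>)"
      by (rule powr_mono2') (use z assms in auto)
    then show ?thesis unfolding z(3) using assms by (intro mult_left_mono) auto
  qed (use assms in auto)
  then have "real (Suc n) powr (-\<alpha>) \<le> (real (Suc n) powr (1 - \<alpha>) - real n powr (1 - \<alpha>)) / (1 - \<alpha>)"
    using assms by (simp add: field_simps)
  with Suc.IH show ?case by (simp add: diff_divide_distrib)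
qed simp

text \<open>The inequality \<open>y \<le> exp y\<close> at \<open>y = c * u / q\<close>, raised to
  the power \<open>q\<close>.\<close>

lemma powr_exp_bound:
  fixes u q c :: real
  assumes "0 < q" "0 < c" "0 < u"
  shows "u powr q * exp (- c * u) \<le> (q / c) powr q"
proof -
  have "c * u / q \<le> exp (c * u / q)" using exp_ge_add_one_self[of "c * u / q"] by linarith
  then have "(c * u / q) powr q \<le> exp (c * u / q) powr q"
    by (intro powr_mono2) (use assms in auto)
  also have "\<dots> = exp (c * u)" using assms by (simp add: powr_def)
  finally have "u powr q * (c / q) powr q \<le> exp (c * u)"
    unfolding powr_mult[symmetric] by (simp add: mult.commute)
  then have "u powr q * (c / q) powr q * (q / c) powr q \<le> exp (c * u) * (q / c) powr q"
    by (rule mult_right_mono) simp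
  moreover have "(c / q) powr q * (q / c) powr q = 1"
    unfolding powr_mult[symmetric] using assms by simp
  ultimately have "u powr q \<le> exp (c * u) * (q / c) powr q" by (simp add: mult.assoc)
  then show ?thesis by (simp add: exp_minus field_simps)
qed

section \<open>Graph distance and transition probabilities\<close>

context weighted_graph
begin

abbreviation p where "p n x y \<equiv> pr (wpath n x) (\<lambda>l. last l = y)"

lemma step_prob_eq: "step_prob \<mu> n x y = p n x y"
proof -
  have "measure (chain_law (walk \<mu>) x) {\<omega>. last (map \<omega> [0..<Suc n]) = y} = p n x y"
    by (rule measure_chain_law_path(2)[OF countable_vertices])
  then show ?thesis unfolding step_prob_def by simp
qed

lemma gdist_eq_0: "gdist E x y = 0 \<longleftrightarrow> x = y"
proof
  assume "gdist E x y = 0"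
  then show "x = y" using relpowp_gdist[of x y] by simp
next
  assume "x = y"
  then show "gdist E x y = 0" using gdist_le[of 0 E x y] by simp
qed

lemma gdist_self [simp]: "gdist E x x = 0" by (simp add: gdist_eq_0)

lemma gdist_triangle: "gdist E x z \<le> gdist E x y + gdist E y z"
  using relpowp_gdist[of x y] relpowp_gdist[of y z] by (intro gdist_le) (auto simp: relpowp_add)

lemma gdist_sym: "gdist E x y = gdist E y x"
proof -
  have "(E ^^ n) y x" if "(E ^^ n) x y" for n x y
    using that
  proof (induction n arbitrary: y)
    case (Suc n)
    then obtain z where "(E ^^ n) x z" "E z y" by auto
    then show ?case using Suc.IH E_sym by (meson relpowp_Suc_I2)
  qed auto
  then have "gdist E y x \<le> gdist E x y" for x y
    using relpowp_gdist[of x y] by (intro gdist_le) blast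
  then show ?thesis by (simp add: antisym)
qed

lemma gdist_edge: "E x y \<Longrightarrow> gdist E x y \<le> 1"
  by (rule gdist_le) (simp only: relpowp_1)

lemma gdist_path:
  "l \<in> set_pmf (wpath n x) \<Longrightarrow> gdist E x (last l) \<le> n"
proof (induction n arbitrary: x l)
  case (Suc n)
  then obtain y l' where l: "y \<in> set_pmf (walk \<mu> x)" "l' \<in> set_pmf (wpath n y)" "l = x # l'"
    unfolding mpath.simps set_bind_pmf set_map_pmf by blast
  have "gdist E x (last l') \<le> gdist E x y + gdist E y (last l')" by (rule gdist_triangle)
  also have "\<dots> \<le> 1 + n" using gdist_edge Suc.IH[OF l(2)] l(1) by (intro add_mono) (auto simp: set_pmf_walk)
  finally show ?case using l path_support[OF l(2)] by simp
qed simp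

lemma mem_gball: "y \<in> gball E x (real r) \<longleftrightarrow> gdist E x y \<le> r"
  by (simp add: gball_def)

text \<open>Balls are finite, so some \<open>w\<close> lies farther than \<open>n\<close> from
  \<open>x\<close>. On a shortest walk to \<open>w\<close> the triangle inequality leaves no slack,
  and every initial piece is itself shortest.\<close>

lemma geodesic:
  "\<exists>f. f 0 = x \<and> (\<forall>i\<le>n. gdist E x (f i) = i) \<and> (\<forall>i<n. E (f i) (f (Suc i)))"
proof -
  have "UNIV \<noteq> gball E x (real n)" using infinite_vertices finite_gball by metis
  then obtain w where "w \<notin> gball E x (real n)" by auto
  then have w: "n < gdist E x w" unfolding mem_gball by simp
  obtain f where f: "f 0 = x" "f (gdist E x w) = w" "\<And>i. i < gdist E x w \<Longrightarrow> E (f i) (f (Suc i))"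
    using relpowp_gdist[of x w] unfolding relpowp_fun_conv by blast
  have up: "j \<le> gdist E x w \<Longrightarrow> i \<le> j \<Longrightarrow> gdist E (f i) (f j) \<le> j - i" for i j
  proof (induction j)
    case (Suc j)
    show ?case
    proof (cases "i = Suc j")
      case False
      have "gdist E (f i) (f (Suc j)) \<le> gdist E (f i) (f j) + gdist E (f j) (f (Suc j))" by (rule gdist_triangle)
      also have "\<dots> \<le> (j - i) + 1"
        using Suc False by (intro add_mono gdist_edge f) auto
      finally show ?thesis using False Suc.prems by simp
    qed simp
  qed simp
  have "gdist E x (f i) = i" if "i \<le> n" for i
  proof (rule antisym)
    show "gdist E x (f i) \<le> i" using up[of i 0] f(1) that w by simp
    have "gdist E x w \<le> gdist E x (f i) + gdist E (f i) w" by (rule gdist_triangle)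
    also have "gdist E (f i) w \<le> gdist E x w - i" using up[of "gdist E x w" i] f(2) that w by simp
    finally show "i \<le> gdist E x (f i)" using that w by simp
  qed
  then show ?thesis using f w by (intro exI[of _ f]) auto
qed

lemma pr_last_in:
  assumes "finite S"
  shows "pr (wpath n x) (\<lambda>l. last l \<in> S) = (\<Sum>y\<in>S. p n x y)"
proof -
  have "pr (wpath n x) (\<lambda>l. last l \<in> S) = EV (wpath n x) (\<lambda>l. \<Sum>y\<in>S. of_bool (last l = y))"
    unfolding pr_EV by (intro EV_cong) (use assms in \<open>simp add: of_bool_def\<close>)
  also have "\<dots> = (\<Sum>y\<in>S. p n x y)"
    unfolding pr_EV by (simp only: EV_sum_fun W.finite_path)
  finally show ?thesis .
qed

end

section \<open>Recurrent walks: tails of the range\<close>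

text \<open>The recurrent case with the masses eliminated: cardinality instead of volume, transition
  probabilities instead of densities, and \<open>n powr (-\<alpha>)\<close> instead of the inverse
  volume of the ball of radius \<open>n powr (1 / \<beta>)\<close>. Here \<open>D\<close>,
  \<open>\<beta>\<close> and \<open>\<alpha>\<close> stand for \<open>df\<close>, \<open>dw\<close>
  and \<open>ds / 2\<close>; \<open>subdiffusive_graphI\<close> derives this form.\<close>

locale subdiffusive_graph = weighted_graph +
  fixes D \<beta> \<alpha> A a c C v V :: real
  assumes \<beta>: "1 < \<beta>" and D: "0 < D" and \<alpha>: "\<alpha> = D / \<beta>" "\<alpha> < 1"
    and pos: "0 < A" "0 < a" "0 < c" "0 < C" "0 < v" "0 < V"
    and card_ball: "1 \<le> r \<Longrightarrow> v * real r powr D \<le> real (card (gball E x (real r)))"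
      "1 \<le> r \<Longrightarrow> real (card (gball E x (real r))) \<le> V * real r powr D"
    and upper: "1 \<le> n \<Longrightarrow> pr (mpath (walk \<mu>) n x) (\<lambda>l. last l = y) \<le>
      A * real n powr (-\<alpha>) * exp (- c * (real (gdist E x y) powr \<beta> / real n) powr (1 / (\<beta> - 1)))"
    and lower: "1 \<le> n \<Longrightarrow> gdist E x y \<le> n \<Longrightarrow>
      a * real n powr (-\<alpha>) * exp (- C * (real (gdist E x y) powr \<beta> / real n) powr (1 / (\<beta> - 1))) \<le>
      pr (mpath (walk \<mu>) n x) (\<lambda>l. last l = y) + pr (mpath (walk \<mu>) (n + 1) x) (\<lambda>l. last l = y)"
begin

lemma \<alpha>_pos: "0 < \<alpha>" using \<beta> D \<alpha> by simp

lemma on_diagonal: "1 \<le> n \<Longrightarrow> p n x y \<le> A * real n powr (-\<alpha>)"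
proof -
  assume n: "1 \<le> n"
  have "A * real n powr (-\<alpha>) * exp (- c * (real (gdist E x y) powr \<beta> / real n) powr (1 / (\<beta> - 1))) \<le> A * real n powr (-\<alpha>) * 1"
    using pos by (intro mult_left_mono) auto
  with upper[OF n, of x y] show ?thesis by linarith
qed

lemma range_lower_tail:
  assumes "0 < q"
  shows "\<exists>c>0. \<forall>t\<ge>1. \<forall>x. pr (wpath t x) (\<lambda>l. real (card (set l)) < c * real t powr \<alpha>) \<le> q"
proof -
  \<comment> \<open>Chosen so that \<open>1 + 2 * A * t powr (1 - \<alpha>) / (1 - \<alpha>) \<le> t
    powr (1 - \<alpha>) * B\<close> for \<open>t \<ge> 1\<close>.\<close>
  define B where "B = 1 + 2 * A / (1 - \<alpha>)"
  have B: "0 < B" using pos \<alpha>(2) unfolding B_def by (intro add_pos_nonneg) auto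
  show ?thesis
  proof (intro exI[of _ "q / B"] conjI allI impI)
    fix t :: nat and x assume t: "1 \<le> t"
    \<comment> \<open>By Cauchy-Schwarz a range below the threshold forces at least \<open>T\<close>
      self-intersections.\<close>
    define T where "T = (real t + 1)\<^sup>2 / (q / B * real t powr \<alpha>)"
    have den: "0 < q / B * real t powr \<alpha>" using t B assms by simp
    have "EV (wpath t x) (\<lambda>l. real (self_intersections l)) \<le> (real t + 1) * (1 + 2 * (\<Sum>k=1..t. A * real k powr (-\<alpha>)))"
      by (rule W.EV_self_intersections) (use on_diagonal in auto)
    also have "\<dots> \<le> (real t + 1) * (real t powr (1 - \<alpha>) * B)"
    proof (intro mult_left_mono)
      have "(\<Sum>k=1..t. A * real k powr (-\<alpha>)) \<le> A * (real t powr (1 - \<alpha>) / (1 - \<alpha>))"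
        unfolding sum_distrib_left[symmetric] using pos \<alpha>_pos \<alpha> by (intro mult_left_mono sum_powr_neg_le) auto
      moreover have "1 \<le> real t powr (1 - \<alpha>)" using t \<alpha> by (intro ge_one_powr_ge_zero) auto
      moreover have "real t powr (1 - \<alpha>) * B = real t powr (1 - \<alpha>) + 2 * (A * (real t powr (1 - \<alpha>) / (1 - \<alpha>)))"
        unfolding B_def by (simp add: algebra_simps)
      ultimately show "1 + 2 * (\<Sum>k=1..t. A * real k powr (-\<alpha>)) \<le> real t powr (1 - \<alpha>) * B"
        by linarith
    qed auto
    finally have E: "EV (wpath t x) (\<lambda>l. real (self_intersections l)) \<le> (real t + 1) * (real t powr (1 - \<alpha>) * B)" .
    have "pr (wpath t x) (\<lambda>l. real (card (set l)) < q / B * real t powr \<alpha>) \<le>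
        EV (wpath t x) (\<lambda>l. real (self_intersections l)) / T"
    proof (rule markov_ineq)
      show "0 < T" unfolding T_def using den by (intro divide_pos_pos zero_less_power) auto
      fix l assume l: "l \<in> set_pmf (wpath t x)" "real (card (set l)) < q / B * real t powr \<alpha>"
      have "(real t + 1)\<^sup>2 \<le> real (card (set l)) * real (self_intersections l)"
        using length_filter_squared_le[of "\<lambda>_. True" l] path_support[OF l(1)] by (simp add: add.commute)
      also have "\<dots> \<le> (q / B * real t powr \<alpha>) * real (self_intersections l)"
        using l(2) by (intro mult_right_mono) auto
      finally show "T \<le> real (self_intersections l)"
        unfolding T_def by (subst pos_divide_le_eq[OF den]) (simp only: mult.commute)
    qed auto
    also have "\<dots> \<le> (real t + 1) * (real t powr (1 - \<alpha>) * B) / T"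
      by (rule divide_right_mono[OF E]) (unfold T_def, intro divide_nonneg_pos den zero_le_power2)
    also have "\<dots> = q * (real t powr (1 - \<alpha>) * real t powr \<alpha>) / (real t + 1)"
    proof -
      have "y * (u * B) / (y\<^sup>2 / (q / B * w)) = q * (u * w) / y" if "0 < y" for y u w :: real
        using B that by (simp add: power2_eq_square field_simps)
      then show ?thesis unfolding T_def by simp
    qed
    also have "real t powr (1 - \<alpha>) * real t powr \<alpha> = real t" using t by (simp flip: powr_add)
    also have "q * real t / (real t + 1) \<le> q" using assms by (simp add: field_simps)
    finally show "pr (wpath t x) (\<lambda>l. real (card (set l)) < q / B * real t powr \<alpha>) \<le> q" .
  qed (use B assms in auto)
qed

text \<open>The lower kernel bound at \<open>y\<close> pairs consecutive times. Summed over
  \<open>1..t\<close> it counts each time up to \<open>t + 1\<close> at most twice, which is the 2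
  in the denominator of \<open>g\<close> and the horizon \<open>Suc t\<close> of the Green
  function.\<close>

lemma range_mean:
  assumes "1 \<le> t"
  shows "EV (wpath t x) (\<lambda>l. real (card (set l))) \<le> 8 / a * real t powr \<alpha>"
proof -
  define g where "g = a * real t powr (1 - \<alpha>) / 2"
  have g: "0 < g" using assms pos by (simp add: g_def)
  have "EV (wpath t x) (\<lambda>l. real (card (set l))) \<le> (real (t + Suc t) + 1) / g"
  proof (rule W.EV_card_range_green[OF _ g])
    fix y
    have "real t * (a * real t powr (-\<alpha>)) = (\<Sum>k=1..t. a * real t powr (-\<alpha>))" by simp
    also have "\<dots> \<le> (\<Sum>k=1..t. p k y y + p (k + 1) y y)"
    proof (rule sum_mono)
      fix k assume k: "k \<in> {1..t}"
      have "real t powr (-\<alpha>) \<le> real k powr (-\<alpha>)" using k \<alpha>_pos by (intro powr_mono2') auto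
      then have "a * real t powr (-\<alpha>) \<le> a * real k powr (-\<alpha>)" using pos by (intro mult_left_mono) auto
      also have "\<dots> \<le> p k y y + p (k + 1) y y" using lower[of k y y] k \<beta> by simp
      finally show "a * real t powr (-\<alpha>) \<le> p k y y + p (k + 1) y y" .
    qed
    also have "\<dots> \<le> (\<Sum>k\<le>Suc t. p k y y) + (\<Sum>k\<le>Suc t. p k y y)"
      unfolding sum.distrib
    proof (rule add_mono)
      show "(\<Sum>k=1..t. p k y y) \<le> (\<Sum>k\<le>Suc t. p k y y)" by (rule sum_mono2) auto
      have "(\<Sum>k=1..t. p (k + 1) y y) = (\<Sum>k=2..Suc t. p k y y)"
        by (rule sum.reindex_bij_witness[of _ "\<lambda>k. k - 1" "\<lambda>k. k + 1"]) auto
      also have "\<dots> \<le> (\<Sum>k\<le>Suc t. p k y y)" by (rule sum_mono2) auto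
      finally show "(\<Sum>k=1..t. p (k + 1) y y) \<le> (\<Sum>k\<le>Suc t. p k y y)" .
    qed
    also have "real t * (a * real t powr (-\<alpha>)) = 2 * g"
      using assms by (simp add: g_def powr_diff powr_minus_divide)
    finally show "g \<le> (\<Sum>k\<le>Suc t. p k y y)" by simp
  qed
  also have "\<dots> \<le> 4 * real t / g" using assms g by (intro divide_right_mono) auto
  also have "\<dots> = 8 / a * real t powr \<alpha>"
    using assms pos by (simp add: g_def powr_diff)
  finally show ?thesis .
qed

lemma nat_ceiling_bounds:
  assumes "1 \<le> (z::real)"
  shows "z \<le> real (nat \<lceil>z\<rceil>)" "real (nat \<lceil>z\<rceil>) \<le> 2 * z" "1 \<le> nat \<lceil>z\<rceil>"
  using assms by linarith+

lemma two_powr_\<alpha>: "2 powr \<alpha> \<le> 2"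
  using powr_mono[of \<alpha> 1 "2::real"] \<alpha> by simp

text \<open>The block length \<open>n / b\<close> is rounded up, which only enlarges the range; the
  union of \<open>b\<close> blocks of range about (n/b)^\<alpha> has the order n^\<alpha>
  b^(1-\<alpha>).\<close>

lemma range_upper_tail:
  "\<exists>B>0. \<forall>x n b. 1 \<le> b \<and> b \<le> n \<longrightarrow>
    pr (wpath n x) (\<lambda>l. B * real n powr \<alpha> * real b powr (1 - \<alpha>) \<le> real (card (set l))) \<le> exp (- 2 * real b)"
proof -
  define G where "G = 16 / a + 2"
  have G: "0 < G" using pos by (simp add: G_def add_pos_pos)
  show ?thesis
  proof (intro exI[of _ "28 * G"] conjI allI impI)
    fix x and n b :: nat assume b: "1 \<le> b \<and> b \<le> n"
    define t where "t = nat \<lceil>real n / real b\<rceil>"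
    have "1 \<le> real n / real b" using b by simp
    note t = nat_ceiling_bounds[OF this, folded t_def]
    have "real n \<le> real t * real b" using t(1) b by (simp add: field_simps)
    then have nt: "n \<le> b * t" by (metis mult.commute of_nat_le_iff of_nat_mult)
    have t\<alpha>: "1 \<le> real t powr \<alpha>" using t(3) \<alpha>_pos by (intro ge_one_powr_ge_zero) auto
    \<comment> \<open>At least twice the bound on the mean range of a block, so that Markov's
      inequality gives 1/2.\<close>
    define k where "k = nat \<lceil>16 / a * real t powr \<alpha>\<rceil> + 1"
    have k: "16 / a * real t powr \<alpha> \<le> real k" "0 < k" by (auto simp: k_def) linarith
    have "0 \<le> 16 / a * real t powr \<alpha>" using pos by simp
    then have "real k \<le> 16 / a * real t powr \<alpha> + 2" unfolding k_def by linarith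
    also have "\<dots> \<le> G * real t powr \<alpha>" unfolding G_def using t\<alpha> by (simp add: algebra_simps)
    also have "\<dots> \<le> G * (2 * (real n / real b)) powr \<alpha>"
      using G t \<alpha>_pos by (intro mult_left_mono powr_mono2) auto
    also have "\<dots> \<le> G * (2 * (real n / real b) powr \<alpha>)"
      unfolding powr_mult using two_powr_\<alpha> G by (intro mult_left_mono mult_right_mono) auto
    finally have k2: "real k \<le> 2 * G * (real n / real b) powr \<alpha>" by simp
    have half: "pr (wpath t y) (\<lambda>l. k \<le> card (set l)) \<le> 1 / 2" for y
    proof -
      have "8 / a * real t powr \<alpha> \<le> real k / 2" using k(1) by simp
      then have "8 / a * real t powr \<alpha> / real k \<le> 1 / 2" using k(2) by (subst pos_divide_le_eq) auto
      moreover have "EV (wpath t y) (\<lambda>l. real (card (set l))) / real k \<le> 8 / a * real t powr \<alpha> / real k"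
        by (intro divide_right_mono range_mean t) auto
      moreover have "pr (wpath t y) (\<lambda>l. k \<le> card (set l)) \<le> EV (wpath t y) (\<lambda>l. real (card (set l))) / real k"
        by (rule markov_ineq) (use k in auto)
      ultimately show ?thesis by linarith
    qed
    have "real (14 * k * b) \<le> 14 * (2 * G * (real n / real b) powr \<alpha>) * real b"
      using k2 by (simp add: mult_right_mono)
    also have "\<dots> = 28 * G * real n powr \<alpha> * real b powr (1 - \<alpha>)"
      using b by (simp add: powr_divide powr_diff)
    finally have le: "real (14 * k * b) \<le> 28 * G * real n powr \<alpha> * real b powr (1 - \<alpha>)" .
    have "pr (wpath n x) (\<lambda>l. 28 * G * real n powr \<alpha> * real b powr (1 - \<alpha>) \<le> real (card (set l))) \<le>
        pr (wpath n x) (\<lambda>l. 14 * k * b \<le> card (set l))"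
      by (rule pr_mono) (use le in linarith)
    also have "\<dots> \<le> pr (wpath (b * t) x) (\<lambda>l. 14 * k * b \<le> card (set l))"
      by (rule W.pr_path_mono[OF nt]) (auto intro: order_trans card_mono)
    also have "\<dots> \<le> exp (- 2 * real b)"
      by (rule W.range_upper_blocks[OF half]) (use k b in auto)
    finally show "pr (wpath n x) (\<lambda>l. 28 * G * real n powr \<alpha> * real b powr (1 - \<alpha>) \<le> real (card (set l))) \<le> exp (- 2 * real b)" .
  qed (use G in simp)
qed

text \<open>Here the block length is rounded down; \<open>n \<le> 2 * t * b\<close> costs a factor
  of at most 2 in the constant. Each block fails with probability at most exp (-2).\<close>

lemma range_lower_tail_blocks:
  "\<exists>B>0. \<forall>x n b. 1 \<le> b \<and> b \<le> n \<longrightarrow>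
    pr (wpath n x) (\<lambda>l. real (card (set l)) < B * real n powr \<alpha> * real b powr (- \<alpha>)) \<le> exp (- 2 * real b)"
proof -
  obtain B where B: "B > 0" "\<And>t x. 1 \<le> t \<Longrightarrow> pr (wpath t x) (\<lambda>l. real (card (set l)) < B * real t powr \<alpha>) \<le> exp (- 2)"
    using range_lower_tail[of "exp (- 2)"] by auto
  show ?thesis
  proof (intro exI[of _ "B / 2"] conjI allI impI)
    fix x and n b :: nat assume b: "1 \<le> b \<and> b \<le> n"
    define t where "t = n div b"
    have t: "1 \<le> t" using b by (simp add: t_def div_greater_zero_iff Suc_leI)
    have nt: "b * t \<le> n" by (simp add: t_def)
    have "n < (t + 1) * b" unfolding t_def using b by (simp add: dividend_less_div_times)
    also have "\<dots> \<le> 2 * t * b" using t by (intro mult_right_mono) auto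
    finally have "real n \<le> 2 * real t * real b" by (metis less_imp_le of_nat_le_iff of_nat_mult of_nat_numeral)
    then have "real n / real b \<le> 2 * real t" using b by (simp add: field_simps)
    then have "(real n / real b) powr \<alpha> \<le> (2 * real t) powr \<alpha>" using \<alpha>_pos by (intro powr_mono2) auto
    also have "\<dots> \<le> 2 * real t powr \<alpha>" unfolding powr_mult using two_powr_\<alpha> by (intro mult_right_mono) auto
    finally have "B / 2 * (real n / real b) powr \<alpha> \<le> B / 2 * (2 * real t powr \<alpha>)" using B by (intro mult_left_mono) auto
    then have le: "B / 2 * real n powr \<alpha> * real b powr (- \<alpha>) \<le> B * real t powr \<alpha>"
      by (simp add: powr_divide powr_minus_divide)
    have "pr (wpath (b * t) x) (\<lambda>l. B * real t powr \<alpha> \<le> real (card (set l))) \<le>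
        pr (wpath n x) (\<lambda>l. B * real t powr \<alpha> \<le> real (card (set l)))"
      by (rule W.pr_path_mono[OF nt]) (auto elim!: order_trans intro: card_mono)
    then have "pr (wpath n x) (\<lambda>l. real (card (set l)) < B * real t powr \<alpha>) \<le>
      pr (wpath (b * t) x) (\<lambda>l. real (card (set l)) < B * real t powr \<alpha>)"
      using pr_neg[of "wpath n x" "\<lambda>l. B * real t powr \<alpha> \<le> real (card (set l))"]
        pr_neg[of "wpath (b * t) x" "\<lambda>l. B * real t powr \<alpha> \<le> real (card (set l))"]
      by (simp add: not_le)
    also have "\<dots> \<le> exp (- 2) ^ b" by (rule W.range_lower_blocks) (rule B(2)[OF t])
    also have "\<dots> = exp (- 2 * real b)" by (simp flip: exp_of_nat_mult add: mult.commute)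
    finally have "pr (wpath n x) (\<lambda>l. real (card (set l)) < B * real t powr \<alpha>) \<le> exp (- 2 * real b)" .
    moreover have "pr (wpath n x) (\<lambda>l. real (card (set l)) < B / 2 * real n powr \<alpha> * real b powr (- \<alpha>)) \<le>
       pr (wpath n x) (\<lambda>l. real (card (set l)) < B * real t powr \<alpha>)"
      by (rule pr_mono) (use le in linarith)
    ultimately show "pr (wpath n x) (\<lambda>l. real (card (set l)) < B / 2 * real n powr \<alpha> * real b powr (- \<alpha>)) \<le> exp (- 2 * real b)"
      by linarith
  qed (use B in simp)
qed

end

section \<open>Displacement, confinement and excursions\<close>

context subdiffusive_graph
begin

text \<open>Polynomial decay of order \<open>1 / w\<close> is all that the displacement bounds take
  from the stretched exponential.\<close>

lemma kernel_decay:
  "\<exists>B>0. \<forall>w>0. w powr \<alpha> * exp (- c * w powr (1 / (\<beta> - 1))) \<le> B / w"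
proof -
  \<comment> \<open>With this \<open>q\<close>, the power \<open>q\<close> of
    \<open>w powr (1 / (\<beta> - 1))\<close> is \<open>w powr (\<alpha> + 1)\<close>.\<close>
  define q where "q = (\<alpha> + 1) * (\<beta> - 1)"
  have q: "0 < q" using \<alpha>_pos \<beta> by (simp add: q_def)
  show ?thesis
  proof (intro exI[of _ "(q / c) powr q"] conjI allI impI)
    fix w :: real assume w: "0 < w"
    let ?u = "w powr (1 / (\<beta> - 1))"
    have "?u powr q * exp (- c * ?u) \<le> (q / c) powr q"
      by (rule powr_exp_bound) (use q pos w in auto)
    moreover have "?u powr q = w powr \<alpha> * w"
      using \<beta> w by (simp add: powr_powr q_def powr_add)
    ultimately show "w powr \<alpha> * exp (- c * ?u) \<le> (q / c) powr q / w"
      using w by (simp add: field_simps)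
  qed (use q pos in simp)
qed

text \<open>The shell has at most \<open>V * (2 * \<rho>) powr D\<close> sites, and on it the kernel
  is largest at distance \<open>\<rho>\<close>. Since \<open>D = \<alpha> * \<beta>\<close>, size
  and diagonal factor combine to the power \<open>\<alpha>\<close> of
  \<open>\<rho> powr \<beta> / s\<close>, which \<open>kernel_decay\<close> handles.\<close>

lemma shell_bound:
  "\<exists>B>0. \<forall>x s \<rho>. 1 \<le> s \<and> 1 \<le> \<rho> \<longrightarrow>
    pr (wpath s x) (\<lambda>l. \<rho> < gdist E x (last l) \<and> gdist E x (last l) \<le> 2 * \<rho>) \<le> B * real s / real \<rho> powr \<beta>"
proof -
  obtain B where B: "B > 0" "\<And>w. w > 0 \<Longrightarrow> w powr \<alpha> * exp (- c * w powr (1 / (\<beta> - 1))) \<le> B / w"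
    using kernel_decay by auto
  show ?thesis
  proof (intro exI[of _ "V * 2 powr D * A * B"] conjI allI impI)
    fix x and s \<rho> :: nat assume s: "1 \<le> s \<and> 1 \<le> \<rho>"
    define w where "w = real \<rho> powr \<beta> / real s"
    have w: "0 < w" using s by (simp add: w_def)
    let ?S = "{y \<in> gball E x (real (2 * \<rho>)). \<rho> < gdist E x y}"
    have "pr (wpath s x) (\<lambda>l. \<rho> < gdist E x (last l) \<and> gdist E x (last l) \<le> 2 * \<rho>) =
        pr (wpath s x) (\<lambda>l. last l \<in> ?S)"
      by (rule pr_cong) (auto simp: gball_def)
    also have "\<dots> = (\<Sum>y\<in>?S. p s x y)" by (rule pr_last_in) (simp add: finite_gball)
    also have "\<dots> \<le> (\<Sum>y\<in>?S. A * real s powr (-\<alpha>) * exp (- c * w powr (1 / (\<beta> - 1))))"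
    proof (rule sum_mono)
      fix y assume y: "y \<in> ?S"
      have "p s x y \<le> A * real s powr (-\<alpha>) * exp (- c * (real (gdist E x y) powr \<beta> / real s) powr (1 / (\<beta> - 1)))"
        using upper s by blast
      also have "\<dots> \<le> A * real s powr (-\<alpha>) * exp (- c * w powr (1 / (\<beta> - 1)))"
      proof (intro mult_left_mono)
        have "w \<le> real (gdist E x y) powr \<beta> / real s"
          unfolding w_def using y \<beta> by (intro divide_right_mono powr_mono2) auto
        then have "w powr (1 / (\<beta> - 1)) \<le> (real (gdist E x y) powr \<beta> / real s) powr (1 / (\<beta> - 1))"
          using w \<beta> by (intro powr_mono2) auto
        then show "exp (- c * (real (gdist E x y) powr \<beta> / real s) powr (1 / (\<beta> - 1))) \<le> exp (- c * w powr (1 / (\<beta> - 1)))"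
          using pos by simp
      qed (use pos in auto)
      finally show "p s x y \<le> A * real s powr (-\<alpha>) * exp (- c * w powr (1 / (\<beta> - 1)))" .
    qed
    also have "\<dots> = real (card ?S) * (A * real s powr (-\<alpha>) * exp (- c * w powr (1 / (\<beta> - 1))))" by simp
    also have "\<dots> \<le> (V * (2 powr D * real \<rho> powr D)) * (A * real s powr (-\<alpha>) * exp (- c * w powr (1 / (\<beta> - 1))))"
    proof (rule mult_right_mono)
      have "card ?S \<le> card (gball E x (real (2 * \<rho>)))" by (rule card_mono) (auto simp: finite_gball)
      then have "real (card ?S) \<le> real (card (gball E x (real (2 * \<rho>))))" by simp
      also have "\<dots> \<le> V * real (2 * \<rho>) powr D" by (rule card_ball) (use s in simp)
      also have "real (2 * \<rho>) powr D = 2 powr D * real \<rho> powr D" by (simp add: powr_mult)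
      finally show "real (card ?S) \<le> V * (2 powr D * real \<rho> powr D)" .
    qed (use pos in simp)
    also have "\<dots> = V * 2 powr D * A * ((real \<rho> powr D * real s powr (-\<alpha>)) * exp (- c * w powr (1 / (\<beta> - 1))))" by simp
    also have "real \<rho> powr D * real s powr (-\<alpha>) = w powr \<alpha>"
      unfolding w_def powr_divide powr_powr using \<alpha> \<beta> by (simp add: powr_minus_divide)
    also have "V * 2 powr D * A * (w powr \<alpha> * exp (- c * w powr (1 / (\<beta> - 1)))) \<le> V * 2 powr D * A * (B / w)"
      using pos B(2)[OF w] by (intro mult_left_mono) auto
    also have "\<dots> = V * 2 powr D * A * B * real s / real \<rho> powr \<beta>" by (simp add: w_def)
    finally show "pr (wpath s x) (\<lambda>l. \<rho> < gdist E x (last l) \<and> gdist E x (last l) \<le> 2 * \<rho>) \<le>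
      V * 2 powr D * A * B * real s / real \<rho> powr \<beta>" .
  qed (use pos B in simp)
qed

text \<open>Dyadic shells, by induction on the number of doublings that bring \<open>\<rho>\<close>
  up to \<open>s\<close>, beyond which the walk cannot be. The constant \<open>2 * B\<close> closes
  the induction because \<open>2 powr \<beta> \<ge> 2\<close>.\<close>

lemma displacement_tail:
  "\<exists>B>0. \<forall>x s \<rho>. 1 \<le> \<rho> \<longrightarrow>
    pr (wpath s x) (\<lambda>l. \<rho> < gdist E x (last l)) \<le> B * real s / real \<rho> powr \<beta>"
proof -
  obtain B where B: "B > 0" "\<And>x s \<rho>. 1 \<le> s \<Longrightarrow> 1 \<le> \<rho> \<Longrightarrow>
    pr (wpath s x) (\<lambda>l. \<rho> < gdist E x (last l) \<and> gdist E x (last l) \<le> 2 * \<rho>) \<le> B * real s / real \<rho> powr \<beta>"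
    using shell_bound by blast
  show ?thesis
  proof (intro exI[of _ "2 * B"] conjI allI impI)
    fix x and s \<rho> :: nat assume \<rho>: "1 \<le> \<rho>"
    have zero: "pr (wpath s x) (\<lambda>l. \<rho> < gdist E x (last l)) = 0" if "s \<le> \<rho>" for \<rho>
      by (rule pr_eq_0) (use gdist_path that in fastforce)
    show "pr (wpath s x) (\<lambda>l. \<rho> < gdist E x (last l)) \<le> 2 * B * real s / real \<rho> powr \<beta>"
    proof (cases "s = 0")
      case True
      then show ?thesis using zero[of \<rho>] by simp
    next
      case False
      have "pr (wpath s x) (\<lambda>l. \<rho> < gdist E x (last l)) \<le> 2 * B * real s / real \<rho> powr \<beta>"
        if "s \<le> 2 ^ J * \<rho>" "1 \<le> \<rho>" for J \<rho>
        using that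
      proof (induction J arbitrary: \<rho>)
        case 0
        then show ?case using zero[of \<rho>] B(1) by simp
      next
        case (Suc J)
        have "pr (wpath s x) (\<lambda>l. \<rho> < gdist E x (last l)) \<le>
            pr (wpath s x) (\<lambda>l. (\<rho> < gdist E x (last l) \<and> gdist E x (last l) \<le> 2 * \<rho>) \<or> 2 * \<rho> < gdist E x (last l))"
          by (rule pr_mono) auto
        also have "\<dots> \<le> B * real s / real \<rho> powr \<beta> + 2 * B * real s / real (2 * \<rho>) powr \<beta>"
        proof (intro order_trans[OF pr_disj] add_mono)
          show "pr (wpath s x) (\<lambda>l. \<rho> < gdist E x (last l) \<and> gdist E x (last l) \<le> 2 * \<rho>) \<le> B * real s / real \<rho> powr \<beta>"
            by (rule B(2)) (use False Suc.prems in auto)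
          show "pr (wpath s x) (\<lambda>l. 2 * \<rho> < gdist E x (last l)) \<le> 2 * B * real s / real (2 * \<rho>) powr \<beta>"
            by (rule Suc.IH) (use Suc.prems in \<open>auto simp: ac_simps\<close>)
        qed
        also have "\<dots> \<le> B * real s / real \<rho> powr \<beta> + B * real s / real \<rho> powr \<beta>"
        proof (rule add_left_mono)
          have "(2::real) powr 1 \<le> 2 powr \<beta>" by (rule powr_mono) (use \<beta> in auto)
          then have "2 * real \<rho> powr \<beta> \<le> real (2 * \<rho>) powr \<beta>" by (simp add: powr_mult mult_right_mono)
          then have "2 * B * real s / real (2 * \<rho>) powr \<beta> \<le> 2 * B * real s / (2 * real \<rho> powr \<beta>)"
            using B Suc.prems by (intro divide_left_mono) auto
          then show "2 * B * real s / real (2 * \<rho>) powr \<beta> \<le> B * real s / real \<rho> powr \<beta>" by simp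
        qed
        finally show ?case by simp
      qed
      moreover have "s \<le> 2 ^ s * \<rho>"
      proof -
        have "s \<le> 2 ^ s" by (simp add: less_imp_le)
        also have "\<dots> \<le> 2 ^ s * \<rho>" using \<rho> by simp
        finally show ?thesis .
      qed
      ultimately show ?thesis using \<rho> by blast
    qed
  qed (use B in simp)
qed

text \<open>The time scale \<open>t\<close> corresponds to the space scale \<open>radius t\<close>.\<close>

definition radius :: "nat \<Rightarrow> nat" where "radius t = nat \<lceil>real t powr (1 / \<beta>)\<rceil>"

lemma radius:
  assumes "1 \<le> t"
  shows "1 \<le> radius t" "real t \<le> real (radius t) powr \<beta>" "real (radius t) powr \<beta> \<le> 2 powr \<beta> * real t"
    "real t powr \<alpha> \<le> real (radius t) powr D" "real (radius t) powr D \<le> 2 powr D * real t powr \<alpha>"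
    "real (radius t) \<le> 2 * real t powr (1 / \<beta>)"
proof -
  have "1 \<le> real t powr (1 / \<beta>)" using assms \<beta> by (intro ge_one_powr_ge_zero) auto
  note r = nat_ceiling_bounds[OF this, folded radius_def]
  have t: "(real t powr (1 / \<beta>)) powr \<beta> = real t" "(real t powr (1 / \<beta>)) powr D = real t powr \<alpha>"
    using \<beta> \<alpha> assms by (simp_all add: powr_powr)
  show "1 \<le> radius t" "real (radius t) \<le> 2 * real t powr (1 / \<beta>)" by (fact r)+
  show "real t \<le> real (radius t) powr \<beta>"
    using powr_mono2[of \<beta>, OF _ _ r(1)] \<beta> t by simp
  show "real t powr \<alpha> \<le> real (radius t) powr D"
    using powr_mono2[of D, OF _ _ r(1)] D t by simp
  show "real (radius t) powr \<beta> \<le> 2 powr \<beta> * real t"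
    using powr_mono2[of \<beta>, OF _ _ r(2)] \<beta> t by (simp add: powr_mult)
  show "real (radius t) powr D \<le> 2 powr D * real t powr \<alpha>"
    using powr_mono2[of D, OF _ _ r(2)] D t by (simp add: powr_mult)
qed

text \<open>A path that leaves the ball of radius 2\<rho> either ends outside radius \<rho> or moves
  by more than \<rho> after leaving, with \<rho> the radius \<open>K * radius t\<close>. Both have
  probability at most \<open>B / K \<le> \<epsilon> / 2\<close>, as
  \<open>K powr \<beta> \<ge> K\<close>.\<close>

lemma exit_tail:
  assumes "0 < \<epsilon>"
  shows "\<exists>K\<ge>1. \<forall>x. \<forall>t\<ge>1. pr (wpath t x) (\<lambda>l. \<exists>z\<in>set l. 2 * (K * radius t) < gdist E x z) \<le> \<epsilon>"
proof -
  obtain B where B: "B > 0" "\<And>x s \<rho>. 1 \<le> \<rho> \<Longrightarrow>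
    pr (wpath s x) (\<lambda>l. \<rho> < gdist E x (last l)) \<le> B * real s / real \<rho> powr \<beta>"
    using displacement_tail by blast
  define K where "K = nat \<lceil>2 * B / \<epsilon>\<rceil> + 1"
  have K: "1 \<le> K" "2 * B / \<epsilon> \<le> real K" unfolding K_def by (simp, linarith)
  show ?thesis
  proof (intro exI[of _ K] conjI allI impI)
    fix x and t :: nat assume t: "1 \<le> t"
    let ?\<rho> = "K * radius t"
    have \<rho>: "1 \<le> ?\<rho>" using K radius(1)[OF t] by simp
    have q: "pr (wpath s z) (\<lambda>l. ?\<rho> < gdist E z (last l)) \<le> \<epsilon> / 2" if "s \<le> t" for s z
    proof -
      have "pr (wpath s z) (\<lambda>l. ?\<rho> < gdist E z (last l)) \<le> B * real s / real ?\<rho> powr \<beta>"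
        by (rule B(2)[OF \<rho>])
      also have "\<dots> \<le> B * real t / (real K * real t)"
      proof (rule frac_le)
        have "real K powr 1 \<le> real K powr \<beta>" using K \<beta> by (intro powr_mono) auto
        then have "real K * real t \<le> real K powr \<beta> * real (radius t) powr \<beta>"
          using K radius(2)[OF t] by (intro mult_mono) auto
        then show "real K * real t \<le> real ?\<rho> powr \<beta>" by (simp add: powr_mult)
      qed (use that t B K in auto)
      also have "\<dots> = B / real K" using t by simp
      also have "\<dots> \<le> \<epsilon> / 2" using K assms by (simp add: field_simps)
      finally show ?thesis .
    qed
    have "pr (wpath t x) (\<lambda>l. \<exists>z\<in>set l. 2 * ?\<rho> < gdist E x z) \<le>
        pr (wpath t x) (\<lambda>l. ?\<rho> < gdist E x (last l)) + \<epsilon> / 2"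
    proof (rule W.exit_bound[where N = "\<lambda>z w. gdist E z w \<le> ?\<rho>"])
      fix z w assume "2 * ?\<rho> < gdist E x z" "gdist E z w \<le> ?\<rho>"
      then show "?\<rho> < gdist E x w" using gdist_triangle[of x z w] gdist_sym[of w z] by linarith
    qed (use q in \<open>simp add: not_le\<close>)
    also have "\<dots> \<le> \<epsilon>" using q[of t x] by simp
    finally show "pr (wpath t x) (\<lambda>l. \<exists>z\<in>set l. 2 * ?\<rho> < gdist E x z) \<le> \<epsilon>" .
  qed (rule K)
qed

text \<open>The lower kernel bound is summed over the ball of radius \<open>radius t\<close> about
  \<open>x\<close>, which has order t^\<alpha> sites of weight of order t^(-\<alpha>). The bound
  pairs the times \<open>t - 1\<close> and \<open>t\<close>; a walk in that ball at time
  \<open>t - 1\<close> is within \<open>radius t + 1\<close> one step later, hence the target radius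
  \<open>2 * radius t\<close> and the factor 1/2.\<close>

lemma near_diagonal:
  "\<exists>\<delta>>0. \<exists>t0\<ge>1. \<forall>t\<ge>t0. \<forall>x y. gdist E x y \<le> K * radius t \<longrightarrow>
    \<delta> \<le> pr (wpath t y) (\<lambda>l. gdist E x (last l) \<le> 2 * radius t)"
proof -
  \<comment> \<open>Bounds \<open>d powr \<beta> / s\<close> for distances \<open>d\<close> up to
    \<open>(K + 1) * radius t\<close>; the 2 comes from \<open>t \<le> 2 * s\<close>, the
    \<open>2 powr \<beta>\<close> from rounding the radius up.\<close>
  define H where "H = 2 * ((real K + 1) powr \<beta> * 2 powr \<beta>)"
  define e where "e = exp (- C * H powr (1 / (\<beta> - 1)))"
  \<comment> \<open>From \<open>t0\<close> on, \<open>(K + 1) * radius t \<le> t - 1\<close>, so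
    that all distances in play satisfy the restriction \<open>gdist E x y \<le> n\<close> of
    \<open>lower\<close>; the 2 ensures \<open>t - 1 \<ge> 1\<close>.\<close>
  define t0 where "t0 = nat \<lceil>(4 * (real K + 1)) powr (1 / (1 - 1 / \<beta>))\<rceil> + 2"
  have b: "0 < 1 - 1 / \<beta>" using \<beta> by simp
  show ?thesis
  proof (intro exI[of _ "a * e * v / 2"] exI[of _ t0] conjI allI impI)
    fix t x y assume t0: "t0 \<le> t" and d: "gdist E x y \<le> K * radius t"
    have t: "2 \<le> t" using t0 by (simp add: t0_def)
    then have t1: "1 \<le> t" by simp
    note r = radius[OF t1]
    define s where "s = t - 1"
    have s: "1 \<le> s" "s + 1 = t" "real t \<le> 2 * real s" using t by (auto simp: s_def)
    have far: "(K + 1) * radius t \<le> s"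
    proof -
      have "(4 * (real K + 1)) powr (1 / (1 - 1 / \<beta>)) \<le> real t0" unfolding t0_def by linarith
      also have "\<dots> \<le> real t" using t0 by simp
      finally have "((4 * (real K + 1)) powr (1 / (1 - 1 / \<beta>))) powr (1 - 1 / \<beta>) \<le> real t powr (1 - 1 / \<beta>)"
        using b by (intro powr_mono2) auto
      moreover have "1 / (1 - 1 / \<beta>) * (1 - 1 / \<beta>) = 1" using \<beta> by simp
      ultimately have "4 * (real K + 1) \<le> real t powr (1 - 1 / \<beta>)" unfolding powr_powr by simp
      then have "4 * (real K + 1) * real t powr (1 / \<beta>) \<le> real t powr (1 - 1 / \<beta>) * real t powr (1 / \<beta>)"
        by (rule mult_right_mono) simp
      also have "\<dots> = real t" using t by (simp flip: powr_add)
      finally have "4 * (real K + 1) * real t powr (1 / \<beta>) \<le> real t" .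
      moreover have "(real K + 1) * (2 * real t powr (1 / \<beta>)) = 4 * (real K + 1) * real t powr (1 / \<beta>) / 2" by simp
      ultimately have "(real K + 1) * (2 * real t powr (1 / \<beta>)) \<le> real s" using s(3) by linarith
      moreover have "(real K + 1) * real (radius t) \<le> (real K + 1) * (2 * real t powr (1 / \<beta>))"
        using r by (intro mult_left_mono) auto
      ultimately have "real ((K + 1) * radius t) \<le> real s" by (simp add: algebra_simps)
      then show ?thesis by (simp only: of_nat_le_iff)
    qed
    let ?B = "gball E x (real (radius t))"
    have "a * e * v \<le> a * e * v * (real t powr \<alpha> * real t powr (-\<alpha>))" using t by (simp flip: powr_add)
    also have "\<dots> = v * real t powr \<alpha> * (a * real t powr (-\<alpha>) * e)" by simp
    also have "\<dots> \<le> real (card ?B) * (a * real t powr (-\<alpha>) * e)"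
    proof (rule mult_right_mono)
      have "v * real t powr \<alpha> \<le> v * real (radius t) powr D" using pos r by (intro mult_left_mono) auto
      also have "\<dots> \<le> real (card ?B)" by (rule card_ball) (rule r)
      finally show "v * real t powr \<alpha> \<le> real (card ?B)" .
    qed (use pos in \<open>simp add: e_def\<close>)
    also have "\<dots> = (\<Sum>z\<in>?B. a * real t powr (-\<alpha>) * e)" by simp
    also have "\<dots> \<le> (\<Sum>z\<in>?B. p s y z + p (s + 1) y z)"
    proof (rule sum_mono)
      fix z assume "z \<in> ?B"
      then have dz: "gdist E y z \<le> (K + 1) * radius t"
        using gdist_triangle[of y z x] gdist_sym[of y x] d by (simp add: gball_def)
      have "real (gdist E y z) powr \<beta> \<le> real ((K + 1) * radius t) powr \<beta>"
        using dz \<beta> by (intro powr_mono2) linarith+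
      also have "\<dots> = (real K + 1) powr \<beta> * real (radius t) powr \<beta>"
        unfolding of_nat_mult powr_mult by (simp add: add.commute)
      also have "\<dots> \<le> (real K + 1) powr \<beta> * (2 powr \<beta> * (2 * real s))"
        using r s by (intro mult_left_mono order_trans[OF r(3)]) auto
      also have "\<dots> = H * real s" by (simp add: H_def)
      finally have "real (gdist E y z) powr \<beta> / real s \<le> H" using s by (simp add: field_simps)
      then have "(real (gdist E y z) powr \<beta> / real s) powr (1 / (\<beta> - 1)) \<le> H powr (1 / (\<beta> - 1))"
        using \<beta> by (intro powr_mono2) auto
      then have e: "e \<le> exp (- C * (real (gdist E y z) powr \<beta> / real s) powr (1 / (\<beta> - 1)))"
        unfolding e_def using pos by simp
      have "real t powr (-\<alpha>) \<le> real s powr (-\<alpha>)" using s \<alpha>_pos by (intro powr_mono2') auto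
      then have "a * real t powr (-\<alpha>) * e \<le>
          a * real s powr (-\<alpha>) * exp (- C * (real (gdist E y z) powr \<beta> / real s) powr (1 / (\<beta> - 1)))"
        using e pos by (intro mult_mono mult_left_mono) (auto simp: e_def)
      also have "\<dots> \<le> p s y z + p (s + 1) y z"
        by (rule lower) (use s far dz in auto)
      finally show "a * real t powr (-\<alpha>) * e \<le> p s y z + p (s + 1) y z" .
    qed
    also have "\<dots> = pr (wpath s y) (\<lambda>l. last l \<in> ?B) + pr (wpath t y) (\<lambda>l. last l \<in> ?B)"
      unfolding sum.distrib pr_last_in[OF finite_gball] s(2) ..
    also have "\<dots> \<le> pr (wpath t y) (\<lambda>l. gdist E x (last l) \<le> 2 * radius t) +
        pr (wpath t y) (\<lambda>l. gdist E x (last l) \<le> 2 * radius t)"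
    proof (rule add_mono)
      have "pr (wpath s y) (\<lambda>l. last l \<in> ?B) * 1 \<le> pr (wpath (s + 1) y) (\<lambda>l. gdist E x (last l) \<le> 2 * radius t)"
      proof (rule W.pr_path_split_ge[OF order_refl, where P' = "\<lambda>_ _. True"])
        fix l l' assume l: "l \<in> set_pmf (wpath s y)" "l' \<in> set_pmf (wpath 1 (last l))" "last l \<in> ?B"
        have "gdist E x (last l') \<le> gdist E x (last l) + gdist E (last l) (last l')" by (rule gdist_triangle)
        also have "\<dots> \<le> radius t + 1" using l(3) gdist_path[OF l(2)] by (simp add: gball_def)
        also have "\<dots> \<le> 2 * radius t" using r by simp
        finally show "gdist E x (last (l @ tl l')) \<le> 2 * radius t"
          using W.set_append_path(2)[OF l(1,2)] by simp
      qed auto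
      then show "pr (wpath s y) (\<lambda>l. last l \<in> ?B) \<le> pr (wpath t y) (\<lambda>l. gdist E x (last l) \<le> 2 * radius t)"
        unfolding s(2) mult_1_right .
      show "pr (wpath t y) (\<lambda>l. last l \<in> ?B) \<le> pr (wpath t y) (\<lambda>l. gdist E x (last l) \<le> 2 * radius t)"
        by (rule pr_mono) (simp add: gball_def)
    qed
    finally show "a * e * v / 2 \<le> pr (wpath t y) (\<lambda>l. gdist E x (last l) \<le> 2 * radius t)" by simp
  qed (use pos in \<open>auto simp: e_def t0_def\<close>)
qed

text \<open>The probability \<open>\<delta>\<close> of coming back near the centre is fixed before
  the size of the confining ball, so \<open>K\<close> can be chosen such that leaving the ball on
  the way costs at most half of \<open>\<delta>\<close>. The assumption
  \<open>n0 * b \<le> n\<close> makes the blocks long enough for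
  \<open>near_diagonal\<close>.\<close>

lemma small_range:
  "\<exists>B>0. \<exists>\<delta>>0. \<exists>n0. \<forall>x n b. 1 \<le> b \<and> n0 * b \<le> n \<longrightarrow>
    \<delta> ^ b \<le> pr (wpath n x) (\<lambda>l. real (card (set l)) \<le> B * real n powr \<alpha> * real b powr (- \<alpha>))"
proof -
  obtain \<delta> t0 where \<delta>: "\<delta> > 0" "t0 \<ge> 1" "\<And>t x y. t \<ge> t0 \<Longrightarrow> gdist E x y \<le> 2 * radius t \<Longrightarrow>
    \<delta> \<le> pr (wpath t y) (\<lambda>l. gdist E x (last l) \<le> 2 * radius t)"
    using near_diagonal[of 2] by auto
  obtain K where K: "K \<ge> 1" "\<And>x t. 1 \<le> t \<Longrightarrow>
    pr (wpath t x) (\<lambda>l. \<exists>z\<in>set l. 2 * (K * radius t) < gdist E x z) \<le> \<delta> / 2"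
    using exit_tail[of "\<delta> / 2"] \<delta>(1) by auto
  \<comment> \<open>At most \<open>2 * radius t\<close> from the centre to the start of a block, and
    \<open>2 * K * radius t\<close> within the block.\<close>
  define M where "M = 2 * K + 2"
  define B where "B = V * (real M powr D * (2 powr D * 2))"
  have B: "0 < B" using pos by (simp add: B_def M_def)
  show ?thesis
  proof (rule exI[of _ B], rule conjI[OF B], rule exI[of _ "\<delta> / 2"], rule conjI[OF half_gt_zero[OF \<delta>(1)]],
      rule exI[of _ t0], intro allI impI)
    fix x and n b :: nat assume n: "1 \<le> b \<and> t0 * b \<le> n"
    have "1 * b \<le> t0 * b" using \<delta>(2) by (rule mult_right_mono) simp
    then have "b \<le> n" using n by linarith
    define t where "t = nat \<lceil>real n / real b\<rceil>"
    have "1 \<le> real n / real b" using n \<open>b \<le> n\<close> by simp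
    note t = nat_ceiling_bounds[OF this, folded t_def]
    have "real n \<le> real t * real b" using t(1) n by (simp add: field_simps)
    then have nt: "n \<le> b * t" by (metis mult.commute of_nat_le_iff of_nat_mult)
    have "real (t0 * b) \<le> real n" using n by (simp only: of_nat_le_iff)
    then have "real t0 \<le> real n / real b" using n by (simp add: field_simps)
    with t(1) have t0: "t0 \<le> t" by linarith
    let ?S = "{y. gdist E x y \<le> 2 * radius t}" and ?B = "gball E x (real (M * radius t))"
    have block: "\<delta> / 2 \<le> pr (wpath t y) (\<lambda>l. set l \<subseteq> ?B \<and> last l \<in> ?S)" if y: "y \<in> ?S" for y
    proof -
      have "\<delta> / 2 \<le> pr (wpath t y) (\<lambda>l. gdist E x (last l) \<le> 2 * radius t) -
          pr (wpath t y) (\<lambda>l. \<not> \<not> (\<exists>z\<in>set l. 2 * (K * radius t) < gdist E y z))"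
        using \<delta>(3)[OF t0, of x y] K(2)[OF t(3), of y] y by simp
      also have "\<dots> \<le> pr (wpath t y) (\<lambda>l. gdist E x (last l) \<le> 2 * radius t \<and>
          \<not> (\<exists>z\<in>set l. 2 * (K * radius t) < gdist E y z))"
        by (rule pr_conj_ge)
      also have "\<dots> \<le> pr (wpath t y) (\<lambda>l. set l \<subseteq> ?B \<and> last l \<in> ?S)"
      proof (rule pr_mono)
        fix l assume l: "gdist E x (last l) \<le> 2 * radius t \<and> \<not> (\<exists>z\<in>set l. 2 * (K * radius t) < gdist E y z)"
        have "z \<in> ?B" if "z \<in> set l" for z
        proof -
          have "gdist E x z \<le> 2 * radius t + 2 * (K * radius t)"
            using gdist_triangle[of x z y] l y that by fastforce
          then show ?thesis unfolding mem_gball M_def by (simp add: algebra_simps)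
        qed
        then show "set l \<subseteq> ?B \<and> last l \<in> ?S" using l by auto
      qed
      finally show ?thesis .
    qed
    have "(\<delta> / 2) ^ b \<le> pr (wpath (b * t) x) (\<lambda>l. set l \<subseteq> ?B \<and> last l \<in> ?S)"
    proof (rule W.confinement_blocks[OF block])
      show "?S \<subseteq> ?B"
      proof
        fix y assume "y \<in> ?S"
        moreover have "2 * radius t \<le> M * radius t" unfolding M_def by (rule mult_right_mono) auto
        ultimately show "y \<in> ?B" unfolding mem_gball mem_Collect_eq by (rule order_trans)
      qed
    qed (use \<delta> in auto)
    also have "\<dots> \<le> pr (wpath (b * t) x) (\<lambda>l. set l \<subseteq> ?B)" by (rule pr_mono) simp
    \<comment> \<open>\<open>b * t\<close> may exceed \<open>n\<close>; the first \<open>n\<close>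
      steps of a confined path are confined.\<close>
    also have "\<dots> \<le> pr (wpath (b * t) x) (\<lambda>l. set (take (Suc n) l) \<subseteq> ?B)"
      by (rule pr_mono) (meson set_take_subset subset_trans)
    also have "\<dots> = pr (wpath n x) (\<lambda>l. set l \<subseteq> ?B)"
      using W.pr_path_take[of n "b * t - n" x "\<lambda>l. set l \<subseteq> ?B"] nt by simp
    also have "\<dots> \<le> pr (wpath n x) (\<lambda>l. real (card (set l)) \<le> B * real n powr \<alpha> * real b powr (- \<alpha>))"
    proof (rule pr_mono)
      fix l assume "set l \<subseteq> ?B"
      then have "real (card (set l)) \<le> real (card ?B)" by (simp add: card_mono finite_gball)
      also have "\<dots> \<le> V * real (M * radius t) powr D" by (rule card_ball) (use radius(1)[OF t(3)] in \<open>simp add: M_def\<close>)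
      also have "\<dots> = V * (real M powr D * real (radius t) powr D)" by (simp add: powr_mult)
      also have "\<dots> \<le> V * (real M powr D * (2 powr D * (2 * (real n / real b) powr \<alpha>)))"
      proof (intro mult_left_mono order_trans[OF radius(5)[OF t(3)]])
        have "real t powr \<alpha> \<le> (2 * (real n / real b)) powr \<alpha>" using t \<alpha>_pos by (intro powr_mono2) auto
        also have "\<dots> \<le> 2 * (real n / real b) powr \<alpha>" unfolding powr_mult using two_powr_\<alpha> by (intro mult_right_mono) auto
        finally show "real t powr \<alpha> \<le> 2 * (real n / real b) powr \<alpha>" .
      qed (use pos in auto)
      also have "\<dots> = B * real n powr \<alpha> * real b powr (- \<alpha>)" by (simp add: B_def powr_divide powr_minus_divide)
      finally show "real (card (set l)) \<le> B * real n powr \<alpha> * real b powr (- \<alpha>)" .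
    qed
    finally show "(\<delta> / 2) ^ b \<le> pr (wpath n x) (\<lambda>l. real (card (set l)) \<le> B * real n powr \<alpha> * real b powr (- \<alpha>))" .
  qed
qed

text \<open>Each block has two halves of length \<open>t\<close>. In the first the walk collects
  order t^\<alpha> sites inside the current ball, with probability at least 3/4 - 1/4; in the second
  it reaches the centre region of the next ball. The balls are disjoint, so the counts add up. In
  contrast to confinement, \<open>K\<close> is fixed before \<open>\<delta>\<close>, since the
  distance to the next centre depends on it.\<close>

lemma large_range:
  "\<exists>B>0. \<exists>\<delta>>0. \<exists>n0. \<forall>x n b. 1 \<le> b \<and> n0 * b \<le> n \<longrightarrow>
    \<delta> ^ b \<le> pr (wpath n x) (\<lambda>l. B * real n powr \<alpha> * real b powr (1 - \<alpha>) \<le> real (card (set l)))"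
proof -
  obtain c0 where c0: "c0 > 0" "\<And>t x. 1 \<le> t \<Longrightarrow>
    pr (wpath t x) (\<lambda>l. real (card (set l)) < c0 * real t powr \<alpha>) \<le> 1 / 4"
    using range_lower_tail[of "1/4"] by auto
  obtain K where K: "K \<ge> 1" "\<And>x t. 1 \<le> t \<Longrightarrow>
    pr (wpath t x) (\<lambda>l. \<exists>z\<in>set l. 2 * (K * radius t) < gdist E x z) \<le> 1 / 4"
    using exit_tail[of "1 / 4"] by auto
  define M where "M = 2 * K + 2"
  \<comment> \<open>\<open>4 * M\<close>: after the first half the walk is within \<open>R\<close>
    of the old centre, and consecutive centres are at distance at most \<open>3 * R\<close>, where
    \<open>R = M * radius t\<close>.\<close>
  obtain \<delta> t0 where \<delta>: "\<delta> > 0" "t0 \<ge> 1" "\<And>t x y. t \<ge> t0 \<Longrightarrow> gdist E x y \<le> 4 * M * radius t \<Longrightarrow>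
    \<delta> \<le> pr (wpath t y) (\<lambda>l. gdist E x (last l) \<le> 2 * radius t)"
    using near_diagonal[of "4 * M"] by auto
  have pos': "0 < c0 / 4" "0 < 1 / 2 * \<delta>" using c0(1) \<delta>(1) by auto
  show ?thesis
  proof (rule exI[of _ "c0 / 4"], rule conjI[OF pos'(1)], rule exI[of _ "1 / 2 * \<delta>"], rule conjI[OF pos'(2)],
      rule exI[of _ "2 * t0"], intro allI impI)
    fix x and n b :: nat assume n: "1 \<le> b \<and> 2 * t0 * b \<le> n"
    define t where "t = n div (2 * b)"
    have t0: "t0 \<le> t" unfolding t_def using n by (subst less_eq_div_iff_mult_less_eq) (auto simp: ac_simps)
    then have t: "1 \<le> t" using \<delta>(2) by simp
    have nt: "b * (t + t) \<le> n"
    proof -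
      have "t * (2 * b) \<le> n" unfolding t_def by (rule div_times_less_eq_dividend)
      then show ?thesis by (simp add: algebra_simps)
    qed
    have "n < (t + 1) * (2 * b)" unfolding t_def using n by (simp add: dividend_less_div_times)
    also have "\<dots> \<le> (2 * t) * (2 * b)" using t by (intro mult_right_mono) auto
    finally have "real n \<le> real ((2 * t) * (2 * b))" by (simp only: of_nat_le_iff less_imp_le)
    then have "real n / real b \<le> 4 * real t" using n by (simp add: field_simps)
    then have "(real n / real b) powr \<alpha> \<le> (4 * real t) powr \<alpha>" using \<alpha>_pos by (intro powr_mono2) auto
    also have "\<dots> \<le> 4 * real t powr \<alpha>" unfolding powr_mult
      using powr_mono[of \<alpha> 1 "4::real"] \<alpha> by (intro mult_right_mono) auto
    finally have nb: "c0 / 4 * (real n / real b) powr \<alpha> \<le> c0 * real t powr \<alpha>" using c0(1) by simp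
    define R where "R = M * radius t"
    have R: "1 \<le> R" "2 * radius t \<le> R" "2 * radius t + 2 * (K * radius t) \<le> R"
      using radius(1)[OF t] by (auto simp: R_def M_def algebra_simps)
    \<comment> \<open>The centres are taken at spacing \<open>3 * R\<close> along a geodesic;
      \<open>3 * R > 2 * R\<close> keeps the balls of radius \<open>R\<close> apart.\<close>
    obtain f where f: "f 0 = x" "\<And>i. i \<le> 3 * R * b \<Longrightarrow> gdist E x (f i) = i" "\<And>i. i < 3 * R * b \<Longrightarrow> E (f i) (f (Suc i))"
      using geodesic[of x "3 * R * b"] by blast
    define z where "z i = f (3 * R * i)" for i
    let ?S = "\<lambda>i. {y. gdist E (z i) y \<le> 2 * radius t}" and ?B = "\<lambda>i. gball E (z i) (real R)"
    have zstep: "gdist E (z i) (z (Suc i)) \<le> 3 * R" if "i < b" for i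
    proof -
      have "gdist E (f k) (f (k + j)) \<le> j" if "k + j \<le> 3 * R * b" for k j
        using that
      proof (induction j)
        case (Suc j)
        have "gdist E (f k) (f (k + Suc j)) \<le> gdist E (f k) (f (k + j)) + gdist E (f (k + j)) (f (Suc (k + j)))"
          by (simp add: gdist_triangle)
        also have "\<dots> \<le> j + 1" using Suc by (intro add_mono gdist_edge f) auto
        finally show ?case by simp
      qed simp
      from this[of "3 * R * i" "3 * R"] show ?thesis
        using mult_le_mono2[of "Suc i" b "3 * R"] that by (simp add: z_def add.commute)
    qed
    have zdist: "gdist E x (z i) = 3 * R * i" if "i \<le> b" for i
      unfolding z_def using that by (intro f) auto
    have disj: "?B i \<inter> ?B j = {}" if "i < j" "j \<le> b" for i j
    proof (rule ccontr)
      assume "?B i \<inter> ?B j \<noteq> {}"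
      then obtain w where w: "gdist E (z i) w \<le> R" "gdist E (z j) w \<le> R" unfolding gball_def by auto
      have "gdist E x (z j) \<le> gdist E x (z i) + (gdist E (z i) w + gdist E w (z j))"
        using gdist_triangle[of x "z j" "z i"] gdist_triangle[of "z i" "z j" w] by linarith
      then have "3 * R * j \<le> 3 * R * i + 2 * R"
        using w that gdist_sym[of w "z j"] by (simp add: zdist)
      moreover have "3 * R * Suc i \<le> 3 * R * j" using that by (intro mult_le_mono2) simp
      ultimately show False using R(1) by simp
    qed
    have block: "1 / 2 * \<delta> \<le> pr (wpath (t + t) y) (\<lambda>l. c0 * real t powr \<alpha> \<le> real (card (set l \<inter> ?B i)) \<and> last l \<in> ?S (Suc i))"
      if i: "i < b" and y: "y \<in> ?S i" for i y
    proof (rule W.pr_path_split_ge[where P' = "\<lambda>_ l. gdist E (z (Suc i)) (last l) \<le> 2 * radius t"])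
      have "1 / 2 \<le> pr (wpath t y) (\<lambda>l. \<not> real (card (set l)) < c0 * real t powr \<alpha>) -
          pr (wpath t y) (\<lambda>l. \<not> \<not> (\<exists>z\<in>set l. 2 * (K * radius t) < gdist E y z))"
        unfolding pr_neg[of _ "\<lambda>l. real (card (set l)) < c0 * real t powr \<alpha>"] not_not
        using c0(2)[OF t, of y] K(2)[OF t, of y] by linarith
      also have "\<dots> \<le> pr (wpath t y) (\<lambda>l. \<not> real (card (set l)) < c0 * real t powr \<alpha> \<and>
          \<not> (\<exists>z\<in>set l. 2 * (K * radius t) < gdist E y z))"
        by (rule pr_conj_ge)
      also have "\<dots> \<le> pr (wpath t y) (\<lambda>l. c0 * real t powr \<alpha> \<le> real (card (set l \<inter> ?B i)) \<and> set l \<subseteq> ?B i)"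
      proof (rule pr_mono)
        fix l assume l: "\<not> real (card (set l)) < c0 * real t powr \<alpha> \<and> \<not> (\<exists>z\<in>set l. 2 * (K * radius t) < gdist E y z)"
        have "w \<in> ?B i" if "w \<in> set l" for w
        proof -
          have "gdist E (z i) w \<le> 2 * radius t + 2 * (K * radius t)"
            using gdist_triangle[of "z i" w y] l y that by fastforce
          then show ?thesis unfolding mem_gball using R(3) by linarith
        qed
        then have "set l \<subseteq> ?B i" by auto
        moreover from this have "set l \<inter> ?B i = set l" by auto
        ultimately show "c0 * real t powr \<alpha> \<le> real (card (set l \<inter> ?B i)) \<and> set l \<subseteq> ?B i" using l by simp
      qed
      finally show "1 / 2 \<le> pr (wpath t y) (\<lambda>l. c0 * real t powr \<alpha> \<le> real (card (set l \<inter> ?B i)) \<and> set l \<subseteq> ?B i)" .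
    next
      fix l assume l: "l \<in> set_pmf (wpath t y)" "c0 * real t powr \<alpha> \<le> real (card (set l \<inter> ?B i)) \<and> set l \<subseteq> ?B i"
      have "last l \<in> ?B i" using l path_support[OF l(1)] by auto
      then have "gdist E (z (Suc i)) (last l) \<le> 3 * R + R"
        using gdist_triangle[of "z (Suc i)" "last l" "z i"] zstep[OF i] gdist_sym[of "z i" "z (Suc i)"]
        unfolding mem_gball by linarith
      then show "\<delta> \<le> pr (wpath t (last l)) (\<lambda>l. gdist E (z (Suc i)) (last l) \<le> 2 * radius t)"
        by (intro \<delta>(3) t0) (simp add: R_def)
      fix l' assume l': "l' \<in> set_pmf (wpath t (last l))" "gdist E (z (Suc i)) (last l') \<le> 2 * radius t"
      have "card (set l \<inter> ?B i) \<le> card (set (l @ tl l') \<inter> ?B i)"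
        unfolding W.set_append_path(1)[OF l(1) l'(1)] by (intro card_mono) auto
      then show "c0 * real t powr \<alpha> \<le> real (card (set (l @ tl l') \<inter> ?B i)) \<and> last (l @ tl l') \<in> ?S (Suc i)"
        using l(2) l'(2) unfolding W.set_append_path(2)[OF l(1) l'(1)] by simp
    qed (use \<delta> in simp)
    have "(1 / 2 * \<delta>) ^ b \<le> pr (wpath (b * (t + t)) x) (\<lambda>l. \<forall>i\<in>{0..<0+b}. c0 * real t powr \<alpha> \<le> real (card (set l \<inter> ?B i)))"
      by (rule W.excursion_blocks[where S = ?S, OF block]) (use \<delta> f(1) in \<open>auto simp: z_def\<close>)
    also have "\<dots> \<le> pr (wpath (b * (t + t)) x) (\<lambda>l. c0 / 4 * real n powr \<alpha> * real b powr (1 - \<alpha>) \<le> real (card (set l)))"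
    proof (rule pr_mono)
      fix l assume l: "\<forall>i\<in>{0..<0+b}. c0 * real t powr \<alpha> \<le> real (card (set l \<inter> ?B i))"
      have "(\<Sum>i<b. card (set l \<inter> ?B i)) = card (\<Union>i<b. set l \<inter> ?B i)"
      proof (rule card_UN_disjoint[symmetric])
        show "\<forall>i\<in>{..<b}. \<forall>j\<in>{..<b}. i \<noteq> j \<longrightarrow> (set l \<inter> ?B i) \<inter> (set l \<inter> ?B j) = {}"
        proof (intro ballI impI)
          fix i j assume "i \<in> {..<b}" "j \<in> {..<b}" "i \<noteq> j"
          then have "?B i \<inter> ?B j = {}" using disj[of i j] disj[of j i] by (cases "i < j") (auto simp: Int_commute)
          then show "(set l \<inter> ?B i) \<inter> (set l \<inter> ?B j) = {}" by blast
        qed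
      qed simp_all
      then have card: "(\<Sum>i<b. real (card (set l \<inter> ?B i))) = real (card (\<Union>i<b. set l \<inter> ?B i))"
        by (simp only: of_nat_sum[symmetric])
      have "c0 / 4 * real n powr \<alpha> * real b powr (1 - \<alpha>) = real b * (c0 / 4 * (real n / real b) powr \<alpha>)"
        using n by (simp add: powr_divide powr_diff)
      also have "\<dots> \<le> real b * (c0 * real t powr \<alpha>)" using nb by (intro mult_left_mono) auto
      also have "\<dots> = (\<Sum>i<b. c0 * real t powr \<alpha>)" by simp
      also have "\<dots> \<le> (\<Sum>i<b. real (card (set l \<inter> ?B i)))" using l by (intro sum_mono) auto
      also have "\<dots> = real (card (\<Union>i<b. set l \<inter> ?B i))" by (rule card)
      also have "\<dots> \<le> real (card (set l))" by (intro of_nat_mono card_mono) auto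
      finally show "c0 / 4 * real n powr \<alpha> * real b powr (1 - \<alpha>) \<le> real (card (set l))" .
    qed
    also have "\<dots> \<le> pr (wpath n x) (\<lambda>l. c0 / 4 * real n powr \<alpha> * real b powr (1 - \<alpha>) \<le> real (card (set l)))"
      by (rule W.pr_path_mono[OF nt]) (auto elim!: order_trans intro: card_mono)
    finally show "(1 / 2 * \<delta>) ^ b \<le> pr (wpath n x) (\<lambda>l. c0 / 4 * real n powr \<alpha> * real b powr (1 - \<alpha>) \<le> real (card (set l)))" .
  qed
qed

end

section \<open>Transient walks: linear growth of the range\<close>

lemma summable_bound_sum:
  assumes "summable f" "\<And>k. 0 \<le> f k"
  shows "(\<Sum>k=1..N. f k) \<le> (suminf f :: real)"
  by (rule sum_le_suminf) (use assms in auto)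

text \<open>Times up to \<open>r\<close> are counted in full. After \<open>r\<close>, half of the
  excess \<open>2 * \<kappa>\<close> of the decay exponent is traded for the factor
  \<open>r powr (- \<kappa>)\<close>, and the other half keeps the series summable.\<close>

lemma (in weighted_graph) occupation_bound:
  assumes \<kappa>: "0 < \<kappa>" and G: "\<And>N. (\<Sum>k=1..N. real k powr (- (1 + \<kappa>))) \<le> G"
    and p: "\<And>n x y. 1 \<le> n \<Longrightarrow> p n x y \<le> A * real n powr (- (1 + 2 * \<kappa>))" and "0 < A"
    and S: "finite S" "card S \<le> N" and "1 \<le> r"
  shows "EV (wpath t x) (\<lambda>l. real (length (filter (\<lambda>y. y \<in> S) l))) \<le>
    real r + 1 + real N * A * real r powr (- \<kappa>) * G"
proof -
  let ?f = "\<lambda>k. real N * A * real r powr (- \<kappa>) * real k powr (- (1 + \<kappa>))"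
  have 1: "pr (wpath k x) (\<lambda>l. last l \<in> S) \<le> of_bool (k \<le> r) + ?f k" for k
  proof (cases "k \<le> r")
    case True
    then show ?thesis using \<open>0 < A\<close> measure_pmf.prob_le_1[of "wpath k x"] by (simp add: add_increasing2)
  next
    case False
    have "pr (wpath k x) (\<lambda>l. last l \<in> S) = (\<Sum>y\<in>S. p k x y)" by (rule pr_last_in[OF S(1)])
    also have "\<dots> \<le> (\<Sum>y\<in>S. A * real k powr (- (1 + 2 * \<kappa>)))" by (rule sum_mono) (use p False \<open>1 \<le> r\<close> in auto)
    also have "\<dots> = real (card S) * (A * (real k powr (- \<kappa>) * real k powr (- (1 + \<kappa>))))"
      by (simp add: algebra_simps flip: powr_add)
    also have "\<dots> \<le> real N * (A * (real r powr (- \<kappa>) * real k powr (- (1 + \<kappa>))))"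
      using S(2) \<open>0 < A\<close> False \<open>1 \<le> r\<close> \<kappa> by (intro mult_mono mult_left_mono mult_right_mono powr_mono2') auto
    finally show ?thesis using False by simp
  qed
  have "EV (wpath t x) (\<lambda>l. real (length (filter (\<lambda>y. y \<in> S) l))) =
      (\<Sum>k\<le>t. pr (wpath k x) (\<lambda>l. last l \<in> S))"
    by (rule W.EV_length_filter)
  also have "\<dots> \<le> (\<Sum>k\<le>t. of_bool (k \<le> r) + ?f k)" by (intro sum_mono 1)
  also have "\<dots> = (\<Sum>k\<le>t. of_bool (k \<le> r)) + (\<Sum>k\<le>t. ?f k)" by (rule sum.distrib)
  also have "(\<Sum>k\<le>t. of_bool (k \<le> r)) \<le> real (card {..r})"
  proof -
    have "(\<Sum>k\<le>t. of_bool (k \<le> r)) = real (card ({..t} \<inter> {k. k \<le> r}))" by (simp add: sum_of_bool_eq)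
    also have "\<dots> \<le> real (card {..r})" by (intro of_nat_mono card_mono) auto
    finally show ?thesis .
  qed
  also have "(\<Sum>k\<le>t. ?f k) = (\<Sum>k=1..t. ?f k)"
    by (rule sum.mono_neutral_right) (auto simp: Suc_le_eq intro: ccontr)
  also have "\<dots> \<le> real N * A * real r powr (- \<kappa>) * G"
    unfolding sum_distrib_left[symmetric] using \<open>0 < A\<close> by (intro mult_left_mono G) auto
  finally show ?thesis by simp
qed

text \<open>A path of length \<open>2 ^ k\<close> is cut into \<open>k\<close> blocks: a fixed
  factor per block is then summable in \<open>k\<close>. Yet a block, of length about
  \<open>2 ^ k / k\<close>, is so long that its expected time in up to \<open>2 * 2 ^ k\<close> old
  sites is small against its length.\<close>

lemma (in weighted_graph) transient_range:
  assumes \<sigma>: "1 < \<sigma>" and A: "0 < A" and p: "\<And>n x y. 1 \<le> n \<Longrightarrow> p n x y \<le> A * real n powr (- \<sigma>)"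
  shows "\<exists>c>0. \<exists>k0. \<forall>k\<ge>k0. \<forall>x. pr (wpath (2 ^ k) x) (\<lambda>l. real (card (set l)) < c * 2 ^ k) \<le> (19 / 20) ^ k"
proof -
  define \<kappa> where "\<kappa> = (\<sigma> - 1) / 2"
  have \<kappa>: "0 < \<kappa>" "\<sigma> = 1 + 2 * \<kappa>" using \<sigma> by (simp_all add: \<kappa>_def field_simps)
  define G where "G = suminf (\<lambda>k. real k powr (- (1 + \<kappa>)))"
  have G: "(\<Sum>k=1..N. real k powr (- (1 + \<kappa>))) \<le> G" for N
    unfolding G_def by (rule summable_bound_sum) (use \<kappa> in \<open>simp_all add: summable_real_powr_iff\<close>)
  have G0: "0 \<le> G" using G[of 0] by simp
  define B where "B = 1 + 2 * (A * suminf (\<lambda>k. real k powr (- \<sigma>)))"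
  have sum\<sigma>: "(\<Sum>k=1..N. A * real k powr (- \<sigma>)) \<le> A * suminf (\<lambda>k. real k powr (- \<sigma>))" for N
    unfolding sum_distrib_left[symmetric] using A
    by (intro mult_left_mono summable_bound_sum) (use \<sigma> in \<open>simp_all add: summable_real_powr_iff\<close>)
  have B: "1 \<le> B" using sum\<sigma>[of 0] by (simp add: B_def)
  have J: "EV (wpath t x) (\<lambda>l. real (self_intersections l)) \<le> (real t + 1) * B" for t x
  proof -
    have "EV (wpath t x) (\<lambda>l. real (self_intersections l)) \<le> (real t + 1) * (1 + 2 * (\<Sum>k=1..t. A * real k powr (-\<sigma>)))"
      by (rule W.EV_self_intersections) (use p in auto)
    also have "\<dots> \<le> (real t + 1) * B" unfolding B_def using sum\<sigma>[of t] by (intro mult_left_mono) auto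
    finally show ?thesis .
  qed
  \<comment> \<open>By Markov's inequality half of the time is spent in \<open>S\<close> with
    probability at most 1/4, and the self-intersections exceed 8 times the bound on their mean with
    probability at most 1/8. Otherwise Cauchy-Schwarz on the visits outside \<open>S\<close> yields
    at least \<open>(t + 1) / (32 * B)\<close> new sites, and the exponential is at most exp (-1),
    hence at most 1/2. The sum is 7/8.\<close>
  have block: "EV (wpath t x) (\<lambda>l. exp (- (32 * B / real t) * real (card (set l - S)))) \<le> 7 / 8"
    if t: "32 \<le> t" and S: "finite S" "card S \<le> N" and N: "real N * A * real (t div 16) powr (- \<kappa>) * G \<le> real t / 32" for t x S N
  proof -
    let ?P = "wpath t x" and ?in = "\<lambda>l. length (filter (\<lambda>y. y \<in> S) l)"
    have "EV ?P (\<lambda>l. real (?in l)) \<le> real (t div 16) + 1 + real N * A * real (t div 16) powr (- \<kappa>) * G"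
      by (rule occupation_bound[OF \<kappa>(1) G _ A S]) (use p \<kappa>(2) t in auto)
    also have "\<dots> \<le> real t / 16 + 1 + real t / 32" using N by (intro add_mono) (auto simp: real_of_nat_div)
    also have "\<dots> \<le> (real t + 1) / 8" using t by simp
    finally have "pr ?P (\<lambda>l. (real t + 1) / 2 \<le> real (?in l)) \<le> (real t + 1) / 8 / ((real t + 1) / 2)"
      by (intro order_trans[OF markov_ineq[where c = "(real t + 1) / 2" and f = "\<lambda>l. real (?in l)"]] divide_right_mono) auto
    also have "\<dots> = 1 / 4" by (simp add: divide_simps)
    finally have in_S: "pr ?P (\<lambda>l. (real t + 1) / 2 \<le> real (?in l)) \<le> 1 / 4" .
    have "pr ?P (\<lambda>l. 8 * ((real t + 1) * B) \<le> real (self_intersections l)) \<le> (real t + 1) * B / (8 * ((real t + 1) * B))"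
      using B by (intro order_trans[OF markov_ineq[where c = "8 * ((real t + 1) * B)" and f = "\<lambda>l. real (self_intersections l)"]] divide_right_mono J) auto
    also have "\<dots> = 1 / 8" using B by (simp add: divide_simps)
    finally have self: "pr ?P (\<lambda>l. 8 * ((real t + 1) * B) \<le> real (self_intersections l)) \<le> 1 / 8" .
    let ?bad = "\<lambda>l. (real t + 1) / 2 \<le> real (?in l) \<or> 8 * ((real t + 1) * B) \<le> real (self_intersections l)"
    have "EV ?P (\<lambda>l. exp (- (32 * B / real t) * real (card (set l - S)))) \<le> EV ?P (\<lambda>l. of_bool (?bad l) + 1 / 2)"
    proof (intro EV_mono W.finite_path)
      fix l assume l: "l \<in> set_pmf ?P"
      show "exp (- (32 * B / real t) * real (card (set l - S))) \<le> of_bool (?bad l) + 1 / 2"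
      proof (cases "?bad l")
        case True
        have "- (32 * B / real t) * real (card (set l - S)) \<le> 0" using B by simp
        then have "exp (- (32 * B / real t) * real (card (set l - S))) \<le> 1" by (simp only: exp_le_one_iff)
        moreover have "of_bool (?bad l) = (1 :: real)" using True by (simp only: of_bool_eq)
        ultimately show ?thesis by linarith
      next
        case False
        have "length (filter (\<lambda>y. y \<in> S) l) + length (filter (\<lambda>y. y \<notin> S) l) = t + 1"
          using path_support[OF l] sum_length_filter_compl[of "\<lambda>y. y \<in> S" l] by simp
        then have "real (length (filter (\<lambda>y. y \<in> S) l)) + real (length (filter (\<lambda>y. y \<notin> S) l)) = real t + 1"
          by (metis of_nat_1 of_nat_add)
        moreover have "real (length (filter (\<lambda>y. y \<in> S) l)) < (real t + 1) / 2" using False by (simp only: de_Morgan_disj not_le)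
        ultimately have out: "(real t + 1) / 2 \<le> real (length (filter (\<lambda>y. y \<notin> S) l))" by argo
        have "((real t + 1) / 2)\<^sup>2 \<le> (real (length (filter (\<lambda>y. y \<notin> S) l)))\<^sup>2"
          by (rule power_mono[OF out]) simp
        also have "\<dots> \<le> real (card {v \<in> set l. v \<notin> S}) * real (self_intersections l)"
          by (rule length_filter_squared_le)
        also have "\<dots> \<le> real (card (set l - S)) * (8 * ((real t + 1) * B))"
          using False unfolding set_diff_eq by (intro mult_left_mono) auto
        finally have "(real t + 1) * (real t + 1) \<le> (real t + 1) * (32 * B * real (card (set l - S)))"
          by (simp add: power2_eq_square field_simps)
        then have "real t + 1 \<le> 32 * B * real (card (set l - S))" by (rule mult_left_le_imp_le) simp
        then have "1 \<le> 32 * B / real t * real (card (set l - S))" using t by (simp add: field_simps)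
        then have "exp (- (32 * B / real t) * real (card (set l - S))) \<le> exp (- 1)" by simp
        also have "\<dots> \<le> 1 / 2" using exp_ge_add_one_self[of "1::real"] by (simp add: exp_minus field_simps)
        finally show ?thesis by simp
      qed
    qed
    also have "\<dots> = pr ?P ?bad + 1 / 2" unfolding pr_EV by (simp add: EV_add)
    also have "\<dots> \<le> (1 / 4 + 1 / 8) + 1 / 2"
      by (intro add_right_mono order_trans[OF pr_disj] add_mono in_S self)
    finally show ?thesis by simp
  qed
  \<comment> \<open>The occupation condition of \<open>block\<close> for \<open>2 * 2 ^ k\<close>
    old sites, rewritten with \<open>t div 16 \<ge> 2 ^ k / (64 * k)\<close>.\<close>
  have "\<forall>\<^sub>F k in sequentially. 128 * real k * A * G + 1 \<le> (2 ^ k / (64 * real k)) powr \<kappa>"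
    using \<kappa>(1) by real_asymp
  moreover have "\<forall>\<^sub>F k in sequentially. 64 * real k \<le> 2 ^ k" by real_asymp
  ultimately have "\<forall>\<^sub>F k in sequentially. 1 \<le> k \<and> 64 * real k \<le> 2 ^ k \<and>
      128 * real k * A * G + 1 \<le> (2 ^ k / (64 * real k)) powr \<kappa>"
    using eventually_ge_at_top[of 1] by eventually_elim simp
  then obtain k0 where k0: "\<And>k. k0 \<le> k \<Longrightarrow> 1 \<le> k" "\<And>k. k0 \<le> k \<Longrightarrow> 64 * real k \<le> 2 ^ k"
    "\<And>k. k0 \<le> k \<Longrightarrow> 128 * real k * A * G + 1 \<le> (2 ^ k / (64 * real k)) powr \<kappa>"
    unfolding eventually_sequentially by blast
  \<comment> \<open>Since \<open>2 ^ k \<le> 2 * t * k\<close>, a range below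
    \<open>c * 2 ^ k\<close> times \<open>32 * B / t\<close> is at most \<open>k / 50\<close>, and
    7/8 times exp (1/50) is still below 19/20.\<close>
  define c where "c = 1 / (50 * 64 * B)"
  have c: "0 < c" using B by (simp add: c_def)
  show ?thesis
  proof (rule exI[of _ c], rule conjI[OF c], rule exI[of _ k0], intro allI impI)
    fix k x assume k: "k0 \<le> k"
    note k1 = k0(1)[OF k] and k2 = k0(2)[OF k] and k3 = k0(3)[OF k]
    define t where "t = 2 ^ k div k"
    have t64: "64 \<le> t"
    proof -
      have "real (64 * k) \<le> real (2 ^ k)" using k2 by simp
      then have "64 * k \<le> 2 ^ k" by (simp only: of_nat_le_iff)
      then show ?thesis unfolding t_def using k1 by (subst less_eq_div_iff_mult_less_eq) auto
    qed
    have kt: "k * t \<le> 2 ^ k" by (simp add: t_def)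
    have "2 ^ k < (t + 1) * k" unfolding t_def using k1 by (simp add: dividend_less_div_times)
    also have "\<dots> \<le> (2 * t) * k" using t64 by (intro mult_right_mono) auto
    finally have "real (2 ^ k) \<le> real (2 * t * k)" by (simp only: of_nat_le_iff less_imp_le)
    then have kt2: "2 ^ k \<le> 2 * real t * real k" by simp
    have t16: "2 ^ k / (64 * real k) \<le> real (t div 16)"
    proof -
      have "t < (t div 16 + 1) * 16" by simp
      then have "t \<le> 32 * (t div 16)" using t64 by linarith
      then have "real t \<le> 32 * real (t div 16)" by (metis of_nat_le_iff of_nat_mult of_nat_numeral)
      moreover have "2 ^ k / (64 * real k) \<le> real t / 32" using kt2 k1 by (simp add: field_simps)
      ultimately show ?thesis by linarith
    qed
    have N: "real (2 * 2 ^ k) * A * real (t div 16) powr (- \<kappa>) * G \<le> real t / 32"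
    proof -
      have "128 * real k * A * G \<le> real (t div 16) powr \<kappa>"
        using k3 powr_mono2[OF _ _ t16, of \<kappa>] \<kappa>(1) by simp
      then have "128 * real k * A * G * real (t div 16) powr (- \<kappa>) \<le> real (t div 16) powr \<kappa> * real (t div 16) powr (- \<kappa>)"
        by (rule mult_right_mono) simp
      also have "\<dots> = 1" using t64 by (simp flip: powr_add)
      finally have 1: "64 * real k * (2 * A * G * real (t div 16) powr (- \<kappa>)) \<le> 1" by (simp add: ac_simps)
      have "real (2 * 2 ^ k) * A * real (t div 16) powr (- \<kappa>) * G = 2 ^ k * (2 * A * G * real (t div 16) powr (- \<kappa>))"
        by simp
      also have "\<dots> \<le> (2 * real t * real k) * (2 * A * G * real (t div 16) powr (- \<kappa>))"
        using kt2 A G0 by (intro mult_right_mono) auto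
      also have "\<dots> = real t / 32 * (64 * real k * (2 * A * G * real (t div 16) powr (- \<kappa>)))" by simp
      also have "\<dots> \<le> real t / 32 * 1" by (rule mult_left_mono[OF 1]) simp
      finally show ?thesis by simp
    qed
    let ?\<theta> = "32 * B / real t"
    have "EV (wpath (k * t) x) (\<lambda>l. exp (- ?\<theta> * real (card (set l)))) \<le> (7 / 8) ^ k"
    proof (rule W.new_sites_blocks)
      show "k * t + 1 \<le> 2 * 2 ^ k" using kt one_le_power[of "2::nat" k] by linarith
      show "0 \<le> ?\<theta>" using B by simp
      show "EV (wpath t x) (\<lambda>l. exp (- ?\<theta> * real (card (set l - S)))) \<le> 7 / 8"
        if "finite S" "card S \<le> 2 * 2 ^ k" for x S
        by (rule block[OF _ that N]) (use t64 in simp)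
    qed
    moreover have "pr (wpath (k * t) x) (\<lambda>l. real (card (set l)) < c * 2 ^ k) \<le>
        EV (wpath (k * t) x) (\<lambda>l. exp (- ?\<theta> * real (card (set l)))) / exp (- real k / 50)"
    proof (rule markov_ineq)
      fix l :: "'v list" assume "real (card (set l)) < c * 2 ^ k"
      then have "?\<theta> * real (card (set l)) \<le> ?\<theta> * (c * (2 * real t * real k))"
        using kt2 c B by (intro mult_left_mono) (auto intro: order_trans[OF less_imp_le])
      also have "\<dots> = real k / 50" using B t64 by (simp add: c_def)
      finally show "exp (- real k / 50) \<le> exp (- ?\<theta> * real (card (set l)))" by simp
    qed auto
    moreover have "EV (wpath (k * t) x) (\<lambda>l. exp (- ?\<theta> * real (card (set l)))) / exp (- real k / 50) \<le>
        (7 / 8) ^ k / exp (- real k / 50)"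
      by (rule divide_right_mono[OF calculation(1)]) simp
    moreover have "(7 / 8) ^ k / exp (- real k / 50) \<le> (19 / 20) ^ k"
    proof -
      have "7 / 8 \<le> 19 / 20 * exp (- (1 / 50) :: real)" using exp_ge_add_one_self[of "- (1 / 50) :: real"] by linarith
      then have "(7 / 8) ^ k \<le> (19 / 20 * exp (- (1 / 50) :: real)) ^ k" by (rule power_mono) simp
      also have "\<dots> = (19 / 20) ^ k * exp (real k * - (1 / 50))"
        unfolding power_mult_distrib exp_of_nat_mult ..
      also have "real k * - (1 / 50) = - real k / 50" by simp
      finally show ?thesis by (subst pos_divide_le_eq) simp_all
    qed
    moreover have "pr (wpath (2 ^ k) x) (\<lambda>l. real (card (set l)) < c * 2 ^ k) \<le>
      pr (wpath (k * t) x) (\<lambda>l. real (card (set l)) < c * 2 ^ k)"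
    proof -
      have "pr (wpath (k * t) x) (\<lambda>l. c * 2 ^ k \<le> real (card (set l))) \<le>
          pr (wpath (2 ^ k) x) (\<lambda>l. c * 2 ^ k \<le> real (card (set l)))"
        by (rule W.pr_path_mono[OF kt]) (auto elim!: order_trans intro: card_mono)
      then show ?thesis
        using pr_neg[of "wpath (2 ^ k) x" "\<lambda>l. c * 2 ^ k \<le> real (card (set l))"]
          pr_neg[of "wpath (k * t) x" "\<lambda>l. c * 2 ^ k \<le> real (card (set l))"] by (simp add: not_le)
    qed
    ultimately show "pr (wpath (2 ^ k) x) (\<lambda>l. real (card (set l)) < c * 2 ^ k) \<le> (19 / 20) ^ k" by linarith
  qed
qed

section \<open>Almost sure statements\<close>

context finite_kernel
begin

text \<open>Both end states, at the times \<open>N k\<close> and \<open>N (Suc k)\<close>, belong to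
  the segment, so consecutive segments share one state as in \<open>path_split\<close>.\<close>

definition segment :: "(nat \<Rightarrow> nat) \<Rightarrow> nat \<Rightarrow> 'b list \<Rightarrow> 'b list" where
  "segment N k l = take (Suc (N (Suc k) - N k)) (drop (N k) l)"

text \<open>Whatever the past, segment \<open>k\<close> fails with probability at most
  \<open>1 - a k \<le> exp (- a k)\<close>, because the lower bound holds from every starting
  state.\<close>

lemma pr_no_success:
  assumes "mono N" "\<And>k x. a k \<le> pr (mpath K (N (Suc k) - N k) x) (Q k)" "\<And>k. 0 \<le> a k"
  shows "pr (mpath K (N (j + m)) x) (\<lambda>l. \<forall>k\<in>{j..<j+m}. \<not> Q k (segment N k l)) \<le> exp (- (\<Sum>k=j..<j+m. a k))"
proof (induction m)
  case (Suc m)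
  let ?n = "N (Suc (j + m)) - N (j + m)"
  have n: "N (j + Suc m) = N (j + m) + ?n" using monoD[OF assms(1), of "j + m" "Suc (j + m)"] by simp
  have "pr (mpath K (N (j + m) + ?n) x) (\<lambda>l. \<forall>k\<in>{j..<j+Suc m}. \<not> Q k (segment N k l)) \<le>
      exp (- (\<Sum>k=j..<j+m. a k)) * exp (- a (j + m))"
  proof (rule pr_path_split_le[OF Suc.IH, where P' = "\<lambda>_ l. \<not> Q (j + m) l"])
    fix l
    have "pr (mpath K ?n (last l)) (\<lambda>l. \<not> Q (j + m) l) \<le> 1 - a (j + m)"
      using assms(2)[of "j + m" "last l"] by (simp add: pr_neg)
    also have "\<dots> \<le> exp (- a (j + m))" using exp_ge_add_one_self[of "- a (j + m)"] by simp
    finally show "pr (mpath K ?n (last l)) (\<lambda>l. \<not> Q (j + m) l) \<le> exp (- a (j + m))" .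
    fix l' assume l: "l \<in> set_pmf (mpath K (N (j + m)) x)" "l' \<in> set_pmf (mpath K ?n (last l))"
      and Q: "\<forall>k\<in>{j..<j+Suc m}. \<not> Q k (segment N k (l @ tl l'))"
    have len: "length l = Suc (N (j + m))" "length l' = Suc ?n" "l \<noteq> []" "l' \<noteq> []" "hd l' = last l"
      using path_support[OF l(1)] path_support[OF l(2)] by auto
    have 1: "segment N k (l @ tl l') = segment N k l" if "k < j + m" for k
    proof -
      have "N (Suc k) \<le> N (j + m)" "N k \<le> N (Suc k)" using that monoD[OF assms(1)] by auto
      then show ?thesis using len by (simp add: segment_def)
    qed
    have 2: "segment N (j + m) (l @ tl l') = l'"
    proof -
      have "drop (N (j + m)) (butlast l @ [last l]) = [last l]"
        using len by (simp del: append_butlast_last_id)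
      then have "drop (N (j + m)) l = [last l]" using len by simp
      then have "drop (N (j + m)) (l @ tl l') = last l # tl l'" using len by simp
      also have "\<dots> = l'" using len by (metis list.collapse)
      finally show ?thesis using len by (simp add: segment_def)
    qed
    show "(\<forall>k\<in>{j..<j+m}. \<not> Q k (segment N k l)) \<and> \<not> Q (j + m) l'"
    proof (intro conjI ballI)
      fix k assume k: "k \<in> {j..<j+m}"
      with Q have "\<not> Q k (segment N k (l @ tl l'))" by simp
      then show "\<not> Q k (segment N k l)" using 1[of k] k by simp
    next
      have "\<not> Q (j + m) (segment N (j + m) (l @ tl l'))" using Q by simp
      then show "\<not> Q (j + m) l'" unfolding 2 .
    qed
  qed simp
  then show ?case unfolding n by (simp add: exp_diff exp_minus field_simps)
qed simp

lemma segment_coordinates: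
  assumes "mono N" "k < m"
  shows "segment N k (map \<omega> [0..<Suc (N m)]) = map \<omega> [N k..<Suc (N (Suc k))]"
proof -
  have "N (Suc k) \<le> N m" "N k \<le> N (Suc k)" using assms monoD by (metis Suc_leI, metis le_Suc_eq order_refl)
  then show ?thesis unfolding segment_def drop_map take_map
    by (simp add: drop_upt take_upt del: upt_Suc)
qed

text \<open>Failure of all segments from \<open>j\<close> on lies in every \<open>A m\<close>, whose
  probability is at most the exponential of minus a partial sum of the divergent series.\<close>

lemma AE_frequently:
  assumes "countable (UNIV :: 's set)" and N: "mono N" "\<And>k x. a k \<le> pr (mpath K (N (Suc k) - N k) x) (Q k)"
    "\<And>k. 0 \<le> a k" "\<not> summable a"
  shows "AE \<omega> in chain_law K x. \<exists>\<^sub>F k in sequentially. Q k (map \<omega> [N k..<Suc (N (Suc k))])"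
proof -
  interpret prob_space "chain_law K x" by (rule prob_space_chain_law)
  have "AE \<omega> in chain_law K x. \<exists>k\<ge>j. Q k (map \<omega> [N k..<Suc (N (Suc k))])" for j
  proof -
    define A where "A m = {\<omega>. \<forall>k\<in>{j..<j+m}. \<not> Q k (segment N k (map \<omega> [0..<Suc (N (j + m))]))}" for m
    have A[measurable]: "A m \<in> sets (chain_law K x)" for m
      unfolding A_def by (rule measure_chain_law_path(1)[OF assms(1)])
    have pA: "prob (A m) \<le> exp (- (\<Sum>k=j..<j+m. a k))" for m
    proof -
      have "prob (A m) = pr (mpath K (N (j + m)) x) (\<lambda>l. \<forall>k\<in>{j..<j+m}. \<not> Q k (segment N k l))"
        unfolding A_def by (rule measure_chain_law_path(2)[OF assms(1)])
      then show ?thesis by (simp only: pr_no_success[OF N(1-3)])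
    qed
    \<comment> \<open>If this were positive, minus its logarithm would bound all partial sums of
      \<open>a\<close>.\<close>
    have "prob (\<Inter>m. A m) = 0"
    proof (rule ccontr)
      assume "prob (\<Inter>m. A m) \<noteq> 0"
      then have q: "0 < prob (\<Inter>m. A m)" by (simp add: zero_less_measure_iff)
      have "(\<Sum>k<m. a (k + j)) \<le> - ln (prob (\<Inter>m. A m))" for m
      proof -
        have "prob (\<Inter>m. A m) \<le> prob (A m)" by (rule finite_measure_mono) auto
        also note pA[of m]
        finally have "ln (prob (\<Inter>m. A m)) \<le> - (\<Sum>k=j..<j+m. a k)" using q by (simp add: ln_le_cancel_iff[symmetric] del: ln_le_cancel_iff)
        moreover have "(\<Sum>k=j..<j+m. a k) = (\<Sum>k<m. a (k + j))"
          by (rule sum.reindex_bij_witness[of _ "\<lambda>k. k + j" "\<lambda>k. k - j"]) auto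
        ultimately show ?thesis by simp
      qed
      then have "summable (\<lambda>k. a (k + j))" by (intro summableI_nonneg_bounded N(3))
      then show False using N(4) summable_iff_shift[of a j] by simp
    qed
    then have "AE \<omega> in chain_law K x. \<omega> \<notin> (\<Inter>m. A m)"
      by (intro AE_not_in) (auto simp: null_sets_def emeasure_eq_measure)
    then show ?thesis
    proof eventually_elim
      case (elim \<omega>)
      then obtain m where "\<omega> \<notin> A m" by blast
      then obtain k where "k \<in> {j..<j+m}" "Q k (segment N k (map \<omega> [0..<Suc (N (j + m))]))" unfolding A_def by blast
      then show ?case using segment_coordinates[OF N(1), of k "j + m" \<omega>] by (intro exI[of _ k]) (simp del: upt_Suc)
    qed
  qed
  then have "AE \<omega> in chain_law K x. \<forall>j. \<exists>k\<ge>j. Q k (map \<omega> [N k..<Suc (N (Suc k))])"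
    unfolding AE_all_countable by blast
  then show ?thesis by (simp only: frequently_sequentially)
qed

end

text \<open>With values in \<open>bit\<close>, a configuration is determined by its support, a
  finite set of vertices.\<close>

lemma countable_lamp_states:
  assumes "countable (UNIV :: 'v set)"
  shows "countable (UNIV :: 'v lamp_state set)"
proof -
  have "inj (Poly_Mapping.keys :: ('v \<Rightarrow>\<^sub>0 bit) \<Rightarrow> 'v set)"
  proof (rule injI, rule poly_mapping_eqI)
    fix f g :: "'v \<Rightarrow>\<^sub>0 bit" and v
    assume "Poly_Mapping.keys f = Poly_Mapping.keys g"
    then have "poly_mapping.lookup f v = 0 \<longleftrightarrow> poly_mapping.lookup g v = 0" by (metis in_keys_iff)
    then show "poly_mapping.lookup f v = poly_mapping.lookup g v"
      by (cases "poly_mapping.lookup f v"; cases "poly_mapping.lookup g v") auto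
  qed
  moreover have "countable (range (Poly_Mapping.keys :: ('v \<Rightarrow>\<^sub>0 bit) \<Rightarrow> 'v set))"
  proof (rule countable_subset)
    show "range (Poly_Mapping.keys :: ('v \<Rightarrow>\<^sub>0 bit) \<Rightarrow> 'v set) \<subseteq> {A. finite A \<and> A \<subseteq> UNIV}" by auto
    show "countable {A :: 'v set. finite A \<and> A \<subseteq> UNIV}" by (rule countable_Collect_finite_subset[OF assms])
  qed
  ultimately have "countable (UNIV :: ('v \<Rightarrow>\<^sub>0 bit) set)" by (rule countable_image_inj_on[rotated])
  then have "countable ((UNIV :: ('v \<Rightarrow>\<^sub>0 bit) set) \<times> (UNIV :: 'v set))" using assms by (rule countable_SIGMA)
  then show ?thesis by simp
qed

section \<open>The range process and dyadic times\<close>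

definition range_size :: "(nat \<Rightarrow> 'v lamp_state) \<Rightarrow> nat \<Rightarrow> real" where
  "range_size \<omega> n = real (card (set (map snd (map \<omega> [0..<Suc n]))))"

lemma range_size_segment:
  assumes "m \<le> n"
  shows "real (card (set (map snd (map \<omega> [m..<Suc n])))) \<le> range_size \<omega> n"
    "range_size \<omega> n \<le> range_size \<omega> m + real (card (set (map snd (map \<omega> [m..<Suc n]))))"
proof -
  have "set [0..<Suc n] = set [0..<Suc m] \<union> set [m..<Suc n]" using assms by auto
  then have *: "set (map snd (map \<omega> [0..<Suc n])) = set (map snd (map \<omega> [0..<Suc m])) \<union> set (map snd (map \<omega> [m..<Suc n]))"
    by (simp only: set_map image_Un)
  show "real (card (set (map snd (map \<omega> [m..<Suc n])))) \<le> range_size \<omega> n"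
    unfolding range_size_def * by (intro of_nat_mono card_mono) auto
  have "card (set (map snd (map \<omega> [0..<Suc n]))) \<le>
      card (set (map snd (map \<omega> [0..<Suc m]))) + card (set (map snd (map \<omega> [m..<Suc n])))"
    unfolding * by (rule card_Un_le)
  then show "range_size \<omega> n \<le> range_size \<omega> m + real (card (set (map snd (map \<omega> [m..<Suc n]))))"
    unfolding range_size_def by (simp only: of_nat_add[symmetric] of_nat_le_iff)
qed

lemma range_size_mono: "m \<le> n \<Longrightarrow> range_size \<omega> m \<le> range_size \<omega> n"
  unfolding range_size_def by (intro of_nat_mono card_mono) (auto simp del: upt_Suc)

lemma range_size_le: "range_size \<omega> n \<le> real n + 1"
proof -
  have "card (set (map snd (map \<omega> [0..<Suc n]))) \<le> length (map snd (map \<omega> [0..<Suc n]))" by (rule card_length)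
  then show ?thesis unfolding range_size_def by simp
qed

text \<open>The range is monotone in time, so within a dyadic interval only the rates
  \<open>f\<close> and \<open>g\<close> need comparing: with the left endpoint for lower bounds,
  with the right one in the companion for upper bounds.\<close>

lemma eventually_dyadic_lower:
  assumes "\<forall>\<^sub>F k in sequentially. g k \<le> range_size \<omega> (2 ^ k)"
    "\<forall>\<^sub>F k in sequentially. \<forall>n. 2 ^ k \<le> n \<and> n < 2 ^ Suc k \<longrightarrow> f n \<le> g k"
  shows "\<forall>\<^sub>F n in sequentially. f n \<le> range_size \<omega> n"
proof -
  from eventually_conj[OF assms] obtain k0 where k0: "\<And>k. k0 \<le> k \<Longrightarrow> g k \<le> range_size \<omega> (2 ^ k)"
    "\<And>k n. k0 \<le> k \<Longrightarrow> 2 ^ k \<le> n \<Longrightarrow> n < 2 ^ Suc k \<Longrightarrow> f n \<le> g k"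
    unfolding eventually_sequentially by blast
  have "f n \<le> range_size \<omega> n" if n: "2 ^ k0 \<le> n" for n
  proof -
    have "1 \<le> n" using n one_le_power[of "2::nat" k0] by linarith
    then obtain k where k: "2 ^ k \<le> n" "n < 2 ^ Suc k" using ex_power_ivl1[of 2 n] by auto
    have "(2::nat) ^ k0 < 2 ^ Suc k" using n k(2) by linarith
    then have "k0 \<le> k" by (simp only: power_strict_increasing_iff one_less_numeral_iff semiring_norm less_Suc_eq_le)
    then show ?thesis using k0(2)[OF _ k] k0(1)[of k] range_size_mono[OF k(1), of \<omega>] by linarith
  qed
  then show ?thesis unfolding eventually_sequentially by blast
qed

lemma eventually_dyadic_upper:
  assumes "\<forall>\<^sub>F k in sequentially. range_size \<omega> (2 ^ k) \<le> g k"
    "\<forall>\<^sub>F k in sequentially. \<forall>n. 2 ^ k \<le> n \<and> n < 2 ^ Suc k \<longrightarrow> g (Suc k) \<le> f n"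
  shows "\<forall>\<^sub>F n in sequentially. range_size \<omega> n \<le> f n"
proof -
  from eventually_conj[OF assms] obtain k0 where k0: "\<And>k. k0 \<le> k \<Longrightarrow> range_size \<omega> (2 ^ k) \<le> g k"
    "\<And>k n. k0 \<le> k \<Longrightarrow> 2 ^ k \<le> n \<Longrightarrow> n < 2 ^ Suc k \<Longrightarrow> g (Suc k) \<le> f n"
    unfolding eventually_sequentially by blast
  have "range_size \<omega> n \<le> f n" if n: "2 ^ k0 \<le> n" for n
  proof -
    have "1 \<le> n" using n one_le_power[of "2::nat" k0] by linarith
    then obtain k where k: "2 ^ k \<le> n" "n < 2 ^ Suc k" using ex_power_ivl1[of 2 n] by auto
    have "(2::nat) ^ k0 < 2 ^ Suc k" using n k(2) by linarith
    then have "k0 \<le> k" by (simp only: power_strict_increasing_iff one_less_numeral_iff semiring_norm less_Suc_eq_le)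
    moreover from this have "k0 \<le> Suc k" by simp
    ultimately show ?thesis using k0(2)[OF _ k] k0(1)[of "Suc k"] range_size_mono[OF less_imp_le[OF k(2)], of \<omega>] by linarith
  qed
  then show ?thesis unfolding eventually_sequentially by blast
qed

section \<open>Distance and range, almost surely\<close>

context weighted_graph
begin

abbreviation wreath_dist :: "(nat \<Rightarrow> 'v lamp_state) \<Rightarrow> nat \<Rightarrow> real" where
  "wreath_dist \<omega> n \<equiv> real (gdist (wreath_adj E) (\<omega> 0) (\<omega> n))"

abbreviation lamplighter_law :: "'v lamp_state \<Rightarrow> (nat \<Rightarrow> 'v lamp_state) measure" where
  "lamplighter_law s \<equiv> chain_law (lamplighter_kernel \<mu>) s"

lemma AE_range_borel_cantelli:
  assumes "summable (\<lambda>k. pr (wpath (N k) (snd s)) (Q k))"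
  shows "AE \<omega> in lamplighter_law s. \<forall>\<^sub>F k in sequentially. \<not> Q k (map snd (map \<omega> [0..<Suc (N k)]))"
  using assms unfolding pr_lamplighter_walk[symmetric]
  by (rule AE_borel_cantelli[OF countable_lamp_states[OF countable_vertices]])

lemma AE_range_frequently:
  assumes "mono N" "\<And>k y. a k \<le> pr (wpath (N (Suc k) - N k) y) (Q k)" "\<And>k. 0 \<le> a k" "\<not> summable a"
  shows "AE \<omega> in lamplighter_law s. \<exists>\<^sub>F k in sequentially. Q k (map snd (map \<omega> [N k..<Suc (N (Suc k))]))"
  by (rule L.AE_frequently[OF countable_lamp_states[OF countable_vertices] assms(1) _ assms(3,4)])
    (simp only: pr_lamplighter_walk assms(2))

lemma AE_dist_range:
  "AE \<omega> in lamplighter_law s. \<forall>n. wreath_dist \<omega> n \<le> 8 * range_size \<omega> n \<and>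
    real (card (lamp_diff (fst s) (fst (\<omega> n)))) \<le> wreath_dist \<omega> n"
proof -
  have "AE \<omega> in lamplighter_law s. wreath_dist \<omega> n \<le> 8 * range_size \<omega> n \<and>
    real (card (lamp_diff (fst s) (fst (\<omega> n)))) \<le> wreath_dist \<omega> n" for n
  proof -
    have "AE \<omega> in lamplighter_law s. (\<lambda>l. gdist (wreath_adj E) (hd l) (last l) \<le> 8 * card (set (map snd l)) \<and>
        card (lamp_diff (fst s) (fst (last l))) \<le> gdist (wreath_adj E) (hd l) (last l)) (map \<omega> [0..<Suc n])"
    proof (rule AE_path[OF countable_lamp_states[OF countable_vertices]])
      fix l assume l: "l \<in> set_pmf (lpath n s)"
      then show "gdist (wreath_adj E) (hd l) (last l) \<le> 8 * card (set (map snd l)) \<and>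
        card (lamp_diff (fst s) (fst (last l))) \<le> gdist (wreath_adj E) (hd l) (last l)"
        using lamplighter_gdist[OF l] path_support[OF l] by simp
    qed
    then show ?thesis
    proof eventually_elim
      case (elim \<omega>)
      have "hd (map \<omega> [0..<Suc n]) = \<omega> 0" "last (map \<omega> [0..<Suc n]) = \<omega> n"
        by (simp_all add: hd_map last_map del: upt_Suc)
      with elim have "gdist (wreath_adj E) (\<omega> 0) (\<omega> n) \<le> 8 * card (set (map snd (map \<omega> [0..<Suc n])))"
        "card (lamp_diff (fst s) (fst (\<omega> n))) \<le> gdist (wreath_adj E) (\<omega> 0) (\<omega> n)" by simp_all
      then show ?case unfolding range_size_def
        by (metis of_nat_le_iff of_nat_mult of_nat_numeral)
    qed
  qed
  then show ?thesis unfolding AE_all_countable by blast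
qed

text \<open>The threshold \<open>20 * ln (n + 1)\<close> makes the bound \<open>(9/10) ^ R\<^sub>n\<close> of \<open>few_lamps_on\<close> summable.\<close>

lemma AE_lamps:
  "AE \<omega> in lamplighter_law s. \<forall>\<^sub>F n in sequentially.
    20 * ln (real n + 1) + 1 \<le> range_size \<omega> n \<longrightarrow> range_size \<omega> n < 4 * real (card (lamp_diff (fst s) (fst (\<omega> n))))"
proof -
  define m where "m k = nat \<lceil>20 * ln (real k + 2)\<rceil>" for k
  define Q where "Q k l \<longleftrightarrow> 4 * card (lamp_diff (fst s) (fst (last l))) \<le> card (set (map snd l)) \<and> m k \<le> card (set (map snd l))"
    for k and l :: "'v lamp_state list"
  \<comment> \<open>The index is shifted to \<open>Suc k\<close> because \<open>few_lamps_on\<close>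
    requires at least one step; \<open>real k + 2\<close> is
    \<open>real (Suc k) + 1\<close>.\<close>
  have "AE \<omega> in lamplighter_law s. \<forall>\<^sub>F k in sequentially. \<not> Q k (map \<omega> [0..<Suc (Suc k)])"
  proof (rule AE_borel_cantelli[OF countable_lamp_states[OF countable_vertices]])
    show "summable (\<lambda>k. pr (lpath (Suc k) s) (Q k))"
    proof (rule summable_comparison_test)
      show "\<exists>N. \<forall>k\<ge>N. norm (pr (lpath (Suc k) s) (Q k)) \<le> real (k + 2) powr (- 2)"
      proof (intro exI[of _ 0] allI impI)
        fix k
        have "pr (lpath (Suc k) s) (Q k) \<le> (9 / 10) ^ m k"
          unfolding Q_def using few_lamps_on[of "Suc k" "fst s" "snd s" "m k"] by simp
        also have "\<dots> \<le> exp (- (1 / 10)) ^ m k"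
          using exp_ge_add_one_self[of "- (1 / 10) :: real"] by (intro power_mono) auto
        also have "\<dots> = exp (- (real (m k) / 10))" by (simp flip: exp_of_nat_mult)
        also have "\<dots> \<le> exp (- 2 * ln (real k + 2))"
        proof -
          have "20 * ln (real k + 2) \<le> real (m k)" unfolding m_def by linarith
          then show ?thesis by simp
        qed
        also have "\<dots> = real (k + 2) powr (- 2)" by (simp add: powr_def)
        finally show "norm (pr (lpath (Suc k) s) (Q k)) \<le> real (k + 2) powr (- 2)" by simp
      qed
      show "summable (\<lambda>k. real (k + 2) powr (- 2))"
        unfolding summable_iff_shift[of "\<lambda>k. real k powr (- 2)" 2] by (simp add: summable_real_powr_iff)
    qed
  qed
  then show ?thesis
  proof eventually_elim
    case (elim \<omega>)
    have "\<forall>\<^sub>F k in sequentially. 20 * ln (real (Suc k) + 1) + 1 \<le> range_size \<omega> (Suc k) \<longrightarrow>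
        range_size \<omega> (Suc k) < 4 * real (card (lamp_diff (fst s) (fst (\<omega> (Suc k)))))"
      using elim
    proof eventually_elim
      case (elim k)
      show ?case
      proof
        assume "20 * ln (real (Suc k) + 1) + 1 \<le> range_size \<omega> (Suc k)"
        then have "real (m k) \<le> range_size \<omega> (Suc k)" unfolding m_def by (simp add: add.commute) linarith
        then have "m k \<le> card (set (map snd (map \<omega> [0..<Suc (Suc k)])))" unfolding range_size_def by (simp only: of_nat_le_iff)
        moreover have "last (map \<omega> [0..<Suc (Suc k)]) = \<omega> (Suc k)" by simp
        ultimately have "card (set (map snd (map \<omega> [0..<Suc (Suc k)]))) < 4 * card (lamp_diff (fst s) (fst (\<omega> (Suc k))))"
          using elim unfolding Q_def by (metis not_le)
        then show "range_size \<omega> (Suc k) < 4 * real (card (lamp_diff (fst s) (fst (\<omega> (Suc k)))))"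
          unfolding range_size_def by (metis of_nat_less_iff of_nat_mult of_nat_numeral)
      qed
    qed
    then show ?case unfolding eventually_sequentially_Suc[of "\<lambda>n. 20 * ln (real n + 1) + 1 \<le> range_size \<omega> n \<longrightarrow>
        range_size \<omega> n < 4 * real (card (lamp_diff (fst s) (fst (\<omega> n))))"] .
  qed
qed

lemma AE_dist_range_comparable:
  assumes "AE \<omega> in lamplighter_law s. \<forall>\<^sub>F n in sequentially. 20 * ln (real n + 1) + 1 \<le> range_size \<omega> n"
  shows "AE \<omega> in lamplighter_law s. (\<forall>n. wreath_dist \<omega> n \<le> 8 * range_size \<omega> n) \<and>
    (\<forall>\<^sub>F n in sequentially. range_size \<omega> n \<le> 4 * wreath_dist \<omega> n)"
  using assms AE_dist_range[of s] AE_lamps[of s]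
proof eventually_elim
  case (elim \<omega>)
  from elim(1,3) have "\<forall>\<^sub>F n in sequentially. range_size \<omega> n \<le> 4 * wreath_dist \<omega> n"
  proof eventually_elim
    case (elim n)
    then have "range_size \<omega> n < 4 * real (card (lamp_diff (fst s) (fst (\<omega> n))))" by blast
    moreover have "real (card (lamp_diff (fst s) (fst (\<omega> n)))) \<le> wreath_dist \<omega> n" using \<open>\<forall>n. _ \<and> _\<close> by blast
    ultimately show ?case by linarith
  qed
  then show ?case using elim(2) by blast
qed

lemma transient_dist:
  assumes "1 < \<sigma>" "0 < A" "\<And>n x y. 1 \<le> n \<Longrightarrow> p n x y \<le> A * real n powr (- \<sigma>)"
  shows "\<exists>c>0. \<forall>s. AE \<omega> in lamplighter_law s. (\<forall>n. wreath_dist \<omega> n \<le> 8 * (real n + 1)) \<and>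
    (\<forall>\<^sub>F n in sequentially. c * real n \<le> wreath_dist \<omega> n)"
proof -
  obtain c k0 where c: "c > 0" "\<And>k x. k0 \<le> k \<Longrightarrow>
    pr (wpath (2 ^ k) x) (\<lambda>l. real (card (set l)) < c * 2 ^ k) \<le> (19 / 20) ^ k"
    using transient_range[OF assms] by blast
  show ?thesis
  \<comment> \<open>A factor 2 is lost between dyadic times, a factor 4 in passing from range to
    lamps.\<close>
  proof (intro exI[of _ "c / 8"] conjI allI)
    fix s
    have range: "AE \<omega> in lamplighter_law s. \<forall>\<^sub>F n in sequentially. c / 2 * real n \<le> range_size \<omega> n"
    proof -
      have "AE \<omega> in lamplighter_law s. \<forall>\<^sub>F k in sequentially. \<not> (real (card (set (map snd (map \<omega> [0..<Suc (2 ^ k)])))) < c * 2 ^ k)"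
      proof (rule AE_range_borel_cantelli[where Q = "\<lambda>k l. real (card (set l)) < c * 2 ^ k" and N = "\<lambda>k. 2 ^ k"], rule summable_comparison_test)
        show "\<exists>N. \<forall>k\<ge>N. norm (pr (wpath (2 ^ k) (snd s)) (\<lambda>l. real (card (set l)) < c * 2 ^ k)) \<le> (19 / 20) ^ k"
          using c(2) by (intro exI[of _ k0]) simp
      qed (rule summable_geometric, simp)
      then show ?thesis
      proof eventually_elim
        case (elim \<omega>)
        then have "\<forall>\<^sub>F k in sequentially. c * 2 ^ k \<le> range_size \<omega> (2 ^ k)"
          unfolding range_size_def not_less .
        then show ?case
        proof (rule eventually_dyadic_lower, intro always_eventually allI impI)
          fix k n :: nat assume "2 ^ k \<le> n \<and> n < 2 ^ Suc k"
          then have "real n \<le> real (2 ^ Suc k)" by (simp only: of_nat_le_iff less_imp_le)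
          then show "c / 2 * real n \<le> c * 2 ^ k" using c(1) by simp
        qed
      qed
    qed
    have "\<forall>\<^sub>F n in sequentially. 20 * ln (real n + 1) + 1 \<le> c / 2 * real n" using c(1) by real_asymp
    then have "AE \<omega> in lamplighter_law s. \<forall>\<^sub>F n in sequentially. 20 * ln (real n + 1) + 1 \<le> range_size \<omega> n"
    proof -
      assume *: "\<forall>\<^sub>F n in sequentially. 20 * ln (real n + 1) + 1 \<le> c / 2 * real n"
      from range show ?thesis
      proof eventually_elim
        case (elim \<omega>)
        from * elim show ?case by eventually_elim linarith
      qed
    qed
    from AE_dist_range_comparable[OF this] range
    show "AE \<omega> in lamplighter_law s. (\<forall>n. wreath_dist \<omega> n \<le> 8 * (real n + 1)) \<and>
      (\<forall>\<^sub>F n in sequentially. c / 8 * real n \<le> wreath_dist \<omega> n)"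
    proof eventually_elim
      case (elim \<omega>)
      from elim(1)[THEN conjunct2] elim(2) have "\<forall>\<^sub>F n in sequentially. c / 8 * real n \<le> wreath_dist \<omega> n"
        by eventually_elim simp
      moreover have "wreath_dist \<omega> n \<le> 8 * (real n + 1)" for n
      proof -
        have "wreath_dist \<omega> n \<le> 8 * range_size \<omega> n" using elim(1) by blast
        also have "\<dots> \<le> 8 * (real n + 1)" by (intro mult_left_mono range_size_le) simp
        finally show ?thesis .
      qed
      ultimately show ?case by blast
    qed
  qed (use c in simp)
qed

end

section \<open>The scales \<open>2 ^ k\<close> and \<open>2 ^ (k * k)\<close>\<close>

text \<open>At time \<open>2 ^ k\<close> the number of blocks is ln k rounded up, and ln (ln (2^k))
  = ln k + ln (ln 2). The factor 4 generously covers that constant, the rounding and the shift to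
  \<open>Suc k\<close>.\<close>

lemma eventually_loglog_dyadic:
  "\<forall>\<^sub>F k in sequentially. \<forall>n. 2 ^ k \<le> n \<longrightarrow>
    1 \<le> nat \<lceil>ln (real k)\<rceil> \<and> real (nat \<lceil>ln (real k)\<rceil>) \<le> 4 * ln (ln (real n)) \<and>
    real (nat \<lceil>ln (real (Suc k))\<rceil>) \<le> 4 * ln (ln (real n))"
proof -
  have "\<forall>\<^sub>F k in sequentially. 0 < ln (real k)" by real_asymp
  moreover have "\<forall>\<^sub>F k in sequentially. 1 < real k * ln 2" by real_asymp
  moreover have "\<forall>\<^sub>F k in sequentially. ln (real k + 1) + 1 \<le> 4 * ln (real k * ln 2)" by real_asymp
  ultimately show ?thesis using eventually_ge_at_top[of 1]
  proof eventually_elim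
    case (elim k)
    show ?case
    proof (intro allI impI)
      fix n :: nat assume n: "2 ^ k \<le> n"
      have "(2::real) ^ k \<le> real n" using n by (metis of_nat_le_iff of_nat_numeral of_nat_power)
      moreover have "0 < real n" using \<open>(2::real) ^ k \<le> real n\<close> zero_less_power[of "2::real" k] by linarith
      ultimately have "ln ((2::real) ^ k) \<le> ln (real n)" by simp
      then have "real k * ln 2 \<le> ln (real n)" by (simp add: ln_realpow)
      then have "ln (real k * ln 2) \<le> ln (ln (real n))" using elim(2) by simp
      with elim(3) have l: "ln (real (Suc k)) + 1 \<le> 4 * ln (ln (real n))" by (simp add: add.commute)
      have "ln (real k) \<le> ln (real (Suc k))" using elim(4) by simp
      then show "1 \<le> nat \<lceil>ln (real k)\<rceil> \<and> real (nat \<lceil>ln (real k)\<rceil>) \<le> 4 * ln (ln (real n)) \<and>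
        real (nat \<lceil>ln (real (Suc k))\<rceil>) \<le> 4 * ln (ln (real n))"
        using l elim(1) by (intro conjI) linarith+
    qed
  qed
qed

text \<open>With \<open>b \<ge> ln k\<close> the bound \<open>exp (- 2 * b)\<close> is at most
  \<open>k powr (- 2)\<close>; for large \<open>k\<close> this \<open>b\<close> lies in the
  admissible range from 1 to \<open>2 ^ k\<close>.\<close>

lemma summable_exp_log:
  assumes "\<And>k b. 1 \<le> b \<Longrightarrow> b \<le> (2::nat) ^ k \<Longrightarrow> 0 \<le> P k b \<and> P k b \<le> exp (- 2 * real b)"
  shows "summable (\<lambda>k. P k (nat \<lceil>ln (real k)\<rceil>) :: real)"
proof (rule summable_comparison_test_ev)
  show "summable (\<lambda>k. real k powr (- 2))" by (simp add: summable_real_powr_iff)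
  have "\<forall>\<^sub>F k in sequentially. 0 < ln (real k)" by real_asymp
  moreover have "\<forall>\<^sub>F k in sequentially. ln (real k) + 1 \<le> 2 ^ k" by real_asymp
  ultimately show "\<forall>\<^sub>F k in sequentially. norm (P k (nat \<lceil>ln (real k)\<rceil>)) \<le> real k powr (- 2)"
    using eventually_ge_at_top[of 1]
  proof eventually_elim
    case (elim k)
    have "real (nat \<lceil>ln (real k)\<rceil>) \<le> ln (real k) + 1" using elim(1) by linarith
    also have "\<dots> \<le> real (2 ^ k)" using elim(2) by simp
    finally have "real (nat \<lceil>ln (real k)\<rceil>) \<le> real (2 ^ k)" .
    then have b: "1 \<le> nat \<lceil>ln (real k)\<rceil>" "nat \<lceil>ln (real k)\<rceil> \<le> 2 ^ k" using elim(1) by (linarith, simp only: of_nat_le_iff)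
    have "P k (nat \<lceil>ln (real k)\<rceil>) \<le> exp (- 2 * real (nat \<lceil>ln (real k)\<rceil>))" using assms[OF b] by blast
    also have "\<dots> \<le> exp (- 2 * ln (real k))" by simp linarith
    also have "\<dots> = real k powr (- 2)" using elim(3) by (simp add: powr_def)
    finally show ?case using assms[OF b] by simp
  qed
qed

text \<open>On this scale \<open>ln (ln (square_scale k))\<close> is about \<open>2 * ln k\<close>, so that \<open>\<delta> ^ b\<close> with
  \<open>b\<close> of order \<open>\<epsilon> * ln k\<close> is not summable for small \<open>\<epsilon>\<close>, while the ratio of successive terms beats
  every power of \<open>ln k\<close>, so that the earlier part of the walk is negligible.\<close>

definition square_scale :: "nat \<Rightarrow> nat" where "square_scale k = 2 ^ (k * k)"

lemma square_scale:
  "mono square_scale" "square_scale k \<ge> 1" "2 ^ k \<le> square_scale (Suc k) - square_scale k"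
  "square_scale (Suc k) \<le> 2 * (square_scale (Suc k) - square_scale k)" "k \<le> square_scale k"
  "square_scale (Suc k) = square_scale k * 2 ^ (2 * k + 1)"
proof -
  show "mono square_scale" unfolding square_scale_def
    by (intro monoI power_increasing mult_mono) auto
  show 1: "square_scale k \<ge> 1" for k by (simp add: square_scale_def)
  show m: "square_scale (Suc k) = square_scale k * 2 ^ (2 * k + 1)" for k
    unfolding square_scale_def power_add[symmetric] by (rule arg_cong[where f = "\<lambda>e. 2 ^ e"]) simp
  have "2 * square_scale k * 2 ^ k \<le> square_scale k * 2 ^ (2 * k + 1)" for k
    by (simp add: power_increasing)
  then have h: "2 * square_scale k * 2 ^ k \<le> square_scale (Suc k)" for k unfolding m .
  have "2 * square_scale k * 1 \<le> 2 * square_scale k * 2 ^ k" for k by (rule mult_left_mono) auto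
  with h have "2 * square_scale k \<le> square_scale (Suc k)" for k by (metis mult_1_right order_trans)
  from this[of k] show s: "square_scale (Suc k) \<le> 2 * (square_scale (Suc k) - square_scale k)" by simp
  have "1 * (2 * 2 ^ k) \<le> square_scale k * (2 * 2 ^ k)" by (rule mult_le_mono1[OF 1])
  also have "\<dots> \<le> square_scale (Suc k)" using h[of k] by (simp only: ac_simps)
  finally have "2 * 2 ^ k \<le> square_scale (Suc k)" by simp
  with s show "2 ^ k \<le> square_scale (Suc k) - square_scale k" by linarith
  have "k \<le> 2 ^ k" by (simp add: less_imp_le)
  also have "\<dots> \<le> 2 ^ (k * k)" by (rule power_increasing) auto
  finally show "k \<le> square_scale k" by (simp add: square_scale_def)
qed

lemma ln_square_scale: "ln (real (square_scale k)) = real (k * k) * ln 2"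
  by (simp add: square_scale_def ln_realpow)

lemma loglog_square_scale:
  "\<forall>\<^sub>F k in sequentially. 0 < ln (ln (real (square_scale k))) \<and> 0 < ln (ln (real (square_scale (Suc k)))) \<and>
    ln (ln (real (square_scale k))) \<le> ln (ln (real (square_scale (Suc k)))) \<and>
    ln (ln (real (square_scale (Suc k)))) \<le> 2 * ln (real k + 2)"
proof -
  have "\<forall>\<^sub>F k in sequentially. 1 < real (k * k) * ln 2" by real_asymp
  then show ?thesis using eventually_ge_at_top[of 1]
  proof eventually_elim
    case (elim k)
    have le: "real (k * k) * ln 2 \<le> real (Suc k * Suc k) * ln 2"
      by (intro mult_right_mono of_nat_mono mult_mono) auto
    have pos: "0 < real (Suc k * Suc k) * ln 2" using less_le_trans[OF less_trans[OF zero_less_one elim(1)] le] .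
    have "real (Suc k * Suc k) * ln 2 \<le> (real k + 2) ^ 2 * 1"
      using ln_2_less_1 by (intro mult_mono) (auto simp: power2_eq_square algebra_simps)
    then have "ln (real (Suc k * Suc k) * ln 2) \<le> ln ((real k + 2) ^ 2)"
      using pos by (intro ln_mono) simp_all
    also have "\<dots> = 2 * ln (real k + 2)" by (simp add: ln_realpow)
    finally have "ln (real (Suc k * Suc k) * ln 2) \<le> 2 * ln (real k + 2)" .
    moreover have "0 < ln (real (k * k) * ln 2)" using elim(1) by (rule ln_gt_zero)
    moreover have "ln (real (k * k) * ln 2) \<le> ln (real (Suc k * Suc k) * ln 2)"
      using le pos elim(1) by (intro ln_mono) linarith+
    ultimately show ?case unfolding ln_square_scale by linarith
  qed
qed

lemma frequently_square_scale:
  assumes "\<exists>\<^sub>F k in sequentially. P (square_scale (Suc k))"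
  shows "\<exists>\<^sub>F n in sequentially. P n"
  unfolding frequently_sequentially
proof
  fix m
  obtain k where "k \<ge> m" "P (square_scale (Suc k))" using assms unfolding frequently_sequentially by blast
  moreover have "Suc k \<le> square_scale (Suc k)" by (rule square_scale(5))
  ultimately show "\<exists>n\<ge>m. P n" by (intro exI[of _ "square_scale (Suc k)"]) auto
qed

context weighted_graph
begin

text \<open>The number of blocks is tuned so that the success probabilities of the segments dominate
  a multiple of the harmonic series.\<close>

lemma AE_segments_frequently:
  assumes "0 < \<delta>" "\<And>y n b. 1 \<le> b \<Longrightarrow> n0 * b \<le> n \<Longrightarrow> \<delta> ^ b \<le> pr (wpath n y) (Q n b)"
  shows "\<exists>\<epsilon>>0. \<forall>s. AE \<omega> in lamplighter_law s. \<exists>\<^sub>F k in sequentially.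
    Q (square_scale (Suc k) - square_scale k) (nat \<lceil>\<epsilon> * ln (real k + 2)\<rceil>)
      (map snd (map \<omega> [square_scale k..<Suc (square_scale (Suc k))]))"
proof -
  \<comment> \<open>Strictly below 1, so that \<open>ln \<delta>'\<close> is negative and
    \<open>\<epsilon>\<close> positive.\<close>
  define \<delta>' where "\<delta>' = min \<delta> (1 / 2)"
  have \<delta>': "0 < \<delta>'" "\<delta>' \<le> \<delta>" "\<delta>' < 1" using assms(1) by (auto simp: \<delta>'_def)
  \<comment> \<open>This makes \<open>\<delta>' powr (\<epsilon> * ln (k + 2))\<close> equal to
    \<open>1 / (k + 2)\<close>; rounding up costs one more factor \<open>\<delta>'\<close>.\<close>
  define \<epsilon> where "\<epsilon> = - 1 / ln \<delta>'"
  have \<epsilon>: "0 < \<epsilon>" "\<epsilon> * ln \<delta>' = - 1" using \<delta>' by (auto simp: \<epsilon>_def divide_neg_neg)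
  define b where "b k = nat \<lceil>\<epsilon> * ln (real k + 2)\<rceil>" for k
  define n where "n k = square_scale (Suc k) - square_scale k" for k
  \<comment> \<open>The value 0 is taken where the segment is too short for \<open>b k\<close>
    blocks, which happens for only finitely many \<open>k\<close>.\<close>
  define a where "a k = (if n0 * b k \<le> n k then \<delta>' ^ b k else 0)" for k
  have b: "1 \<le> b k" "real (b k) \<le> \<epsilon> * ln (real k + 2) + 1" for k
  proof -
    have "0 < \<epsilon> * ln (real k + 2)" using \<epsilon>(1) by (intro mult_pos_pos) auto
    then show "1 \<le> b k" "real (b k) \<le> \<epsilon> * ln (real k + 2) + 1" unfolding b_def by linarith+
  qed
  have pa: "a k \<le> pr (wpath (n k) y) (Q (n k) (b k))" for k y
  proof (cases "n0 * b k \<le> n k")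
    case True
    have "\<delta>' ^ b k \<le> \<delta> ^ b k" using \<delta>' by (intro power_mono) auto
    also have "\<dots> \<le> pr (wpath (n k) y) (Q (n k) (b k))" by (rule assms(2)[OF b(1) True])
    finally show ?thesis using True by (simp add: a_def)
  qed (simp add: a_def)
  have pa': "a k \<le> pr (wpath (square_scale (Suc k) - square_scale k) y) (Q (n k) (b k))" for k y
    using pa[of k y] by (subst n_def[symmetric])
  have "\<not> summable a"
  proof
    assume "summable a"
    have "\<forall>\<^sub>F k in sequentially. real n0 * (\<epsilon> * ln (real k + 2) + 1) \<le> 2 ^ k" using \<epsilon>(1) by real_asymp
    then have "\<forall>\<^sub>F k in sequentially. norm (\<delta>' * (1 / real (k + 2))) \<le> a k"
    proof eventually_elim
      case (elim k)
      have "real n0 * real (b k) \<le> real n0 * (\<epsilon> * ln (real k + 2) + 1)" by (rule mult_left_mono[OF b(2)]) simp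
      with elim have "real (n0 * b k) \<le> real (2 ^ k)" by simp
      then have "n0 * b k \<le> 2 ^ k" by (simp only: of_nat_le_iff)
      then have "n0 * b k \<le> n k" using square_scale(3)[of k] by (simp add: n_def)
      then have "a k = \<delta>' powr real (b k)" using \<delta>' by (simp add: a_def powr_realpow)
      moreover have "\<delta>' powr (\<epsilon> * ln (real k + 2) + 1) \<le> \<delta>' powr real (b k)"
        using powr_mono'[OF b(2)[of k], of \<delta>'] \<delta>' by simp
      moreover have "\<delta>' powr (\<epsilon> * ln (real k + 2) + 1) = \<delta>' * (1 / real (k + 2))"
      proof -
        have "\<delta>' powr (\<epsilon> * ln (real k + 2)) = exp ((\<epsilon> * ln \<delta>') * ln (real k + 2))"
          using \<delta>' by (simp add: powr_def mult.assoc mult.left_commute mult.commute)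
        also have "\<dots> = 1 / real (k + 2)" unfolding \<epsilon>(2) by (simp add: exp_minus inverse_eq_divide add.commute)
        finally show ?thesis using \<delta>' by (simp add: powr_add)
      qed
      ultimately show ?case using \<delta>' by simp
    qed
    then have "summable (\<lambda>k. \<delta>' * (1 / real (k + 2)))"
      using \<open>summable a\<close> by (rule summable_comparison_test_ev)
    then have "summable (\<lambda>k. (1 / \<delta>') * (\<delta>' * (1 / real (k + 2))))" by (rule summable_mult)
    then have "summable (\<lambda>k. 1 / real (k + 2))" using \<delta>' by simp
    then have "summable (\<lambda>k. 1 / real k)" using summable_iff_shift[of "\<lambda>k. 1 / real k" 2] by blast
    then have "summable (\<lambda>k. inverse (of_nat k :: real))" by (simp add: inverse_eq_divide)
    then show False using not_summable_harmonic[where 'a = real] by blast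
  qed
  moreover have "0 \<le> a k" for k using \<delta>' by (simp add: a_def)
  ultimately have "AE \<omega> in lamplighter_law s. \<exists>\<^sub>F k in sequentially.
    Q (n k) (b k) (map snd (map \<omega> [square_scale k..<Suc (square_scale (Suc k))]))" for s
    using AE_range_frequently[OF square_scale(1), where a = a and Q = "\<lambda>k. Q (n k) (b k)", OF pa'] by blast
  then show ?thesis using \<epsilon>(1) unfolding b_def n_def by blast
qed

end

section \<open>Iterated logarithm bounds for the range\<close>

context subdiffusive_graph
begin

abbreviation "upper_rate n \<equiv> real n powr \<alpha> * ln (ln (real n)) powr (1 - \<alpha>)"
abbreviation "lower_rate n \<equiv> real n powr \<alpha> * ln (ln (real n)) powr (- \<alpha>)"

lemma range_eventually_lower:
  "\<exists>B>0. \<forall>s. AE \<omega> in lamplighter_law s. \<forall>\<^sub>F n in sequentially. B * lower_rate n \<le> range_size \<omega> n"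
proof -
  obtain B where B: "B > 0" "\<And>x n b. 1 \<le> b \<Longrightarrow> b \<le> n \<Longrightarrow>
    pr (wpath n x) (\<lambda>l. real (card (set l)) < B * real n powr \<alpha> * real b powr (- \<alpha>)) \<le> exp (- 2 * real b)"
    using range_lower_tail_blocks by blast
  define b where "b k = nat \<lceil>ln (real k)\<rceil>" for k :: nat
  \<comment> \<open>\<open>2 ^ k\<close> is at least \<open>n / 2\<close>, and the number of blocks
    is at most \<open>4 * ln (ln n)\<close>.\<close>
  have B': "0 < B * (1 / 2) powr \<alpha> * 4 powr (- \<alpha>)" using B(1) by simp
  show ?thesis
  proof (rule exI[of _ "B * (1 / 2) powr \<alpha> * 4 powr (- \<alpha>)"], rule conjI[OF B'], rule allI)
    fix s
    have "AE \<omega> in lamplighter_law s. \<forall>\<^sub>F k in sequentially.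
      \<not> real (card (set (map snd (map \<omega> [0..<Suc (2 ^ k)])))) < B * real (2 ^ k) powr \<alpha> * real (b k) powr (- \<alpha>)"
      unfolding b_def
      by (rule AE_range_borel_cantelli[where Q = "\<lambda>k l. real (card (set l)) < B * real (2 ^ k) powr \<alpha> * real (nat \<lceil>ln (real k)\<rceil>) powr (- \<alpha>)"],
          rule summable_exp_log, intro conjI measure_nonneg B(2), assumption+)
    then show "AE \<omega> in lamplighter_law s. \<forall>\<^sub>F n in sequentially. B * (1 / 2) powr \<alpha> * 4 powr (- \<alpha>) * lower_rate n \<le> range_size \<omega> n"
    proof eventually_elim
      case (elim \<omega>)
      then have "\<forall>\<^sub>F k in sequentially. B * real (2 ^ k) powr \<alpha> * real (b k) powr (- \<alpha>) \<le> range_size \<omega> (2 ^ k)"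
        unfolding range_size_def not_less .
      then show ?case
      proof (rule eventually_dyadic_lower)
        show "\<forall>\<^sub>F k in sequentially. \<forall>n. 2 ^ k \<le> n \<and> n < 2 ^ Suc k \<longrightarrow>
          B * (1 / 2) powr \<alpha> * 4 powr (- \<alpha>) * lower_rate n \<le> B * real (2 ^ k) powr \<alpha> * real (b k) powr (- \<alpha>)"
          using eventually_loglog_dyadic
        proof eventually_elim
          case (elim k)
          show ?case
          proof (intro allI impI)
            fix n :: nat assume n: "2 ^ k \<le> n \<and> n < 2 ^ Suc k"
            have bk: "1 \<le> b k" "real (b k) \<le> 4 * ln (ln (real n))" using elim n unfolding b_def by auto
            have "real n \<le> real (2 ^ Suc k)" using n by (simp only: of_nat_le_iff less_imp_le)
            then have "(1 / 2 * real n) powr \<alpha> \<le> real (2 ^ k) powr \<alpha>" using \<alpha>_pos by (intro powr_mono2) auto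
            moreover have "(4 * ln (ln (real n))) powr (- \<alpha>) \<le> real (b k) powr (- \<alpha>)"
              using bk \<alpha>_pos by (intro powr_mono2') auto
            ultimately have "(1 / 2 * real n) powr \<alpha> * (4 * ln (ln (real n))) powr (- \<alpha>) \<le> real (2 ^ k) powr \<alpha> * real (b k) powr (- \<alpha>)"
              by (rule mult_mono) auto
            then have "B * ((1 / 2 * real n) powr \<alpha> * (4 * ln (ln (real n))) powr (- \<alpha>)) \<le> B * (real (2 ^ k) powr \<alpha> * real (b k) powr (- \<alpha>))"
              using B(1) by (intro mult_left_mono) auto
            then show "B * (1 / 2) powr \<alpha> * 4 powr (- \<alpha>) * lower_rate n \<le> B * real (2 ^ k) powr \<alpha> * real (b k) powr (- \<alpha>)"
              unfolding powr_mult by (simp only: ac_simps)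
          qed
        qed
      qed
    qed
  qed
qed

lemma range_eventually_upper:
  "\<exists>B>0. \<forall>s. AE \<omega> in lamplighter_law s. \<forall>\<^sub>F n in sequentially. range_size \<omega> n \<le> B * upper_rate n"
proof -
  obtain B where B: "B > 0" "\<And>x n b. 1 \<le> b \<Longrightarrow> b \<le> n \<Longrightarrow>
    pr (wpath n x) (\<lambda>l. B * real n powr \<alpha> * real b powr (1 - \<alpha>) \<le> real (card (set l))) \<le> exp (- 2 * real b)"
    using range_upper_tail by blast
  define b where "b k = nat \<lceil>ln (real k)\<rceil>" for k :: nat
  \<comment> \<open>The bound is taken at the right endpoint \<open>2 ^ Suc k \<le> 2 * n\<close>,
    again with at most \<open>4 * ln (ln n)\<close> blocks.\<close>
  have B': "0 < B * 2 powr \<alpha> * 4 powr (1 - \<alpha>)" using B(1) by simp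
  show ?thesis
  proof (rule exI[of _ "B * 2 powr \<alpha> * 4 powr (1 - \<alpha>)"], rule conjI[OF B'], rule allI)
    fix s
    have "AE \<omega> in lamplighter_law s. \<forall>\<^sub>F k in sequentially.
      \<not> B * real (2 ^ k) powr \<alpha> * real (b k) powr (1 - \<alpha>) \<le> real (card (set (map snd (map \<omega> [0..<Suc (2 ^ k)]))))"
      unfolding b_def
      by (rule AE_range_borel_cantelli[where Q = "\<lambda>k l. B * real (2 ^ k) powr \<alpha> * real (nat \<lceil>ln (real k)\<rceil>) powr (1 - \<alpha>) \<le> real (card (set l))"],
          rule summable_exp_log, intro conjI measure_nonneg B(2), assumption+)
    then show "AE \<omega> in lamplighter_law s. \<forall>\<^sub>F n in sequentially. range_size \<omega> n \<le> B * 2 powr \<alpha> * 4 powr (1 - \<alpha>) * upper_rate n"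
    proof eventually_elim
      case (elim \<omega>)
      then have "\<forall>\<^sub>F k in sequentially. range_size \<omega> (2 ^ k) \<le> B * real (2 ^ k) powr \<alpha> * real (b k) powr (1 - \<alpha>)"
        unfolding range_size_def by eventually_elim linarith
      then show ?case
      proof (rule eventually_dyadic_upper)
        show "\<forall>\<^sub>F k in sequentially. \<forall>n. 2 ^ k \<le> n \<and> n < 2 ^ Suc k \<longrightarrow>
          B * real (2 ^ Suc k) powr \<alpha> * real (b (Suc k)) powr (1 - \<alpha>) \<le> B * 2 powr \<alpha> * 4 powr (1 - \<alpha>) * upper_rate n"
          using eventually_loglog_dyadic
        proof eventually_elim
          case (elim k)
          show ?case
          proof (intro allI impI)
            fix n :: nat assume n: "2 ^ k \<le> n \<and> n < 2 ^ Suc k"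
            have bk: "real (b (Suc k)) \<le> 4 * ln (ln (real n))" using elim n unfolding b_def by auto
            have "real (2 ^ Suc k) \<le> real (2 * n)" using n by (intro of_nat_mono) simp
            then have "real (2 ^ Suc k) powr \<alpha> \<le> (2 * real n) powr \<alpha>" using \<alpha>_pos by (intro powr_mono2) auto
            moreover have "real (b (Suc k)) powr (1 - \<alpha>) \<le> (4 * ln (ln (real n))) powr (1 - \<alpha>)"
              using bk \<alpha>(2) by (intro powr_mono2) auto
            ultimately have "real (2 ^ Suc k) powr \<alpha> * real (b (Suc k)) powr (1 - \<alpha>) \<le> (2 * real n) powr \<alpha> * (4 * ln (ln (real n))) powr (1 - \<alpha>)"
              by (rule mult_mono) auto
            then have "B * (real (2 ^ Suc k) powr \<alpha> * real (b (Suc k)) powr (1 - \<alpha>)) \<le> B * ((2 * real n) powr \<alpha> * (4 * ln (ln (real n))) powr (1 - \<alpha>))"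
              using B(1) by (intro mult_left_mono) auto
            then show "B * real (2 ^ Suc k) powr \<alpha> * real (b (Suc k)) powr (1 - \<alpha>) \<le> B * 2 powr \<alpha> * 4 powr (1 - \<alpha>) * upper_rate n"
              unfolding powr_mult by (simp only: ac_simps)
          qed
        qed
      qed
    qed
  qed
qed

text \<open>One segment alone already has a large range, and it fills at least half of the time up
  to its end. The \<open>\<epsilon> / 2\<close> in the constant reflects that the iterated logarithm
  at that end is at most \<open>2 * ln (k + 2)\<close>.\<close>

lemma range_frequently_large:
  "\<exists>B>0. \<forall>s. AE \<omega> in lamplighter_law s. \<exists>\<^sub>F n in sequentially. B * upper_rate n \<le> range_size \<omega> n"
proof -
  obtain B \<delta> n0 where B: "B > 0" "\<delta> > 0" "\<And>x n b. 1 \<le> b \<Longrightarrow> n0 * b \<le> n \<Longrightarrow>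
    \<delta> ^ b \<le> pr (wpath n x) (\<lambda>l. B * real n powr \<alpha> * real b powr (1 - \<alpha>) \<le> real (card (set l)))"
    using large_range by blast
  from AE_segments_frequently[where Q = "\<lambda>n b l. B * real n powr \<alpha> * real b powr (1 - \<alpha>) \<le> real (card (set l))", OF B(2,3)]
  obtain \<epsilon> where \<epsilon>: "\<epsilon> > 0" "\<And>s. AE \<omega> in lamplighter_law s. \<exists>\<^sub>F k in sequentially.
    B * real (square_scale (Suc k) - square_scale k) powr \<alpha> * real (nat \<lceil>\<epsilon> * ln (real k + 2)\<rceil>) powr (1 - \<alpha>) \<le>
      real (card (set (map snd (map \<omega> [square_scale k..<Suc (square_scale (Suc k))]))))" by blast
  have B': "0 < B * (1 / 2) powr \<alpha> * (\<epsilon> / 2) powr (1 - \<alpha>)" using B(1) \<epsilon>(1) by simp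
  show ?thesis
  proof (rule exI[of _ "B * (1 / 2) powr \<alpha> * (\<epsilon> / 2) powr (1 - \<alpha>)"], rule conjI[OF B'], rule allI)
    fix s
    from \<epsilon>(2)[of s] show "AE \<omega> in lamplighter_law s. \<exists>\<^sub>F n in sequentially. B * (1 / 2) powr \<alpha> * (\<epsilon> / 2) powr (1 - \<alpha>) * upper_rate n \<le> range_size \<omega> n"
    proof eventually_elim
      case (elim \<omega>)
      show ?case
      proof (rule frequently_square_scale, rule frequently_rev_mp[OF elim], rule eventually_mono[OF loglog_square_scale], rule impI)
        fix k
        let ?N = "square_scale (Suc k)"
        assume ll: "0 < ln (ln (real (square_scale k))) \<and> 0 < ln (ln (real ?N)) \<and>
          ln (ln (real (square_scale k))) \<le> ln (ln (real ?N)) \<and> ln (ln (real ?N)) \<le> 2 * ln (real k + 2)"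
        assume seg: "B * real (?N - square_scale k) powr \<alpha> * real (nat \<lceil>\<epsilon> * ln (real k + 2)\<rceil>) powr (1 - \<alpha>) \<le>
          real (card (set (map snd (map \<omega> [square_scale k..<Suc ?N]))))"
        have "real ?N \<le> real (2 * (?N - square_scale k))" using square_scale(4) by (intro of_nat_mono)
        then have "(1 / 2 * real ?N) powr \<alpha> \<le> real (?N - square_scale k) powr \<alpha>" using \<alpha>_pos by (intro powr_mono2) auto
        moreover have "(\<epsilon> / 2 * ln (ln (real ?N))) powr (1 - \<alpha>) \<le> real (nat \<lceil>\<epsilon> * ln (real k + 2)\<rceil>) powr (1 - \<alpha>)"
        proof (rule powr_mono2)
          have "\<epsilon> / 2 * ln (ln (real ?N)) \<le> \<epsilon> / 2 * (2 * ln (real k + 2))" using ll \<epsilon>(1) by (intro mult_left_mono) auto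
          then show "\<epsilon> / 2 * ln (ln (real ?N)) \<le> real (nat \<lceil>\<epsilon> * ln (real k + 2)\<rceil>)" by linarith
        qed (use \<alpha> \<epsilon>(1) ll in auto)
        ultimately have "(1 / 2 * real ?N) powr \<alpha> * (\<epsilon> / 2 * ln (ln (real ?N))) powr (1 - \<alpha>) \<le>
            real (?N - square_scale k) powr \<alpha> * real (nat \<lceil>\<epsilon> * ln (real k + 2)\<rceil>) powr (1 - \<alpha>)"
          by (rule mult_mono) auto
        then have "B * ((1 / 2 * real ?N) powr \<alpha> * (\<epsilon> / 2 * ln (ln (real ?N))) powr (1 - \<alpha>)) \<le>
            B * (real (?N - square_scale k) powr \<alpha> * real (nat \<lceil>\<epsilon> * ln (real k + 2)\<rceil>) powr (1 - \<alpha>))"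
          using B(1) by (intro mult_left_mono) auto
        also have "\<dots> \<le> real (card (set (map snd (map \<omega> [square_scale k..<Suc ?N]))))"
          using seg by (simp only: mult.assoc)
        also have "\<dots> \<le> range_size \<omega> ?N"
          by (rule range_size_segment) (use monoD[OF square_scale(1)] in simp)
        finally show "B * (1 / 2) powr \<alpha> * (\<epsilon> / 2) powr (1 - \<alpha>) * upper_rate ?N \<le> range_size \<omega> ?N"
          unfolding powr_mult by (simp only: ac_simps)
      qed
    qed
  qed
qed

text \<open>A segment of small range is preceded by the path up to \<open>square_scale k\<close>.
  The almost sure upper bound at that time exceeds the desired rate by the iterated logarithm only,
  which the ratio \<open>2 ^ (2 * k + 1)\<close> of the two times, to the power
  \<open>\<alpha>\<close>, outweighs.\<close>

lemma range_frequently_small: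
  "\<exists>B>0. \<forall>s. AE \<omega> in lamplighter_law s. \<exists>\<^sub>F n in sequentially. range_size \<omega> n \<le> B * lower_rate n"
proof -
  obtain B \<delta> n0 where B: "B > 0" "\<delta> > 0" "\<And>x n b. 1 \<le> b \<Longrightarrow> n0 * b \<le> n \<Longrightarrow>
    \<delta> ^ b \<le> pr (wpath n x) (\<lambda>l. real (card (set l)) \<le> B * real n powr \<alpha> * real b powr (- \<alpha>))"
    using small_range by blast
  from AE_segments_frequently[where Q = "\<lambda>n b l. real (card (set l)) \<le> B * real n powr \<alpha> * real b powr (- \<alpha>)", OF B(2,3)]
  obtain \<epsilon> where \<epsilon>: "\<epsilon> > 0" "\<And>s. AE \<omega> in lamplighter_law s. \<exists>\<^sub>F k in sequentially.
      real (card (set (map snd (map \<omega> [square_scale k..<Suc (square_scale (Suc k))])))) \<le>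
      B * real (square_scale (Suc k) - square_scale k) powr \<alpha> * real (nat \<lceil>\<epsilon> * ln (real k + 2)\<rceil>) powr (- \<alpha>)" by blast
  obtain B2 where B2: "B2 > 0" "\<And>s. AE \<omega> in lamplighter_law s. \<forall>\<^sub>F n in sequentially. range_size \<omega> n \<le> B2 * upper_rate n"
    using range_eventually_upper by blast
  have B': "0 < B2 + B * (\<epsilon> / 2) powr (- \<alpha>)" using B(1) B2(1) \<epsilon>(1) by (simp add: add_pos_pos)
  show ?thesis
  proof (rule exI[of _ "B2 + B * (\<epsilon> / 2) powr (- \<alpha>)"], rule conjI[OF B'], rule allI)
    fix s
    from \<epsilon>(2)[of s] B2(2)[of s] show "AE \<omega> in lamplighter_law s. \<exists>\<^sub>F n in sequentially.
      range_size \<omega> n \<le> (B2 + B * (\<epsilon> / 2) powr (- \<alpha>)) * lower_rate n"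
    proof eventually_elim
      case (elim \<omega>)
      have "\<forall>\<^sub>F k in sequentially. 2 * ln (real k + 2) \<le> (2 powr (2 * real k + 1)) powr \<alpha>"
        using \<alpha>_pos by real_asymp
      moreover have "\<forall>\<^sub>F k in sequentially. range_size \<omega> (square_scale k) \<le> B2 * upper_rate (square_scale k)"
      proof -
        obtain m where "\<And>n. m \<le> n \<Longrightarrow> range_size \<omega> n \<le> B2 * upper_rate n"
          using elim(2) unfolding eventually_sequentially by blast
        then show ?thesis unfolding eventually_sequentially
          by (intro exI[of _ m]) (meson order_trans square_scale(5))
      qed
      ultimately have ev: "\<forall>\<^sub>F k in sequentially. 2 * ln (real k + 2) \<le> (2 powr (2 * real k + 1)) powr \<alpha> \<and>
        range_size \<omega> (square_scale k) \<le> B2 * upper_rate (square_scale k) \<and>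
        (0 < ln (ln (real (square_scale k))) \<and> 0 < ln (ln (real (square_scale (Suc k)))) \<and>
          ln (ln (real (square_scale k))) \<le> ln (ln (real (square_scale (Suc k)))) \<and>
          ln (ln (real (square_scale (Suc k)))) \<le> 2 * ln (real k + 2))"
        using loglog_square_scale by eventually_elim blast
      show ?case
      proof (rule frequently_square_scale, rule frequently_rev_mp[OF elim(1)], rule eventually_mono[OF ev], rule impI)
        fix k
        let ?N = "square_scale (Suc k)" and ?M = "square_scale k"
        let ?L = "ln (ln (real ?N))"
        assume ll: "2 * ln (real k + 2) \<le> (2 powr (2 * real k + 1)) powr \<alpha> \<and>
          range_size \<omega> ?M \<le> B2 * upper_rate ?M \<and>
          (0 < ln (ln (real ?M)) \<and> 0 < ?L \<and> ln (ln (real ?M)) \<le> ?L \<and> ?L \<le> 2 * ln (real k + 2))"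
        assume seg: "real (card (set (map snd (map \<omega> [?M..<Suc ?N])))) \<le>
          B * real (?N - ?M) powr \<alpha> * real (nat \<lceil>\<epsilon> * ln (real k + 2)\<rceil>) powr (- \<alpha>)"
        \<comment> \<open>Writing \<open>?L powr (1 - \<alpha>)\<close> as
          \<open>?L * ?L powr (- \<alpha>)\<close> isolates the surplus factor
          \<open>?L\<close>.\<close>
        have "ln (ln (real ?M)) powr (1 - \<alpha>) \<le> ?L powr (1 - \<alpha>)" using ll \<alpha> by (intro powr_mono2) auto
        also have "\<dots> = ?L * ?L powr (- \<alpha>)" using ll by (simp add: powr_diff powr_minus_divide)
        also have "\<dots> \<le> (2 powr (2 * real k + 1)) powr \<alpha> * ?L powr (- \<alpha>)" using ll by (intro mult_right_mono) auto
        finally have "upper_rate ?M \<le> real ?M powr \<alpha> * ((2 powr (2 * real k + 1)) powr \<alpha> * ?L powr (- \<alpha>))"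
          by (intro mult_left_mono) auto
        also have "\<dots> = lower_rate ?N"
        proof -
          have "(2::real) powr (2 * real k + 1) = 2 powr real (2 * k + 1)" by (simp add: add.commute)
          also have "\<dots> = 2 ^ (2 * k + 1)" by (rule powr_realpow) simp
          finally have e: "(2::real) powr (2 * real k + 1) = 2 ^ (2 * k + 1)" .
          have "real ?N = real ?M * 2 powr (2 * real k + 1)" unfolding e square_scale(6)[of k] by simp
          then show ?thesis by (simp only: powr_mult mult.assoc)
        qed
        finally have "B2 * upper_rate ?M \<le> B2 * lower_rate ?N" using B2(1) by (intro mult_left_mono) auto
        then have 1: "range_size \<omega> ?M \<le> B2 * lower_rate ?N" using ll by linarith
        have "real (?N - ?M) powr \<alpha> \<le> real ?N powr \<alpha>" using \<alpha>_pos by (intro powr_mono2) auto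
        moreover have "real (nat \<lceil>\<epsilon> * ln (real k + 2)\<rceil>) powr (- \<alpha>) \<le> (\<epsilon> / 2 * ?L) powr (- \<alpha>)"
        proof (rule powr_mono2')
          have "\<epsilon> / 2 * ?L \<le> \<epsilon> / 2 * (2 * ln (real k + 2))" using ll \<epsilon>(1) by (intro mult_left_mono) auto
          then show "\<epsilon> / 2 * ?L \<le> real (nat \<lceil>\<epsilon> * ln (real k + 2)\<rceil>)" by linarith
        qed (use \<alpha>_pos \<epsilon>(1) ll in auto)
        ultimately have "real (?N - ?M) powr \<alpha> * real (nat \<lceil>\<epsilon> * ln (real k + 2)\<rceil>) powr (- \<alpha>) \<le> real ?N powr \<alpha> * (\<epsilon> / 2 * ?L) powr (- \<alpha>)"
          by (rule mult_mono) auto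
        then have "B * (real (?N - ?M) powr \<alpha> * real (nat \<lceil>\<epsilon> * ln (real k + 2)\<rceil>) powr (- \<alpha>)) \<le> B * (real ?N powr \<alpha> * (\<epsilon> / 2 * ?L) powr (- \<alpha>))"
          using B(1) by (intro mult_left_mono) auto
        then have 2: "real (card (set (map snd (map \<omega> [?M..<Suc ?N])))) \<le> B * (\<epsilon> / 2) powr (- \<alpha>) * lower_rate ?N"
          using seg unfolding powr_mult[of "\<epsilon> / 2"] by (simp only: ac_simps)
        have "range_size \<omega> ?N \<le> range_size \<omega> ?M + real (card (set (map snd (map \<omega> [?M..<Suc ?N]))))"
          by (rule range_size_segment) (use monoD[OF square_scale(1)] in simp)
        with 1 2 show "range_size \<omega> ?N \<le> (B2 + B * (\<epsilon> / 2) powr (- \<alpha>)) * lower_rate ?N"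
          by (simp only: distrib_right)
      qed
    qed
  qed
qed

lemma subdiffusive_dist:
  "\<exists>c1>0. \<exists>c2>0. \<exists>c3>0. \<exists>c4>0. \<forall>s. AE \<omega> in lamplighter_law s.
    (\<exists>\<^sub>F n in sequentially. c1 * upper_rate n \<le> wreath_dist \<omega> n) \<and>
    (\<forall>\<^sub>F n in sequentially. wreath_dist \<omega> n \<le> c2 * upper_rate n) \<and>
    (\<forall>\<^sub>F n in sequentially. c3 * lower_rate n \<le> wreath_dist \<omega> n) \<and>
    (\<exists>\<^sub>F n in sequentially. wreath_dist \<omega> n \<le> c4 * lower_rate n)"
proof -
  obtain b1 where b1: "b1 > 0" "\<And>s. AE \<omega> in lamplighter_law s. \<exists>\<^sub>F n in sequentially. b1 * upper_rate n \<le> range_size \<omega> n"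
    using range_frequently_large by blast
  obtain b2 where b2: "b2 > 0" "\<And>s. AE \<omega> in lamplighter_law s. \<forall>\<^sub>F n in sequentially. range_size \<omega> n \<le> b2 * upper_rate n"
    using range_eventually_upper by blast
  obtain b3 where b3: "b3 > 0" "\<And>s. AE \<omega> in lamplighter_law s. \<forall>\<^sub>F n in sequentially. b3 * lower_rate n \<le> range_size \<omega> n"
    using range_eventually_lower by blast
  obtain b4 where b4: "b4 > 0" "\<And>s. AE \<omega> in lamplighter_law s. \<exists>\<^sub>F n in sequentially. range_size \<omega> n \<le> b4 * lower_rate n"
    using range_frequently_small by blast
  have "AE \<omega> in lamplighter_law s.
    (\<exists>\<^sub>F n in sequentially. b1 / 4 * upper_rate n \<le> wreath_dist \<omega> n) \<and>
    (\<forall>\<^sub>F n in sequentially. wreath_dist \<omega> n \<le> 8 * b2 * upper_rate n) \<and>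
    (\<forall>\<^sub>F n in sequentially. b3 / 4 * lower_rate n \<le> wreath_dist \<omega> n) \<and>
    (\<exists>\<^sub>F n in sequentially. wreath_dist \<omega> n \<le> 8 * b4 * lower_rate n)" for s
  proof -
    \<comment> \<open>The lower rate is a positive power of \<open>n\<close> up to iterated
      logarithms, so it beats the logarithmic threshold below which the lamps are not
      controlled.\<close>
    have *: "\<forall>\<^sub>F n in sequentially. 20 * ln (real n + 1) + 1 \<le> b3 * lower_rate n"
      using b3(1) \<alpha>_pos \<alpha>(2) by real_asymp
    have "AE \<omega> in lamplighter_law s. \<forall>\<^sub>F n in sequentially. 20 * ln (real n + 1) + 1 \<le> range_size \<omega> n"
      using b3(2)[of s]
    proof eventually_elim
      case (elim \<omega>)
      from * elim show ?case by eventually_elim linarith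
    qed
    from AE_dist_range_comparable[OF this] b1(2)[of s] b2(2)[of s] b3(2)[of s] b4(2)[of s]
    show ?thesis
    proof eventually_elim
      case (elim \<omega>)
      then have up: "wreath_dist \<omega> n \<le> 8 * range_size \<omega> n" for n by blast
      have low: "\<forall>\<^sub>F n in sequentially. range_size \<omega> n \<le> 4 * wreath_dist \<omega> n" using elim(1) by blast
      show ?case
      proof (intro conjI)
        show "\<exists>\<^sub>F n in sequentially. b1 / 4 * upper_rate n \<le> wreath_dist \<omega> n"
          by (rule frequently_rev_mp[OF elim(2)], rule eventually_mono[OF low]) linarith
        show "\<forall>\<^sub>F n in sequentially. wreath_dist \<omega> n \<le> 8 * b2 * upper_rate n"
          using elim(3)
        proof eventually_elim
          case (elim n) then show ?case using up[of n] by linarith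
        qed
        show "\<forall>\<^sub>F n in sequentially. b3 / 4 * lower_rate n \<le> wreath_dist \<omega> n"
          using elim(4) low by eventually_elim linarith
        show "\<exists>\<^sub>F n in sequentially. wreath_dist \<omega> n \<le> 8 * b4 * lower_rate n"
        proof (rule frequently_elim1[OF elim(5)])
          fix n assume "range_size \<omega> n \<le> b4 * lower_rate n"
          then show "wreath_dist \<omega> n \<le> 8 * b4 * lower_rate n" using up[of n] by linarith
        qed
      qed
    qed
  qed
  moreover have "b1 / 4 > 0" "8 * b2 > 0" "b3 / 4 > 0" "8 * b4 > 0" using b1(1) b2(1) b3(1) b4(1) by auto
  ultimately show ?thesis by blast
qed

end

section \<open>From eventual and frequent bounds to upper and lower limits\<close>

lemma limsup_ge_frequently:
  fixes u r :: "nat \<Rightarrow> real"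
  assumes "\<exists>\<^sub>F n in sequentially. c * r n \<le> u n" "\<forall>\<^sub>F n in sequentially. 0 < r n"
  shows "ereal c \<le> limsup (\<lambda>n. ereal (u n / r n))"
  unfolding limsup_INF_SUP
proof (rule INF_greatest)
  fix m
  have "\<exists>\<^sub>F n in sequentially. c \<le> u n / r n"
    by (rule frequently_rev_mp[OF assms(1)], rule eventually_mono[OF assms(2)]) (simp add: field_simps)
  then obtain n where "n \<ge> m" "c \<le> u n / r n" unfolding frequently_sequentially by blast
  then show "ereal c \<le> (SUP n\<in>{m..}. ereal (u n / r n))" by (intro SUP_upper2[of n]) auto
qed

lemma liminf_le_frequently:
  fixes u r :: "nat \<Rightarrow> real"
  assumes "\<exists>\<^sub>F n in sequentially. u n \<le> c * r n" "\<forall>\<^sub>F n in sequentially. 0 < r n"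
  shows "liminf (\<lambda>n. ereal (u n / r n)) \<le> ereal c"
  unfolding liminf_SUP_INF
proof (rule SUP_least)
  fix m
  have "\<exists>\<^sub>F n in sequentially. u n / r n \<le> c"
    by (rule frequently_rev_mp[OF assms(1)], rule eventually_mono[OF assms(2)]) (simp add: field_simps)
  then obtain n where "n \<ge> m" "u n / r n \<le> c" unfolding frequently_sequentially by blast
  then show "(INF n\<in>{m..}. ereal (u n / r n)) \<le> ereal c" by (intro INF_lower2[of n]) auto
qed

lemma limsup_le_eventually:
  fixes u r :: "nat \<Rightarrow> real"
  assumes "\<forall>\<^sub>F n in sequentially. u n \<le> c * r n" "\<forall>\<^sub>F n in sequentially. 0 < r n"
  shows "limsup (\<lambda>n. ereal (u n / r n)) \<le> ereal c"
  by (rule Limsup_bounded) (use assms in eventually_elim, simp add: field_simps)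

lemma liminf_ge_eventually:
  fixes u r :: "nat \<Rightarrow> real"
  assumes "\<forall>\<^sub>F n in sequentially. c * r n \<le> u n" "\<forall>\<^sub>F n in sequentially. 0 < r n"
  shows "ereal c \<le> liminf (\<lambda>n. ereal (u n / r n))"
  by (rule Liminf_bounded) (use assms in eventually_elim, simp add: field_simps)

section \<open>Reduction of the hypotheses\<close>

context weighted_graph
begin

lemma gball_0: "gball E x 0 = {x}"
  using mem_gball[of _ x 0] by (auto simp: gdist_eq_0)

lemma vol_0: "vol E \<mu> x 0 = mass \<mu> x"
  by (simp add: vol_def gball_0)

lemma gball_floor: "0 \<le> r \<Longrightarrow> gball E x r = gball E x (real (nat \<lfloor>r\<rfloor>))"
proof -
  assume r: "0 \<le> r"
  have "real m \<le> r \<longleftrightarrow> real m \<le> real (nat \<lfloor>r\<rfloor>)" for m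
  proof
    assume "real m \<le> r"
    then show "real m \<le> real (nat \<lfloor>r\<rfloor>)" using le_nat_floor by (simp only: of_nat_le_iff)
  next
    assume "real m \<le> real (nat \<lfloor>r\<rfloor>)"
    with r show "real m \<le> r" by linarith
  qed
  then show ?thesis unfolding gball_def by blast
qed

text \<open>At \<open>r = 0\<close> the ball is a single vertex, and the convention for the zeroth
  power bounds every mass between two positive constants.\<close>

lemma df_set_bounds:
  assumes "df_set_condition E \<mu> D"
  obtains k K where "0 < k" "0 < K" "\<And>x. k \<le> mass \<mu> x" "\<And>x. mass \<mu> x \<le> K"
    "\<And>x r. 1 \<le> r \<Longrightarrow> k * real r powr D \<le> vol E \<mu> x (real r)"
    "\<And>x r. 1 \<le> r \<Longrightarrow> vol E \<mu> x (real r) \<le> K * real r powr D"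
proof -
  obtain k K where kK: "0 < k" "0 < K" and v: "\<And>x r. k * (if r = 0 then 1 else real r powr D) \<le> vol E \<mu> x (real r)"
    "\<And>x r. vol E \<mu> x (real r) \<le> K * (if r = 0 then 1 else real r powr D)"
    using assms unfolding df_set_condition_def by blast
  show ?thesis
  proof (rule that[OF kK])
    fix x r
    show "k \<le> mass \<mu> x" "mass \<mu> x \<le> K" using v(1)[of 0 x] v(2)[of x 0] by (simp_all add: vol_0)
    show "k * real r powr D \<le> vol E \<mu> x (real r)" "vol E \<mu> x (real r) \<le> K * real r powr D" if "1 \<le> r"
      using v(1)[of r x] v(2)[of x r] that by simp_all
  qed
qed

text \<open>Bounded masses make counting and volume comparable and turn densities into transition
  probabilities, at the price of constants that are quotients of \<open>k\<close> and
  \<open>K\<close>.\<close>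

lemma subdiffusive_graphI:
  assumes df: "df_set_condition E \<mu> D" and sg: "sub_gaussian_estimates E \<mu> \<beta>" and lt: "D / \<beta> < 1"
  shows "\<exists>A a c C v V. subdiffusive_graph E \<mu> D \<beta> (D / \<beta>) A a c C v V"
proof -
  obtain k K where kK: "0 < k" "0 < K" and mass: "\<And>x. k \<le> mass \<mu> x" "\<And>x. mass \<mu> x \<le> K"
    and vol: "\<And>x r. 1 \<le> r \<Longrightarrow> k * real r powr D \<le> vol E \<mu> x (real r)"
      "\<And>x r. 1 \<le> r \<Longrightarrow> vol E \<mu> x (real r) \<le> K * real r powr D"
    using df_set_bounds[OF df] by metis
  have D: "0 < D" using df by (simp add: df_set_condition_def)
  obtain c1 c2 c3 c4 where \<beta>: "1 < \<beta>" and c: "0 < c1" "0 < c2" "0 < c3" "0 < c4"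
    and ub: "\<And>x y n. 1 \<le> n \<Longrightarrow> step_prob \<mu> n x y / mass \<mu> y
          \<le> c1 / vol E \<mu> x (real n powr (1 / \<beta>)) * exp (- c2 * (real (gdist E x y) powr \<beta> / real n) powr (1 / (\<beta> - 1)))"
    and lb: "\<And>x y n. 1 \<le> n \<Longrightarrow> gdist E x y \<le> n \<Longrightarrow>
        c3 / vol E \<mu> x (real n powr (1 / \<beta>)) * exp (- c4 * (real (gdist E x y) powr \<beta> / real n) powr (1 / (\<beta> - 1)))
        \<le> step_prob \<mu> n x y / mass \<mu> y + step_prob \<mu> (n + 1) x y / mass \<mu> y"
    using sg unfolding sub_gaussian_estimates_def by blast
  \<comment> \<open>The volume condition speaks of integer radii. Rounding
    \<open>n powr (1 / \<beta>)\<close>, which is at least 1, down to an integer loses at most a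
    factor 2, hence \<open>(1 / 2) powr D\<close>.\<close>
  have scale: "k * (1 / 2) powr D * real n powr (D / \<beta>) \<le> vol E \<mu> x (real n powr (1 / \<beta>))"
    "vol E \<mu> x (real n powr (1 / \<beta>)) \<le> K * real n powr (D / \<beta>)" if n: "1 \<le> n" for x n
  proof -
    define z where "z = real n powr (1 / \<beta>)"
    have z: "1 \<le> z" unfolding z_def using n \<beta> by (intro ge_one_powr_ge_zero) auto
    have zD: "z powr D = real n powr (D / \<beta>)" by (simp add: z_def powr_powr)
    define r where "r = nat \<lfloor>z\<rfloor>"
    have r: "1 \<le> r" "real r \<le> z" "1 / 2 * z \<le> real r" proof -
      have "1 \<le> \<lfloor>z\<rfloor>" using z by simp
      then show "1 \<le> r" "real r \<le> z" "1 / 2 * z \<le> real r" unfolding r_def by linarith+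
    qed
    have v: "vol E \<mu> x z = vol E \<mu> x (real r)" unfolding vol_def using gball_floor[of z x] z by (simp add: r_def)
    have "(1 / 2 * z) powr D \<le> real r powr D" using r D z by (intro powr_mono2) auto
    then have "k * ((1 / 2) powr D * z powr D) \<le> k * real r powr D" unfolding powr_mult using kK by (intro mult_left_mono) auto
    also have "\<dots> \<le> vol E \<mu> x z" unfolding v by (rule vol(1)[OF r(1)])
    finally show "k * (1 / 2) powr D * real n powr (D / \<beta>) \<le> vol E \<mu> x (real n powr (1 / \<beta>))"
      unfolding zD unfolding z_def by simp
    have "vol E \<mu> x z \<le> K * real r powr D" unfolding v by (rule vol(2)[OF r(1)])
    also have "\<dots> \<le> K * z powr D" using r D kK by (intro mult_left_mono powr_mono2) auto
    finally show "vol E \<mu> x (real n powr (1 / \<beta>)) \<le> K * real n powr (D / \<beta>)"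
      unfolding zD unfolding z_def .
  qed
  have "subdiffusive_graph E \<mu> D \<beta> (D / \<beta>) (K * c1 / (k * (1 / 2) powr D)) (k * c3 / K) c2 c4 (k / K) (K / k)"
  \<comment> \<open>Goals 11 and 12 are \<open>card_ball\<close>, 13 and 14 are \<open>upper\<close>
    and \<open>lower\<close>; the others are conditions on the constants.\<close>
  proof (unfold_locales, goal_cases)
    case (11 r x)
    have "k * real r powr D \<le> vol E \<mu> x (real r)" using vol(1) 11 by blast
    also have "\<dots> \<le> (\<Sum>y\<in>gball E x (real r). K)" unfolding vol_def by (intro sum_mono mass)
    finally show ?case using kK by (simp add: field_simps)
  next
    case (12 r x)
    have "(\<Sum>y\<in>gball E x (real r). k) \<le> vol E \<mu> x (real r)" unfolding vol_def by (intro sum_mono mass)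
    also have "\<dots> \<le> K * real r powr D" using vol(2) 12 by blast
    finally show ?case using kK by (simp add: field_simps)
  next
    case (13 n x y)
    let ?e = "exp (- c2 * (real (gdist E x y) powr \<beta> / real n) powr (1 / (\<beta> - 1)))"
    have den: "0 < k * (1 / 2) powr D * real n powr (D / \<beta>)" using kK 13 by simp
    then have vpos: "0 < vol E \<mu> x (real n powr (1 / \<beta>))" using scale(1)[OF 13, of x] by linarith
    have "p n x y = step_prob \<mu> n x y / mass \<mu> y * mass \<mu> y" using mass_pos[of y] by (simp add: step_prob_eq)
    also have "\<dots> \<le> (c1 / vol E \<mu> x (real n powr (1 / \<beta>)) * ?e) * mass \<mu> y"
      using ub[OF 13, of x y] mass_pos[of y] by (intro mult_right_mono) auto
    also have "\<dots> \<le> (c1 / (k * (1 / 2) powr D * real n powr (D / \<beta>)) * ?e) * K"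
      using scale(1)[OF 13, of x] den vpos c kK mass(2)[of y] mass_pos[of y] 13
      by (intro mult_mono mult_right_mono divide_left_mono mult_pos_pos) (auto intro: order_trans less_le_trans)
    also have "\<dots> = K * c1 / (k * (1 / 2) powr D) * real n powr (- (D / \<beta>)) * ?e"
      by (simp add: powr_minus_divide)
    finally show ?case .
  next
    case (14 n x y)
    let ?e = "exp (- c4 * (real (gdist E x y) powr \<beta> / real n) powr (1 / (\<beta> - 1)))"
    have "0 < k * (1 / 2) powr D * real n powr (D / \<beta>)" using kK 14 by simp
    then have vpos: "0 < vol E \<mu> x (real n powr (1 / \<beta>))" using scale(1)[OF 14(1), of x] by linarith
    have "k * c3 / K * real n powr (- (D / \<beta>)) * ?e = (c3 / (K * real n powr (D / \<beta>)) * ?e) * k"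
      by (simp add: powr_minus_divide)
    also have "\<dots> \<le> (c3 / vol E \<mu> x (real n powr (1 / \<beta>)) * ?e) * mass \<mu> y"
      using scale(2)[OF 14(1), of x] vpos c kK mass(1)[of y] 14(1)
      by (intro mult_mono mult_right_mono divide_left_mono mult_pos_pos) auto
    also have "\<dots> \<le> (step_prob \<mu> n x y / mass \<mu> y + step_prob \<mu> (n + 1) x y / mass \<mu> y) * mass \<mu> y"
      using lb[OF 14] mass_pos[of y] by (intro mult_right_mono) auto
    also have "\<dots> = p n x y + p (n + 1) x y" using mass_pos[of y]
      unfolding step_prob_eq by (simp add: distrib_right)
    finally show ?case .
  qed (use \<beta> D c kK lt in simp_all)
  then show ?thesis by blast
qed

lemma recurrent_case:
  assumes "df_set_condition E \<mu> D" "sub_gaussian_estimates E \<mu> \<beta>" "ds / 2 = D / \<beta>" "ds / 2 < 1"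
  shows "\<exists>c1>0. \<exists>c2>0. \<exists>c3>0. \<exists>c4>0. \<forall>x.
        (AE Y in lamplighter_law x.
          ereal c1 \<le> limsup (\<lambda>n. ereal (real (gdist (wreath_adj E) (Y 0) (Y n)) /
              (real n powr (ds / 2) * ln (ln (real n)) powr (1 - ds / 2)))) \<and>
          limsup (\<lambda>n. ereal (real (gdist (wreath_adj E) (Y 0) (Y n)) /
              (real n powr (ds / 2) * ln (ln (real n)) powr (1 - ds / 2)))) \<le> ereal c2) \<and>
        (AE Y in lamplighter_law x.
          ereal c3 \<le> liminf (\<lambda>n. ereal (real (gdist (wreath_adj E) (Y 0) (Y n)) /
              (real n powr (ds / 2) * ln (ln (real n)) powr (- ds / 2)))) \<and>
          liminf (\<lambda>n. ereal (real (gdist (wreath_adj E) (Y 0) (Y n)) /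
              (real n powr (ds / 2) * ln (ln (real n)) powr (- ds / 2)))) \<le> ereal c4)"
proof -
  obtain A a c C v V where "subdiffusive_graph E \<mu> D \<beta> (D / \<beta>) A a c C v V"
    using subdiffusive_graphI[OF assms(1,2)] assms(3,4) by auto
  then interpret S: subdiffusive_graph E \<mu> D \<beta> "D / \<beta>" A a c C v V .
  have ev: "\<forall>\<^sub>F n in sequentially. 0 < S.upper_rate n" "\<forall>\<^sub>F n in sequentially. 0 < S.lower_rate n"
  proof -
    have ll: "\<forall>\<^sub>F n in sequentially. 0 < ln (ln (real n))" by real_asymp
    from ll show "\<forall>\<^sub>F n in sequentially. 0 < S.upper_rate n" "\<forall>\<^sub>F n in sequentially. 0 < S.lower_rate n"
      using eventually_gt_at_top[of 0] by (eventually_elim, simp)+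
  qed
  \<comment> \<open>The exponent in the statement parses as \<open>(- ds) / 2\<close>.\<close>
  have minus: "- ds / 2 = - (D / \<beta>)" using assms(3) by simp
  obtain c1 c2 c3 c4 where c: "c1 > 0" "c2 > 0" "c3 > 0" "c4 > 0" and AE: "\<And>s. AE \<omega> in lamplighter_law s.
    (\<exists>\<^sub>F n in sequentially. c1 * S.upper_rate n \<le> wreath_dist \<omega> n) \<and>
    (\<forall>\<^sub>F n in sequentially. wreath_dist \<omega> n \<le> c2 * S.upper_rate n) \<and>
    (\<forall>\<^sub>F n in sequentially. c3 * S.lower_rate n \<le> wreath_dist \<omega> n) \<and>
    (\<exists>\<^sub>F n in sequentially. wreath_dist \<omega> n \<le> c4 * S.lower_rate n)"
    using S.subdiffusive_dist by blast
  show ?thesis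
    unfolding minus assms(3)
  proof (rule exI[of _ c1], rule conjI[OF c(1)], rule exI[of _ c2], rule conjI[OF c(2)],
      rule exI[of _ c3], rule conjI[OF c(3)], rule exI[of _ c4], rule conjI[OF c(4)], rule allI, rule conjI)
    fix x
    show "AE Y in lamplighter_law x. ereal c1 \<le> limsup (\<lambda>n. ereal (wreath_dist Y n / S.upper_rate n)) \<and>
        limsup (\<lambda>n. ereal (wreath_dist Y n / S.upper_rate n)) \<le> ereal c2"
      using AE[of x] by eventually_elim (intro conjI limsup_ge_frequently limsup_le_eventually ev; blast)
    show "AE Y in lamplighter_law x. ereal c3 \<le> liminf (\<lambda>n. ereal (wreath_dist Y n / S.lower_rate n)) \<and>
        liminf (\<lambda>n. ereal (wreath_dist Y n / S.lower_rate n)) \<le> ereal c4"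
      using AE[of x] by eventually_elim (intro conjI liminf_ge_eventually liminf_le_frequently ev; blast)
  qed
qed

lemma transient_case:
  assumes "df_set_condition E \<mu> D" "on_diagonal_upper_bound \<mu> ds" "ds / 2 > 1"
  shows "\<exists>c1>0. \<exists>c2>0. \<forall>x.
        AE Y in lamplighter_law x.
          ereal c1 \<le> liminf (\<lambda>n. ereal (real (gdist (wreath_adj E) (Y 0) (Y n)) / real n)) \<and>
          liminf (\<lambda>n. ereal (real (gdist (wreath_adj E) (Y 0) (Y n)) / real n)) \<le>
            limsup (\<lambda>n. ereal (real (gdist (wreath_adj E) (Y 0) (Y n)) / real n)) \<and>
          limsup (\<lambda>n. ereal (real (gdist (wreath_adj E) (Y 0) (Y n)) / real n)) \<le> ereal c2"
proof -
  obtain k K where K: "0 < K" "\<And>x. mass \<mu> x \<le> K" using df_set_bounds[OF assms(1)] by metis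
  obtain c1 where c1: "0 < c1" "\<And>n x y. 1 \<le> n \<Longrightarrow> step_prob \<mu> n x y / mass \<mu> y \<le> c1 * real n powr (- ds / 2)"
    using assms(2) unfolding on_diagonal_upper_bound_def by blast
  have "p n x y \<le> c1 * K * real n powr (- (ds / 2))" if "1 \<le> n" for n x y
  proof -
    have "p n x y = step_prob \<mu> n x y / mass \<mu> y * mass \<mu> y" using mass_pos[of y] by (simp add: step_prob_eq)
    also have "\<dots> \<le> c1 * real n powr (- ds / 2) * K"
      using c1(2)[OF that, of x y] c1(1) K(2)[of y] mass_pos[of y] by (intro mult_mono) auto
    finally show ?thesis by (simp add: mult.commute mult.left_commute)
  qed
  from transient_dist[OF assms(3) _ this] obtain c where c: "0 < c" and AE: "\<And>s. AE \<omega> in lamplighter_law s.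
    (\<forall>n. wreath_dist \<omega> n \<le> 8 * (real n + 1)) \<and> (\<forall>\<^sub>F n in sequentially. c * real n \<le> wreath_dist \<omega> n)"
    using c1(1) K(1) by auto
  have pos: "\<forall>\<^sub>F n in sequentially. 0 < real n" by real_asymp
  show ?thesis
  \<comment> \<open>The range has at most \<open>n + 1\<close> sites, and
    \<open>8 * (n + 1) \<le> 16 * n\<close> for \<open>n \<ge> 1\<close>.\<close>
  proof (rule exI[of _ c], rule conjI[OF c], rule exI[of _ 16], rule conjI, simp, rule allI)
    fix x
    from AE[of x] show "AE Y in lamplighter_law x.
          ereal c \<le> liminf (\<lambda>n. ereal (wreath_dist Y n / real n)) \<and>
          liminf (\<lambda>n. ereal (wreath_dist Y n / real n)) \<le> limsup (\<lambda>n. ereal (wreath_dist Y n / real n)) \<and>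
          limsup (\<lambda>n. ereal (wreath_dist Y n / real n)) \<le> ereal 16"
    proof eventually_elim
      case (elim Y)
      have "\<forall>\<^sub>F n in sequentially. wreath_dist Y n \<le> 16 * real n"
        using eventually_ge_at_top[of 1]
      proof eventually_elim
        case (elim n)
        have "wreath_dist Y n \<le> 8 * (real n + 1)" using \<open>_ \<and> _\<close> by blast
        also have "\<dots> \<le> 16 * real n" using elim by simp
        finally show ?case .
      qed
      then show ?case
        using elim by (intro conjI liminf_ge_eventually limsup_le_eventually pos Liminf_le_Limsup) auto
    qed
  qed
qed

end

theorem theorem2p4:
  fixes E :: "'v \<Rightarrow> 'v \<Rightarrow> bool" and \<mu> :: "'v \<Rightarrow> 'v \<Rightarrow> real"
  assumes "weighted_graph E \<mu>"
  shows
    "(\<forall>df dw ds. p0_condition E \<mu> \<and> df_set_condition E \<mu> df \<and> sub_gaussian_estimates E \<mu> dw \<and>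
        ds / 2 = df / dw \<and> ds / 2 < 1 \<longrightarrow>
      (\<exists>c1>0. \<exists>c2>0. \<exists>c3>0. \<exists>c4>0. \<forall>x :: 'v lamp_state.
        (AE Y in chain_law (lamplighter_kernel \<mu>) x.
          ereal c1 \<le> limsup (\<lambda>n. ereal (real (gdist (wreath_adj E) (Y 0) (Y n)) /
              (real n powr (ds / 2) * ln (ln (real n)) powr (1 - ds / 2)))) \<and>
          limsup (\<lambda>n. ereal (real (gdist (wreath_adj E) (Y 0) (Y n)) /
              (real n powr (ds / 2) * ln (ln (real n)) powr (1 - ds / 2)))) \<le> ereal c2) \<and>
        (AE Y in chain_law (lamplighter_kernel \<mu>) x.
          ereal c3 \<le> liminf (\<lambda>n. ereal (real (gdist (wreath_adj E) (Y 0) (Y n)) /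
              (real n powr (ds / 2) * ln (ln (real n)) powr (- ds / 2)))) \<and>
          liminf (\<lambda>n. ereal (real (gdist (wreath_adj E) (Y 0) (Y n)) /
              (real n powr (ds / 2) * ln (ln (real n)) powr (- ds / 2)))) \<le> ereal c4)))
     \<and>
     (\<forall>df ds. p0_condition E \<mu> \<and> df_set_condition E \<mu> df \<and> on_diagonal_upper_bound \<mu> ds \<and>
        ds / 2 > 1 \<longrightarrow>
      (\<exists>c1>0. \<exists>c2>0. \<forall>x :: 'v lamp_state.
        AE Y in chain_law (lamplighter_kernel \<mu>) x.
          ereal c1 \<le> liminf (\<lambda>n. ereal (real (gdist (wreath_adj E) (Y 0) (Y n)) / real n)) \<and>
          liminf (\<lambda>n. ereal (real (gdist (wreath_adj E) (Y 0) (Y n)) / real n)) \<le>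
            limsup (\<lambda>n. ereal (real (gdist (wreath_adj E) (Y 0) (Y n)) / real n)) \<and>
          limsup (\<lambda>n. ereal (real (gdist (wreath_adj E) (Y 0) (Y n)) / real n)) \<le> ereal c2))"
proof -
  interpret weighted_graph E \<mu> by (rule assms)
  show ?thesis
    by (intro conjI allI impI; elim conjE)
      (rule recurrent_case transient_case; assumption)+
qed

end
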